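(* The set $\mathsf{A} \in \mathcal{K}(\mathit{GL}_d(\mathbb{R}))$ is a point of continuity of the function $\check{\varrho} \colon \mathcal{K}(\mathit{GL}_d(\mathbb{R})) \to \mathbb{R}_+$ if and only if $$\check{\varrho}(\mathsf{A}) = \check{\varrho}\left(\wedge^{\ell(\mathsf{A})} \mathsf{A}\right)^{1/\ell(\mathsf{A})}.$$
   Context: $\mathcal{K}(\mathit{GL}_d(\mathbb{R}))$ is the set of all nonempty compact subsets of $\mathit{GL}_d(\mathbb{R})$, equipped with the Hausdorff metric $d_H(\mathsf{A},\mathsf{B}) = \max\{\sup_{A\in\mathsf{A}}\inf_{B\in\mathsf{B}}\|A-B\|, \sup_{B\in\mathsf{B}}\inf_{A\in\mathsf{A}}\|A-B\|\}$, where $\|\cdot\|$ is the Euclidean operator norm. $\mathbb{R}_+=[0,\infty)$. For a nonempty compact set $\mathsf{S}$ of linear endomorphisms of a finite-dimensional real vector space, the lower spectral radius is $$\check{\varrho}(\mathsf{S}) := \lim_{n\to\infty} \inf\{\|A_n\cdots A_1\|^{1/n} : A_1,\dots,A_n \in \mathsf{S}\} = \inf_{n\ge 1} \inf\{\|A_n\cdots A_1\|^{1/n} : A_1,\dots,A_n \in \mathsf{S}\},$$ independent of the operator norm. $\wedge^k A$ is the $k$th exterior power of $A$, acting on $\wedge^k\mathbb{R}^d$, and $\wedge^k\mathsf{A} := \{\wedge^k A : A\in\mathsf{A}\}$. Let $\sigma_1(A)\ge \cdots \ge \sigma_d(A)$ denote the singular values of $A$. For $1\le k<d$, $\mathsf{A}\in\mathcal{K}(\mathit{GL}_d(\mathbb{R}))$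 is $k$-dominated if one of the following equivalent conditions holds: (a) there exist $C>1$, $\tau\in(0,1)$ such that $\sigma_{k+1}(A_n\cdots A_1)/\sigma_k(A_n\cdots A_1) \le C\tau^n$ for all $n\ge1$ and $A_1,\dots,A_n\in\mathsf{A}$; (b) there exists a set $\mathcal{C}\subset\mathbb{R}^d\setminus\{0\}$, relatively closed in $\mathbb{R}^d\setminus\{0\}$, closed under multiplication by nonzero scalars, such that $\bigcup_{A\in\mathsf{A}}A(\mathcal{C})$ is contained in the interior of $\mathcal{C}$, some $k$-dimensional subspace of $\mathbb{R}^d$ is contained in $\mathcal{C}\cup\{0\}$, and some $(d-k)$-dimensional subspace of $\mathbb{R}^d$ does not intersect $\mathcal{C}$. By convention every $\mathsf{A}\in\mathcal{K}(\mathit{GL}_d(\mathbb{R}))$ is $d$-dominated. Define $\ell(\mathsf{A}) := \min\{k\in\{1,\dots,d\} : \mathsf{A} \text{ is } k\text{-dominated}\}$. *)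

theory Defs
  imports "HOL-Analysis.Analysis" "HOL-Library.Multiset"
begin

text \<open>
  Linear endomorphisms of \<open>\<real>\<^sup>d\<close>, with \<open>d = CARD('n)\<close>, are the elements of
  \<^typ>\<open>(real^'n) \<Rightarrow>\<^sub>L (real^'n)\<close>; the norm of that type is the Euclidean operator norm.
\<close>

definition GL :: "((real^'n) \<Rightarrow>\<^sub>L (real^'n)) set" where
  "GL = {A. bij (blinfun_apply A)}"

definition KGL :: "((real^'n) \<Rightarrow>\<^sub>L (real^'n)) set set" where
  "KGL = {S. S \<noteq> {} \<and> compact S \<and> S \<subseteq> GL}"

definition hausdorff_dist :: "'a::real_normed_vector set \<Rightarrow> 'a set \<Rightarrow> real" where
  "hausdorff_dist S T =
     max (SUP A\<in>S. INF B\<in>T. norm (A - B)) (SUP B\<in>T. INF A\<in>S. norm (A - B))"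

definition KGL_continuous_at ::
    "(((real^'n) \<Rightarrow>\<^sub>L (real^'n)) set \<Rightarrow> real) \<Rightarrow> ((real^'n) \<Rightarrow>\<^sub>L (real^'n)) set \<Rightarrow> bool" where
  "KGL_continuous_at f S \<longleftrightarrow>
     (\<forall>e>0. \<exists>\<delta>>0. \<forall>T\<in>KGL. hausdorff_dist T S < \<delta> \<longrightarrow> \<bar>f T - f S\<bar> < e)"


section \<open>Lower spectral radius\<close>

text \<open>The products \<open>A\<^sub>n \<cdots> A\<^sub>1\<close> of \<open>n\<close> factors from \<open>S\<close>; the list is \<open>[A\<^sub>n, \<dots>, A\<^sub>1]\<close>.\<close>

definition products ::
    "('a::real_normed_vector \<Rightarrow>\<^sub>L 'a) set \<Rightarrow> nat \<Rightarrow> ('a \<Rightarrow>\<^sub>L 'a) set" where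
  "products S n = {foldr (o\<^sub>L) As id_blinfun | As. As \<in> lists S \<and> length As = n}"

definition lower_spectral_radius :: "('a::euclidean_space \<Rightarrow>\<^sub>L 'a) set \<Rightarrow> real" where
  "lower_spectral_radius S = lim (\<lambda>n. INF P\<in>products S n. root n (norm P))"


section \<open>Singular values and domination\<close>

text \<open>
  The singular values of \<open>A\<close> are the square roots of the eigenvalues of \<open>A\<^sup>T A\<close>. As
  \<open>A\<^sup>T A\<close> is symmetric, the multiplicity of an eigenvalue is the dimension of its eigenspace.
\<close>

definition gram_eigenspace :: "('a::euclidean_space \<Rightarrow>\<^sub>L 'a) \<Rightarrow> real \<Rightarrow> 'a set" where
  "gram_eigenspace A \<mu> = {v. adjoint (blinfun_apply A) (blinfun_apply A v) = \<mu> *\<^sub>R v}"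

definition singular_mset :: "('a::euclidean_space \<Rightarrow>\<^sub>L 'a) \<Rightarrow> real multiset" where
  "singular_mset A =
     (\<Sum>s | s \<ge> 0 \<and> gram_eigenspace A (s\<^sup>2) \<noteq> {0}.
        replicate_mset (dim (gram_eigenspace A (s\<^sup>2))) s)"

text \<open>\<open>singular_value k A\<close> is \<open>\<sigma>\<^sub>k(A)\<close>, in decreasing order, for \<open>1 \<le> k \<le> d\<close>.\<close>

definition singular_value :: "nat \<Rightarrow> ('a::euclidean_space \<Rightarrow>\<^sub>L 'a) \<Rightarrow> real" where
  "singular_value k A = rev (sorted_list_of_multiset (singular_mset A)) ! (k - 1)"

text \<open>Only meant for \<open>1 \<le> k \<le> d\<close>; the case \<open>k = d\<close> holds by convention.\<close>

definition dominated :: "nat \<Rightarrow> ((real^'n) \<Rightarrow>\<^sub>L (real^'n)) set \<Rightarrow> bool" where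
  "dominated k S \<longleftrightarrow> k = CARD('n) \<or>
     (\<exists>C \<tau>. C > 1 \<and> 0 < \<tau> \<and> \<tau> < 1 \<and>
       (\<forall>n\<ge>1. \<forall>P\<in>products S n. singular_value (k + 1) P / singular_value k P \<le> C * \<tau> ^ n))"

definition ell :: "((real^'n) \<Rightarrow>\<^sub>L (real^'n)) set \<Rightarrow> nat" where
  "ell S = Min {k\<in>{1..CARD('n)}. dominated k S}"


section \<open>Exterior powers\<close>

text \<open>
  The exterior algebra of \<open>\<real>\<^sup>d\<close> is \<^typ>\<open>real^('n set)\<close>: the coordinate at \<open>I = {i\<^sub>1, \<dots>, i\<^sub>k}\<close>
  belongs to the basis vector \<open>e\<^sub>i\<^sub>1 \<and> \<dots> \<and> e\<^sub>i\<^sub>k\<close>, where the (otherwise irrelevant)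
  order \<open>i\<^sub>1, \<dots>, i\<^sub>k\<close> of the elements of \<open>I\<close> is \<open>set_enum I\<close>. The vectors supported on
  \<open>{I. card I = k}\<close> form \<open>\<and>\<^sup>k \<real>\<^sup>d\<close>. This way a single type contains all the \<open>\<and>\<^sup>k \<real>\<^sup>d\<close>.
\<close>

definition set_enum :: "'a set \<Rightarrow> 'a list" where
  "set_enum I = (SOME xs. set xs = I \<and> distinct xs)"

text \<open>
  \<open>wedge [v\<^sub>1, \<dots>, v\<^sub>k]\<close> is \<open>v\<^sub>1 \<and> \<dots> \<and> v\<^sub>k\<close>. Its coordinates are the \<open>k \<times> k\<close> minors of the
  matrix with columns \<open>v\<^sub>1, \<dots>, v\<^sub>k\<close>, written with the Leibniz formula.
\<close>

definition wedge :: "(real^'n) list \<Rightarrow> real^('n set)" where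
  "wedge vs = (\<chi> I. if card I = length vs
     then \<Sum>p | p permutes {..<length vs}.
            of_int (sign p) * (\<Prod>j<length vs. vs ! j $ (set_enum I ! p j))
     else 0)"

text \<open>
  \<open>ext_power k A\<close> is \<open>\<and>\<^sup>k A\<close> on \<open>\<and>\<^sup>k \<real>\<^sup>d\<close>, extended by zero to the orthogonal complement
  of \<open>\<and>\<^sup>k \<real>\<^sup>d\<close>; this extension is multiplicative and preserves the operator norm.
\<close>

definition ext_power ::
    "nat \<Rightarrow> ((real^'n) \<Rightarrow>\<^sub>L (real^'n)) \<Rightarrow> (real^('n set)) \<Rightarrow>\<^sub>L (real^('n set))" where
  "ext_power k A = Blinfun (\<lambda>x. \<Sum>I | card I = k.
     x $ I *\<^sub>R wedge (map (\<lambda>i. blinfun_apply A (axis i 1)) (set_enum I)))"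

lemma ext_power_apply:
  "blinfun_apply (ext_power k A) x = (\<Sum>I | card I = k.
     x $ I *\<^sub>R wedge (map (\<lambda>i. blinfun_apply A (axis i 1)) (set_enum I)))"
  unfolding ext_power_def
  by (subst bounded_linear_Blinfun_apply)
     (auto intro!: bounded_linear_sum bounded_linear_compose[OF bounded_linear_scaleR_left bounded_linear_vec_nth])

lemma set_enum:
  fixes I :: "'a::finite set"
  shows "set (set_enum I) = I" "distinct (set_enum I)" "length (set_enum I) = card I"
proof -
  have "\<exists>xs. set xs = I \<and> distinct xs"
    using finite_distinct_list[of I] by auto
  then have "set (set_enum I) = I \<and> distinct (set_enum I)"
    unfolding set_enum_def by (rule someI_ex)
  then show "set (set_enum I) = I" "distinct (set_enum I)" "length (set_enum I) = card I"
    using distinct_card by force+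
qed

lemma ext_power_eq_0:
  assumes "\<And>I. card I = k \<Longrightarrow> x $ I = 0"
  shows "blinfun_apply (ext_power k A) x = 0"
  using assms by (simp add: ext_power_apply)

lemma wedge_basis:
  fixes I :: "'n::finite set"
  shows "wedge (map (\<lambda>i. axis i 1) (set_enum I)) = axis I 1"
proof -
  have main: "(\<Sum>p | p permutes {..<card I}. of_int (sign p) *
       (\<Prod>j<card I. (axis (set_enum I ! j) 1 :: real^'n) $ (set_enum J ! p j))) = (if J = I then 1 else 0)"
    (is "sum ?f _ = _") if c: "card J = card I" for J
  proof -
    have z: "?f p = 0" if p: "p permutes {..<card I}" and ne: "\<not> (J = I \<and> p = id)" for p
    proof (rule ccontr)
      assume "?f p \<noteq> 0"
      then have eq: "set_enum J ! p j = set_enum I ! j" if "j < card I" for j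
        using that by (auto simp: axis_def split: if_splits)
      have "J = I"
      proof -
        have "I \<subseteq> J"
        proof
          fix i assume "i \<in> I"
          then obtain j where j: "j < card I" "i = set_enum I ! j"
            by (metis in_set_conv_nth set_enum(1,3))
          have "p j < card J" using permutes_in_image[OF p] j c by auto
          then show "i \<in> J" using eq[OF j(1)] j(2) by (metis nth_mem set_enum(1,3))
        qed
        then show ?thesis using c card_subset_eq[of J I] by auto
      qed
      moreover have "p j = j" for j
      proof (cases "j < card I")
        case True
        then have "p j < card I" using permutes_in_image[OF p] by auto
        with True eq[OF True] \<open>J = I\<close> show ?thesis
          by (metis nth_eq_iff_index_eq set_enum(2,3))
      qed (use p in \<open>auto simp: permutes_def\<close>)
      ultimately show False using ne by auto
    qed
    show ?thesis
    proof (cases "J = I")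
      case True
      have "sum ?f {p. p permutes {..<card I}} = sum ?f {id}"
        using z by (intro sum.mono_neutral_right) (auto simp: finite_permutations permutes_id)
      then show ?thesis using True by (simp add: sign_id axis_def)
    next
      case False
      then have "sum ?f {p. p permutes {..<card I}} = 0"
        using z by (intro sum.neutral) auto
      then show ?thesis using False by simp
    qed
  qed
  have "wedge (map (\<lambda>i. axis i 1) (set_enum I)) $ J = axis I 1 $ J" for J
  proof (cases "card J = card I")
    case True
    have "wedge (map (\<lambda>i. axis i 1) (set_enum I)) $ J = (if J = I then 1 else 0)"
      using main[OF True] True by (simp add: wedge_def set_enum(3))
    then show ?thesis by (auto simp: axis_def)
  next
    case False
    then show ?thesis by (auto simp: wedge_def set_enum(3) axis_def)
  qed
  then show ?thesis by (simp add: vec_eq_iff)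
qed

text \<open>The property that characterises \<open>\<and>\<^sup>k A\<close> on \<open>\<and>\<^sup>k \<real>\<^sup>d\<close>:\<close>

lemma ext_power_wedge:
  fixes A :: "(real^'n) \<Rightarrow>\<^sub>L (real^'n)"
  assumes len: "length vs = k"
  shows "blinfun_apply (ext_power k A) (wedge vs) = wedge (map (blinfun_apply A) vs)"
proof -
  define a where "a i = blinfun_apply A (axis i 1)" for i
  define F where "F f J = (\<Sum>p | p permutes {..<k}. of_int (sign p) *
    (\<Prod>j<k. a (f j) $ (set_enum J ! p j)))" for f :: "nat \<Rightarrow> 'n" and J
  have A_eq: "blinfun_apply A v $ i = (\<Sum>l\<in>UNIV. v $ l * a l $ i)" for v i
  proof -
    have "blinfun_apply A v = blinfun_apply A (\<Sum>l\<in>UNIV. v $ l *\<^sub>R axis l 1)"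
      using basis_expansion[of v] by (simp add: scalar_mult_eq_scaleR)
    then show ?thesis
      by (simp add: blinfun.sum_right blinfun.scaleR_right a_def)
  qed
  have pp: "permutation p" if "p permutes {..<k}" for p
    using that by (auto simp: permutation_permutes)
  have F_perm: "F (\<lambda>j. f (q j)) J = of_int (sign q) * F f J" if q: "q permutes {..<k}" for f q J
  proof -
    have "F (\<lambda>j. f (q j)) J = (\<Sum>p | p permutes {..<k}. of_int (sign (p \<circ> q)) *
        (\<Prod>j<k. a (f (q j)) $ (set_enum J ! (p \<circ> q) j)))"
      unfolding F_def by (rule sum_permutations_compose_right[OF q])
    also have "\<dots> = (\<Sum>p | p permutes {..<k}. of_int (sign q) * (of_int (sign p) *
        (\<Prod>j<k. a (f j) $ (set_enum J ! p j))))"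
    proof (rule sum.cong)
      fix p assume "p \<in> {p. p permutes {..<k}}"
      then have "sign (p \<circ> q) = sign p * sign q"
        using q by (intro sign_compose pp) auto
      moreover have "(\<Prod>j<k. a (f (q j)) $ (set_enum J ! (p \<circ> q) j)) =
          (\<Prod>j<k. a (f j) $ (set_enum J ! p j))"
        using prod.permute[OF q, of "\<lambda>j. a (f j) $ (set_enum J ! p j)"] by (simp add: o_def)
      ultimately show "real_of_int (sign (p \<circ> q)) * (\<Prod>j<k. a (f (q j)) $ (set_enum J ! (p \<circ> q) j)) =
          of_int (sign q) * (of_int (sign p) * (\<Prod>j<k. a (f j) $ (set_enum J ! p j)))"
        by simp
    qed simp
    also have "\<dots> = of_int (sign q) * F f J"
      by (simp add: F_def sum_distrib_left)
    finally show ?thesis .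
  qed
  have F_noninj: "F f J = 0" if ni: "\<not> inj_on f {..<k}" for f J
  proof -
    obtain i j where ij: "i < k" "j < k" "i \<noteq> j" "f i = f j"
      using ni by (auto simp: inj_on_def)
    have t: "Transposition.transpose i j permutes {..<k}"
      using ij by (intro permutes_swap_id) auto
    have "(\<lambda>l. f (Transposition.transpose i j l)) = f"
      using ij by (auto simp: fun_eq_iff Transposition.transpose_def)
    then have "F f J = - F f J"
      using F_perm[OF t, of f J] ij by (simp add: sign_swap_id)
    then show ?thesis by simp
  qed
  define G where "G J f = (\<Prod>j<k. vs ! j $ f j) * F f J" for f J
  define h where "h = (\<lambda>(I :: 'n set, q). restrict (\<lambda>j. set_enum I ! q j) {..<k})"
  define D where "D = {I :: 'n set. card I = k} \<times> {q. q permutes {..<k}}"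
  define E where "E = {f \<in> {..<k} \<rightarrow>\<^sub>E (UNIV :: 'n set). inj_on f {..<k}}"
  have h_img: "h (I, q) ` {..<k} = I" if "card I = k" "q permutes {..<k}" for I q
  proof -
    have "h (I, q) ` {..<k} = (\<lambda>j. set_enum I ! j) ` (q ` {..<k})"
      by (auto simp: h_def)
    also have "\<dots> = (\<lambda>j. set_enum I ! j) ` {..<length (set_enum I)}"
      using that by (simp add: permutes_image set_enum(3))
    also have "\<dots> = I"
      using set_enum(1)[of I] nth_image[of "length (set_enum I)" "set_enum I"] by (simp add: atLeast0LessThan)
    finally show ?thesis .
  qed
  have bij: "bij_betw h D E"
    unfolding bij_betw_def
  proof (intro conjI subset_antisym subsetI)
    show "inj_on h D"
    proof (rule inj_onI)
      fix x y assume xy: "x \<in> D" "y \<in> D" "h x = h y"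
      obtain I q where x: "x = (I, q)" by (cases x)
      obtain I' q' where y: "y = (I', q')" by (cases y)
      have c: "card I = k" "q permutes {..<k}" "card I' = k" "q' permutes {..<k}"
        and eq: "h (I, q) = h (I', q')"
        using xy unfolding x y D_def by auto
      have II: "I' = I"
        using h_img[OF c(3,4)] h_img[OF c(1,2)] unfolding eq by (rule trans[OF sym])
      have "q j = q' j" for j
      proof (cases "j < k")
        case True
        have "set_enum I ! q j = set_enum I ! q' j"
          using fun_cong[OF eq, of j] True unfolding II by (simp add: h_def)
        moreover have "q j < k" "q' j < k"
          using permutes_in_image[OF c(2), of j] permutes_in_image[OF c(4), of j] True by auto
        ultimately show ?thesis
          using nth_eq_iff_index_eq[OF set_enum(2)[of I], of "q j" "q' j"] c(1)
          by (simp add: set_enum(3))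
      next
        case False
        then show ?thesis using c(2,4) by (simp add: permutes_def)
      qed
      then show "x = y" unfolding x y using II by auto
    qed
  next
    fix f assume "f \<in> h ` D"
    then obtain I q where Iq: "card I = k" "q permutes {..<k}" "f = h (I, q)"
      by (auto simp: D_def)
    have "inj_on f {..<k}"
      using h_img[OF Iq(1,2)] Iq by (intro eq_card_imp_inj_on) auto
    then show "f \<in> E" using Iq by (auto simp: E_def h_def)
  next
    fix f assume f: "f \<in> E"
    define I where "I = f ` {..<k}"
    have inj: "inj_on f {..<k}" and ext: "f \<in> extensional {..<k}"
      using f by (auto simp: E_def PiE_def)
    have c: "card I = k" using inj by (simp add: I_def card_image)
    define e where "e = (\<lambda>j. set_enum I ! j)"
    have e: "bij_betw e {..<k} I"
      unfolding e_def using bij_betw_nth[of "set_enum I" "{..<k}" I] set_enum[of I] c by simp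
    have fb: "bij_betw f {..<k} I" using inj by (simp add: I_def bij_betw_def)
    define q where "q = (\<lambda>j. if j < k then inv_into {..<k} e (f j) else j)"
    have "bij_betw (inv_into {..<k} e \<circ> f) {..<k} {..<k}"
      using bij_betw_trans[OF fb bij_betw_inv_into[OF e]] .
    then have "bij_betw q {..<k} {..<k}"
      by (rule bij_betw_cong[THEN iffD1, rotated]) (auto simp: q_def)
    then have q: "q permutes {..<k}"
      by (rule bij_imp_permutes) (auto simp: q_def)
    have "h (I, q) = f"
    proof (rule extensionalityI[OF _ ext])
      fix j assume "j \<in> {..<k}"
      then show "h (I, q) j = f j"
        using bij_betw_inv_into_right[OF e, of "f j"] by (auto simp: h_def q_def e_def I_def)
    qed (auto simp: h_def)
    then show "f \<in> h ` D" using c q by (force simp: D_def)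
  qed
  have wJ: "wedge (map (blinfun_apply A) vs) $ J = blinfun_apply (ext_power k A) (wedge vs) $ J" for J
  proof (cases "card J = k")
    case False
    then show ?thesis
      by (auto simp: ext_power_apply wedge_def len set_enum(3) intro!: sum.neutral)
  next
    case c: True
    have "wedge (map (blinfun_apply A) vs) $ J = (\<Sum>p | p permutes {..<k}. of_int (sign p) *
        (\<Prod>j<k. \<Sum>l\<in>UNIV. vs ! j $ l * a l $ (set_enum J ! p j)))"
      using c len by (auto simp: wedge_def A_eq intro!: sum.cong prod.cong)
    also have "\<dots> = (\<Sum>p | p permutes {..<k}. \<Sum>f\<in>{..<k} \<rightarrow>\<^sub>E UNIV. of_int (sign p) *
        (\<Prod>j<k. vs ! j $ f j * a (f j) $ (set_enum J ! p j)))"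
      by (subst prod_sum_PiE) (auto simp: sum_distrib_left)
    also have "\<dots> = (\<Sum>f\<in>{..<k} \<rightarrow>\<^sub>E UNIV. \<Sum>p | p permutes {..<k}. of_int (sign p) *
        (\<Prod>j<k. vs ! j $ f j * a (f j) $ (set_enum J ! p j)))"
      by (rule sum.swap)
    also have "\<dots> = (\<Sum>f\<in>{..<k} \<rightarrow>\<^sub>E UNIV. G J f)"
      by (simp add: G_def F_def prod.distrib sum_distrib_left mult_ac)
    also have "\<dots> = (\<Sum>f\<in>E. G J f)"
      by (rule sum.mono_neutral_right)
         (auto simp: E_def G_def F_noninj intro!: finite_PiE)
    also have "\<dots> = (\<Sum>x\<in>D. G J (h x))"
      by (rule sum.reindex_bij_betw[OF bij, symmetric])
    also have "\<dots> = (\<Sum>I | card I = k. \<Sum>q | q permutes {..<k}. G J (h (I, q)))"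
      unfolding D_def by (simp add: sum.cartesian_product case_prod_unfold)
    also have "\<dots> = (\<Sum>I | card I = k. wedge vs $ I *
        wedge (map (\<lambda>i. blinfun_apply A (axis i 1)) (set_enum I)) $ J)"
    proof (rule sum.cong)
      fix I :: "'n set" assume "I \<in> {I. card I = k}"
      then have cI: "card I = k" by simp
      have w: "wedge (map (\<lambda>i. blinfun_apply A (axis i 1)) (set_enum I)) $ J = F (\<lambda>j. set_enum I ! j) J"
        using c cI by (simp add: wedge_def F_def set_enum(3) a_def cong: prod.cong_simp)
      have g: "G J (h (I, q)) = (of_int (sign q) * (\<Prod>j<k. vs ! j $ (set_enum I ! q j))) *
          F (\<lambda>j. set_enum I ! j) J" if q: "q permutes {..<k}" for q
      proof -
        have "F (h (I, q)) J = F (\<lambda>j. set_enum I ! q j) J"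
          by (simp add: F_def h_def cong: prod.cong_simp)
        then show ?thesis
          using F_perm[OF q, of "\<lambda>j. set_enum I ! j" J] by (simp add: G_def h_def mult_ac cong: prod.cong_simp)
      qed
      show "(\<Sum>q | q permutes {..<k}. G J (h (I, q))) = wedge vs $ I *
          wedge (map (\<lambda>i. blinfun_apply A (axis i 1)) (set_enum I)) $ J"
        unfolding w using cI len by (simp add: g wedge_def sum_distrib_right)
    qed simp
    also have "\<dots> = blinfun_apply (ext_power k A) (wedge vs) $ J"
      by (simp add: ext_power_apply)
    finally show ?thesis .
  qed
  then show ?thesis by (simp add: vec_eq_iff)
qed

end

theory Submission
  imports Defs
begin

text \<open>
  Write \<open>r\<close> for the lower spectral radius, \<open>d\<close> for the dimension and \<open>l = ell S\<close>. Three facts together give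
  the criterion.

  First, \<open>r\<close> is upper semicontinuous, because it is an infimum over products of finite length, and
  \<open>r(\<and>\<^sup>l T) \<le> r(T)\<^sup>l\<close> for every \<open>T\<close>, because the norm of \<open>\<and>\<^sup>l P\<close> is the product of the \<open>l\<close> largest singular
  values of \<open>P\<close>.

  Second, \<open>T \<mapsto> r(\<and>\<^sup>l T)\<close> is lower semicontinuous at \<open>S\<close>. Domination of index \<open>l\<close> says that all long
  products of \<open>\<and>\<^sup>l S\<close> have a large gap between their two largest singular values. The most expanded
  direction of a product then hardly changes when letters are added on the left, and a discrete
  Gronwall argument turns this into \<open>c \<parallel>P\<parallel> \<parallel>Q\<parallel> \<le> \<parallel>P Q\<parallel>\<close> with \<open>c > 0\<close> independent of the products
  (\<open>almost_multiplicative\<close>). For blocks of a long fixed length this inequality and the gap survive a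
  perturbation of the letters, in the form of an invariant cone condition, and the loss of a factor
  \<open>c/4\<close> per block is negligible for long blocks. So if \<open>r(S)\<^sup>l = r(\<and>\<^sup>l S)\<close>, then \<open>r(T)\<close> cannot be much
  smaller than \<open>r(S)\<close> for \<open>T\<close> near \<open>S\<close>.

  Third, sets arbitrarily close to \<open>S\<close> have a lower spectral radius that hardly exceeds
  \<open>r(\<and>\<^sup>l S)\<^bsup>1/l\<^esup>\<close>, so that continuity at \<open>S\<close> forces equality. Take for \<open>T\<close> the closed \<open>\<delta>\<close>-neighbourhood of
  \<open>S\<close>. For \<open>k < l\<close> the set \<open>S\<close> is not dominated of index \<open>k\<close>, and there is a length \<open>m\<close> such that
  products of \<open>m\<close> letters of \<open>T\<close> can send some vector of any given \<open>k\<close>-plane into any given subspace of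
  codimension \<open>k\<close> (\<open>not_dominated_connect\<close>). Choosing such a \<open>W\<close> between two copies of a long product \<open>P\<close>
  gives \<open>\<parallel>\<and>\<^sup>k(P W P)\<parallel> \<le> const \<cdot> \<parallel>\<and>\<^bsup>k-1\<^esup>P\<parallel> \<parallel>\<and>\<^bsup>k+1\<^esup>P\<parallel>\<close>. Thus the growth rate of the \<open>k\<close>-volume can be
  replaced by the mean of the rates of its two neighbours, without raising the other rates. Iterating
  this for all \<open>k < l\<close> makes the rates almost convex in \<open>k\<close>, so that the rate of the norm, \<open>k = 1\<close>, becomes
  almost at most \<open>1/l\<close> of the rate of the \<open>l\<close>-volume.
\<close>

section \<open>Products of matrices\<close>

lemma products_0 [simp]: "products S 0 = {id_blinfun}"
  by (auto simp: products_def)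

lemma products_SucI: "A \<in> S \<Longrightarrow> Q \<in> products S n \<Longrightarrow> A o\<^sub>L Q \<in> products S (Suc n)"
proof -
  assume A: "A \<in> S" and "Q \<in> products S n"
  then obtain As where "As \<in> lists S" "length As = n" "Q = foldr (o\<^sub>L) As id_blinfun"
    unfolding products_def by auto
  with A show ?thesis unfolding products_def by (intro CollectI exI[of _ "A # As"]) auto
qed

lemma products_SucE:
  assumes "P \<in> products S (Suc n)"
  obtains A Q where "A \<in> S" "Q \<in> products S n" "P = A o\<^sub>L Q"
proof -
  obtain As where As: "As \<in> lists S" "length As = Suc n" "P = foldr (o\<^sub>L) As id_blinfun"
    using assms unfolding products_def by auto
  then obtain A Bs where "As = A # Bs" by (cases As) auto
  then show thesis using As that[of A "foldr (o\<^sub>L) Bs id_blinfun"] by (auto simp: products_def)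
qed

lemma blinfun_compose_assoc: "(A o\<^sub>L B) o\<^sub>L C = A o\<^sub>L (B o\<^sub>L C)"
  by (auto intro: blinfun_eqI)

lemma blinfun_compose_id [simp]: "id_blinfun o\<^sub>L A = A" "A o\<^sub>L id_blinfun = A"
  by (auto intro: blinfun_eqI)

lemma products_1 [simp]: "products S (Suc 0) = S"
proof (intro subset_antisym subsetI)
  show "P \<in> S" if "P \<in> products S (Suc 0)" for P
    using that by (rule products_SucE) simp
  show "P \<in> products S (Suc 0)" if "P \<in> S" for P
    using products_SucI[OF that, of id_blinfun 0] by simp
qed

lemma products_comp:
  "P \<in> products S m \<Longrightarrow> Q \<in> products S n \<Longrightarrow> P o\<^sub>L Q \<in> products S (m + n)"
proof (induction m arbitrary: P)
  case (Suc m)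
  then obtain A R where "A \<in> S" "R \<in> products S m" "P = A o\<^sub>L R" by (auto elim: products_SucE)
  then show ?case using Suc products_SucI[of A S "R o\<^sub>L Q" "m + n"] by (simp add: blinfun_compose_assoc)
qed simp

lemma products_addE:
  assumes "P \<in> products S (m + n)"
  obtains Q R where "Q \<in> products S m" "R \<in> products S n" "P = Q o\<^sub>L R"
  using assms
proof (induction m arbitrary: P thesis)
  case (Suc m)
  obtain A P' where P: "A \<in> S" "P' \<in> products S (m + n)" "P = A o\<^sub>L P'"
    using Suc.prems(2) by (auto elim: products_SucE)
  obtain Q R where "Q \<in> products S m" "R \<in> products S n" "P' = Q o\<^sub>L R"
    using Suc.IH[OF _ P(2)] by blast
  then show ?case
    using Suc.prems(1)[of "A o\<^sub>L Q" R] P by (auto simp: blinfun_compose_assoc intro: products_SucI)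
qed simp

lemma products_mono: "S \<subseteq> T \<Longrightarrow> products S n \<subseteq> products T n"
  unfolding products_def by (auto dest: lists_mono)

lemma products_nonempty: "S \<noteq> {} \<Longrightarrow> products S n \<noteq> {}"
proof (induction n)
  case (Suc n)
  then show ?case using products_SucI[of _ S _ n] by blast
qed simp

lemma norm_products_le:
  assumes "\<And>A. A \<in> S \<Longrightarrow> norm A \<le> K" "P \<in> products S n"
  shows "norm P \<le> K ^ n"
  using assms(2)
proof (induction n arbitrary: P)
  case 0
  then show ?case by (simp add: norm_blinfun_id_le)
next
  case (Suc n)
  then obtain A Q where AQ: "A \<in> S" "Q \<in> products S n" "P = A o\<^sub>L Q" by (auto elim: products_SucE)
  have "norm P \<le> norm A * norm Q" using AQ norm_blinfun_compose by blast
  also have "\<dots> \<le> K * K ^ n"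
    using assms(1)[OF AQ(1)] Suc.IH[OF AQ(2)] order.trans[OF norm_ge_zero assms(1)[OF AQ(1)]]
    by (intro mult_mono) auto
  finally show ?case by simp
qed

text \<open>Blocks of length \<open>N\<close> may be regarded as letters of a new alphabet.\<close>

lemma products_products_subset: "products S (N * k) \<subseteq> products (products S N) k"
proof (induction k)
  case (Suc k)
  show ?case
  proof
    fix P assume "P \<in> products S (N * Suc k)"
    then obtain Q R where "Q \<in> products S N" "R \<in> products S (N * k)" "P = Q o\<^sub>L R"
      by (auto elim: products_addE)
    then show "P \<in> products (products S N) (Suc k)" using Suc by (auto intro: products_SucI)
  qed
qed simp

section \<open>The lower spectral radius as an infimum\<close>

text \<open>
  Subadditivity along \<open>n = q m + r\<close> bounds \<open>g n / n\<close> by \<open>g m / m\<close> up to a term that is bounded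
  independently of \<open>n\<close>, divided by \<open>n\<close>.
\<close>

lemma Fekete_subadditive:
  fixes g :: "nat \<Rightarrow> real"
  assumes sub: "\<And>m n. m \<ge> 1 \<Longrightarrow> n \<ge> 1 \<Longrightarrow> g (m + n) \<le> g m + g n"
    and low: "\<And>n. n \<ge> 1 \<Longrightarrow> - L * n \<le> g n"
  shows "(\<lambda>n. g n / n) \<longlonglongrightarrow> (INF n\<in>{1..}. g n / n)"
proof -
  define I where "I = (INF n\<in>{1..}. g n / n)"
  have bdd: "bdd_below ((\<lambda>n. g n / real n) ` {1..})"
  proof (rule bdd_belowI2)
    fix n :: nat assume n: "n \<in> {1..}"
    then show "- L \<le> g n / n" using low[of n] by (simp add: field_simps)
  qed
  have ge: "I \<le> g n / n" if "n \<ge> 1" for n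
    unfolding I_def using that by (intro cINF_lower[OF bdd]) auto
  have mult: "g (q * m + r) \<le> q * g m + g r" if "m \<ge> 1" "r \<ge> 1" for q m r
  proof (induction q)
    case (Suc q)
    have "g (Suc q * m + r) = g (m + (q * m + r))" by (simp add: algebra_simps)
    also have "\<dots> \<le> g m + g (q * m + r)" using that by (intro sub) auto
    finally show ?case using Suc by (simp add: algebra_simps)
  qed simp
  have ev: "\<forall>\<^sub>F n in sequentially. g n / n < I + e" if e: "e > 0" for e
  proof -
    have "I < I + e / 2" using e by simp
    then obtain m where m: "m \<ge> 1" "g m / m < I + e / 2"
      unfolding I_def by (subst (asm) cINF_less_iff[OF _ bdd]) auto
    define c where "c = (MAX r\<in>{1..m}. \<bar>g r\<bar>) + \<bar>I + e / 2\<bar> * m"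
    have "\<forall>\<^sub>F n in sequentially. n > nat \<lceil>2 * c / e\<rceil> \<and> n \<ge> 1"
      by (intro eventually_conj eventually_gt_at_top eventually_ge_at_top)
    then show ?thesis
    proof eventually_elim
      case (elim n)
      \<comment> \<open>the remainder is taken in \<open>{1..m}\<close>, where subadditivity is available\<close>
      define q where "q = (n - 1) div m"
      define r where "r = (n - 1) mod m + 1"
      have n: "n = q * m + r" "r \<ge> 1" "r \<le> m"
      proof -
        have "(n - 1) div m * m + (n - 1) mod m = n - 1" by simp
        then show "n = q * m + r" unfolding q_def r_def using elim by linarith
        show "r \<ge> 1" "r \<le> m" using m(1) by (simp_all add: r_def Suc_le_eq)
      qed
      have "g r \<le> (MAX r\<in>{1..m}. \<bar>g r\<bar>)"
        using n by (intro order.trans[OF abs_ge_self Max_ge]) auto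
      moreover have "q * g m \<le> (I + e / 2) * (q * m)"
      proof -
        have "g m \<le> (I + e / 2) * m" using m by (simp add: field_simps)
        then have "q * g m \<le> q * ((I + e / 2) * m)" by (intro mult_left_mono) auto
        then show ?thesis by (simp add: mult_ac)
      qed
      moreover have "(I + e / 2) * (q * m) = (I + e / 2) * n - (I + e / 2) * r"
        using n(1) by (simp add: algebra_simps)
      moreover have "- ((I + e / 2) * r) \<le> \<bar>I + e / 2\<bar> * m"
      proof -
        have "\<bar>(I + e / 2) * r\<bar> \<le> \<bar>I + e / 2\<bar> * m"
          using n(3) unfolding abs_mult by (intro mult_mono) auto
        then show ?thesis by linarith
      qed
      ultimately have "g n \<le> (I + e / 2) * n + c"
        using mult[OF m(1) n(2), of q] unfolding n(1)[symmetric] c_def by linarith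
      moreover have "c < e / 2 * n"
      proof -
        have "2 * c / e < n" using elim by linarith
        then show ?thesis using e by (simp add: field_simps)
      qed
      ultimately have "g n < (I + e) * n" by (simp add: algebra_simps)
      then show ?case using elim by (simp add: field_simps)
    qed
  qed
  have "(\<lambda>n. g n / n) \<longlonglongrightarrow> I"
  proof (rule order_tendstoI)
    fix a assume "a < I"
    show "\<forall>\<^sub>F n in sequentially. a < g n / n"
      by (rule eventually_mono[OF eventually_ge_at_top[of 1]]) (use ge \<open>a < I\<close> in force)
  next
    fix a assume "a > I"
    then show "\<forall>\<^sub>F n in sequentially. g n / n < a" using ev[of "a - I"] by simp
  qed
  then show ?thesis unfolding I_def .
qed

text \<open>
  These bounds keep all logarithms below finite. The lower one concerns the products, and not the
  inverses of the letters, because \<open>\<and>\<^sup>k A\<close>, extended by zero, has no inverse.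
\<close>

definition exp_bounded :: "('a::euclidean_space \<Rightarrow>\<^sub>L 'a) set \<Rightarrow> bool" where
  "exp_bounded S \<longleftrightarrow> S \<noteq> {} \<and> (\<exists>K \<kappa>. \<kappa> > 0 \<and> (\<forall>A\<in>S. norm A \<le> K) \<and>
     (\<forall>n\<ge>1. \<forall>P\<in>products S n. \<kappa> ^ n \<le> norm P))"

text \<open>
  The logarithms of the infima over the products of length \<open>n\<close> are subadditive in \<open>n\<close>; the two-sided
  bounds make them finite and bounded below by a linear function, so the limit exists, is an infimum
  and is positive.
\<close>

lemma lower_spectral_radius_basic:
  fixes S :: "('a::euclidean_space \<Rightarrow>\<^sub>L 'a) set"
  assumes S: "exp_bounded S"
  shows "(\<lambda>n. INF P\<in>products S n. root n (norm P)) \<longlonglongrightarrow> lower_spectral_radius S"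
    and "lower_spectral_radius S > 0"
    and "n \<ge> 1 \<Longrightarrow> P \<in> products S n \<Longrightarrow> lower_spectral_radius S ^ n \<le> norm P"
proof -
  obtain K \<kappa> where ne: "S \<noteq> {}" and \<kappa>: "\<kappa> > 0" and K: "\<And>A. A \<in> S \<Longrightarrow> norm A \<le> K"
    and low: "\<And>n P. n \<ge> 1 \<Longrightarrow> P \<in> products S n \<Longrightarrow> \<kappa> ^ n \<le> norm P"
    using S unfolding exp_bounded_def by blast
  define b where "b n = (INF P\<in>products S n. root n (norm P))" for n
  have bdd: "bdd_below ((\<lambda>P. root n (norm P)) ` products S n)" for n
    by (rule bdd_belowI2[of _ 0]) (cases n; simp)
  have b_le: "b n \<le> root n (norm P)" if "P \<in> products S n" for n P
    unfolding b_def using that by (rule cINF_lower[OF bdd])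
  have b_ge: "b n \<ge> \<kappa>" if n: "n \<ge> 1" for n
    unfolding b_def
  proof (rule cINF_greatest)
    fix P assume "P \<in> products S n"
    then have "root n (\<kappa> ^ n) \<le> root n (norm P)"
      using low n by (intro real_root_le_mono) auto
    then show "\<kappa> \<le> root n (norm P)" using n \<kappa> by (simp add: real_root_power_cancel)
  qed (use ne products_nonempty in auto)
  have b_pos: "b n > 0" if "n \<ge> 1" for n using b_ge[OF that] \<kappa> by linarith
  have b_pow: "b n ^ n \<le> norm P" if "P \<in> products S n" "n \<ge> 1" for n P
  proof -
    have "b n ^ n \<le> root n (norm P) ^ n"
      using b_le[OF that(1)] b_pos[OF that(2)] by (intro power_mono) auto
    then show ?thesis using that by simp
  qed
  have approx: "\<exists>P\<in>products S n. norm P \<le> (b n + e) ^ n" if "e > 0" "n \<ge> 1" for e n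
  proof -
    have "b n < b n + e" using that by simp
    then obtain P where "P \<in> products S n" "root n (norm P) < b n + e"
      unfolding b_def using products_nonempty[OF ne] by (subst (asm) cINF_less_iff[OF _ bdd]) auto
    moreover from this have "root n (norm P) ^ n \<le> (b n + e) ^ n"
      using that by (intro power_mono) auto
    ultimately show ?thesis using that by auto
  qed
  have sub: "b (m + n) ^ (m + n) \<le> b m ^ m * b n ^ n" if mn: "m \<ge> 1" "n \<ge> 1" for m n
  proof (rule tendsto_lowerbound)
    show "((\<lambda>e. (b m + e) ^ m * (b n + e) ^ n) \<longlongrightarrow> b m ^ m * b n ^ n) (at_right 0)"
      by (auto intro!: tendsto_eq_intros)
    show "\<forall>\<^sub>F e in at_right 0. b (m + n) ^ (m + n) \<le> (b m + e) ^ m * (b n + e) ^ n"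
      using eventually_at_right_less[of "0::real"]
    proof eventually_elim
      case (elim e)
      obtain P Q where PQ: "P \<in> products S m" "norm P \<le> (b m + e) ^ m"
        "Q \<in> products S n" "norm Q \<le> (b n + e) ^ n"
        using approx[OF elim] mn by meson
      have "b (m + n) ^ (m + n) \<le> norm (P o\<^sub>L Q)"
        using PQ mn by (intro b_pow products_comp) auto
      also have "\<dots> \<le> norm P * norm Q" by (rule norm_blinfun_compose)
      also have "\<dots> \<le> (b m + e) ^ m * (b n + e) ^ n"
        using PQ(2,4) b_pos[OF mn(1)] elim by (intro mult_mono) auto
      finally show ?case .
    qed
  qed simp
  define g where "g n = n * ln (b n)" for n
  define I where "I = (INF n\<in>{1..}. g n / n)"
  have g_low: "- (- ln \<kappa>) * n \<le> g n" if "n \<ge> 1" for n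
    using b_ge[OF that] \<kappa> b_pos[OF that] unfolding g_def by (simp add: mult_left_mono mult.commute)
  have lim: "(\<lambda>n. g n / n) \<longlonglongrightarrow> I"
    unfolding I_def
  proof (rule Fekete_subadditive[OF _ g_low])
    fix m n :: nat assume mn: "m \<ge> 1" "n \<ge> 1"
    have "ln (b (m + n) ^ (m + n)) \<le> ln (b m ^ m * b n ^ n)"
      using sub[OF mn] b_pos mn by (subst ln_le_cancel_iff) auto
    then show "g (m + n) \<le> g m + g n"
      unfolding g_def using b_pos[OF mn(1)] b_pos[OF mn(2)] b_pos[of "m + n"] mn
      by (simp add: ln_mult ln_realpow)
  qed
  have "(\<lambda>n. exp (g n / n)) \<longlonglongrightarrow> exp I" by (intro tendsto_exp lim)
  moreover have "\<forall>\<^sub>F n in sequentially. exp (g n / n) = b n"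
    using eventually_ge_at_top[of 1] by eventually_elim (simp add: g_def b_pos)
  ultimately have blim: "b \<longlonglongrightarrow> exp I" by (rule Lim_transform_eventually)
  then have lsr: "lower_spectral_radius S = exp I"
    unfolding lower_spectral_radius_def b_def[symmetric] by (simp add: limI)
  show "(\<lambda>n. INF P\<in>products S n. root n (norm P)) \<longlonglongrightarrow> lower_spectral_radius S"
    using blim unfolding lsr b_def .
  show "lower_spectral_radius S > 0" unfolding lsr by simp
  show "lower_spectral_radius S ^ n \<le> norm P" if n: "n \<ge> 1" and P: "P \<in> products S n"
  proof -
    have "bdd_below ((\<lambda>n. g n / real n) ` {1..})"
    proof (rule bdd_belowI2)
      fix n :: nat assume n: "n \<in> {1..}"
      then show "ln \<kappa> \<le> g n / n" using g_low[of n] by (simp add: field_simps)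
    qed
    then have "I \<le> g n / n" unfolding I_def using n by (intro cINF_lower) auto
    then have "exp I \<le> b n" using n b_pos[OF n] by (simp add: g_def) (metis exp_le_cancel_iff exp_ln)
    then have "exp I ^ n \<le> b n ^ n" by (intro power_mono) auto
    then show ?thesis using b_pow[OF P n] unfolding lsr by linarith
  qed
qed

lemma lower_spectral_radius_approx:
  assumes S: "exp_bounded S" and e: "e > 0"
  shows "\<exists>N. \<forall>n\<ge>N. \<exists>P\<in>products S n. norm P \<le> (lower_spectral_radius S + e) ^ n"
proof -
  have ne: "S \<noteq> {}" using S by (simp add: exp_bounded_def)
  have "\<forall>\<^sub>F n in sequentially. (INF P\<in>products S n. root n (norm P)) < lower_spectral_radius S + e"
    using lower_spectral_radius_basic(1)[OF S] by (rule order_tendstoD) (use e in simp)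
  then have "\<forall>\<^sub>F n in sequentially. \<exists>P\<in>products S n. norm P \<le> (lower_spectral_radius S + e) ^ n"
    using eventually_ge_at_top[of 1]
  proof eventually_elim
    case (elim n)
    have "bdd_below ((\<lambda>P. root n (norm P)) ` products S n)"
      by (rule bdd_belowI2[of _ 0]) (use elim(2) in simp)
    then obtain P where P: "P \<in> products S n" "root n (norm P) < lower_spectral_radius S + e"
      using elim(1) products_nonempty[OF ne, of n] by (subst (asm) cINF_less_iff) auto
    then have "root n (norm P) ^ n \<le> (lower_spectral_radius S + e) ^ n"
      using elim(2) by (intro power_mono) auto
    then show ?case using P elim(2) by auto
  qed
  then show ?thesis by (simp add: eventually_sequentially)
qed

lemma lower_spectral_radius_le:
  assumes S: "exp_bounded S" and P: "P \<in> products S n" "n \<ge> 1" "norm P \<le> c ^ n" and c: "c \<ge> 0"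
  shows "lower_spectral_radius S \<le> c"
proof -
  have "lower_spectral_radius S ^ n \<le> c ^ n"
    using lower_spectral_radius_basic(3)[OF S P(2,1)] P(3) by linarith
  then show ?thesis using P(2) c by (simp add: power_mono_iff lower_spectral_radius_basic(2)[OF S] less_imp_le)
qed

lemma lower_spectral_radius_ge:
  assumes S: "exp_bounded S" and c: "c \<ge> 0"
    and inf: "\<And>N. \<exists>n\<ge>N. \<forall>P\<in>products S n. c ^ n \<le> norm P"
  shows "lower_spectral_radius S \<ge> c"
proof (rule field_le_epsilon)
  fix e :: real assume e: "e > 0"
  obtain N where N: "\<And>n. n \<ge> N \<Longrightarrow> \<exists>P\<in>products S n. norm P \<le> (lower_spectral_radius S + e) ^ n"
    using lower_spectral_radius_approx[OF S e] by blast
  obtain n where n: "n \<ge> max N 1" "\<forall>P\<in>products S n. c ^ n \<le> norm P" using inf by blast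
  obtain P where P: "P \<in> products S n" "norm P \<le> (lower_spectral_radius S + e) ^ n"
    using N[of n] n by auto
  have "c ^ n \<le> norm P" using n P by blast
  then have "c ^ n \<le> (lower_spectral_radius S + e) ^ n"
    using P(2) by linarith
  then show "c \<le> lower_spectral_radius S + e"
    using n c e lower_spectral_radius_basic(2)[OF S] by (simp add: power_mono_iff)
qed

section \<open>Almost multiplicative norms of products with a spectral gap\<close>

text \<open>
  \<open>v\<close> and \<open>u\<close> are unit singular vectors of \<open>M\<close> for its largest singular value, in the domain and in the
  image, and the second largest singular value is at most \<open>\<epsilon>\<close> times the largest one.
\<close>

definition gap_vectors ::
    "real \<Rightarrow> ('a::euclidean_space \<Rightarrow>\<^sub>L 'a) \<Rightarrow> 'a \<Rightarrow> 'a \<Rightarrow> bool" where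
  "gap_vectors \<epsilon> M u v \<longleftrightarrow> \<epsilon> \<ge> 0 \<and> norm u = 1 \<and> norm v = 1 \<and> M v = norm M *\<^sub>R u \<and>
     (\<forall>x. u \<bullet> M x = norm M * (v \<bullet> x)) \<and>
     (\<forall>x. v \<bullet> x = 0 \<longrightarrow> norm (M x) \<le> \<epsilon> * norm M * norm x)"

lemma remove_component:
  fixes x v :: "'a::real_inner"
  assumes "norm v = 1"
  shows "norm (x - (v \<bullet> x) *\<^sub>R v) \<le> norm x" "v \<bullet> (x - (v \<bullet> x) *\<^sub>R v) = 0"
    "(norm (x - (v \<bullet> x) *\<^sub>R v))\<^sup>2 = (norm x)\<^sup>2 - (v \<bullet> x)\<^sup>2"
proof -
  have vv: "v \<bullet> v = 1" using assms by (simp add: norm_eq_1)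
  show "v \<bullet> (x - (v \<bullet> x) *\<^sub>R v) = 0" by (simp add: inner_diff_right vv)
  show eq: "(norm (x - (v \<bullet> x) *\<^sub>R v))\<^sup>2 = (norm x)\<^sup>2 - (v \<bullet> x)\<^sup>2"
    unfolding power2_norm_eq_inner
    by (simp add: inner_diff_right inner_diff_left vv power2_eq_square inner_commute)
  have "(norm (x - (v \<bullet> x) *\<^sub>R v))\<^sup>2 \<le> (norm x)\<^sup>2" unfolding eq by simp
  then show "norm (x - (v \<bullet> x) *\<^sub>R v) \<le> norm x" by (rule power2_le_imp_le) simp
qed

lemma gap_vectors_remainder:
  assumes "gap_vectors \<epsilon> M u v"
  obtains e where "M x = (norm M * (v \<bullet> x)) *\<^sub>R u + e" "norm e \<le> \<epsilon> * norm M * norm x"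
proof -
  have nv: "norm v = 1" and Mv: "M v = norm M *\<^sub>R u"
    and orth: "\<And>x. v \<bullet> x = 0 \<Longrightarrow> norm (M x) \<le> \<epsilon> * norm M * norm x"
    and e: "\<epsilon> \<ge> 0"
    using assms by (auto simp: gap_vectors_def)
  define w where "w = x - (v \<bullet> x) *\<^sub>R v"
  have eq: "M x = (norm M * (v \<bullet> x)) *\<^sub>R u + M w"
    unfolding w_def by (simp add: blinfun.diff_right blinfun.scaleR_right Mv)
  have "norm (M w) \<le> \<epsilon> * norm M * norm w"
    unfolding w_def by (intro orth remove_component(2) nv)
  also have "\<dots> \<le> \<epsilon> * norm M * norm x"
    using remove_component(1)[OF nv, of x] e unfolding w_def by (intro mult_left_mono) auto
  finally show thesis using that eq by blast
qed

lemma gap_vectors_norm_le: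
  assumes "gap_vectors \<epsilon> M u v"
  shows "norm (M x) \<le> norm M * (\<bar>v \<bullet> x\<bar> + \<epsilon> * norm x)"
proof -
  have nu: "norm u = 1" using assms by (simp add: gap_vectors_def)
  obtain e where "M x = (norm M * (v \<bullet> x)) *\<^sub>R u + e" "norm e \<le> \<epsilon> * norm M * norm x"
    using gap_vectors_remainder[OF assms] .
  then have "norm (M x) \<le> norm M * \<bar>v \<bullet> x\<bar> + \<epsilon> * norm M * norm x"
    using norm_triangle_ineq[of "(norm M * (v \<bullet> x)) *\<^sub>R u" e] nu by (simp add: abs_mult)
  then show ?thesis by (simp add: algebra_simps)
qed

text \<open>
  A vector orthogonal to \<open>v\<close> is expanded by \<open>A M\<close> far less than \<open>\<parallel>A M\<parallel>\<close>, hence is nearly orthogonal to \<open>v'\<close>.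
  So the lines of \<open>v\<close> and \<open>v'\<close> are close. Absolute values of inner products avoid the choice of signs.
\<close>

lemma gap_direction_stable:
  assumes M: "gap_vectors \<epsilon> M u v" and AM: "gap_vectors \<epsilon>' (A o\<^sub>L M) u' v'"
    and A: "norm A \<le> K" "norm M \<le> K * norm (A o\<^sub>L M)" and M0: "M \<noteq> 0"
  shows "\<bar>v \<bullet> x\<bar> \<le> \<bar>v' \<bullet> x\<bar> + K\<^sup>2 * \<epsilon> * norm x"
proof -
  have nv: "norm v = 1" and nv': "norm v' = 1" and nu': "norm u' = 1" and e: "\<epsilon> \<ge> 0"
    and orth: "\<And>x. v \<bullet> x = 0 \<Longrightarrow> norm (M x) \<le> \<epsilon> * norm M * norm x"
    and u': "\<And>x. u' \<bullet> (A o\<^sub>L M) x = norm (A o\<^sub>L M) * (v' \<bullet> x)"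
    using M AM by (auto simp: gap_vectors_def)
  have K: "K \<ge> 0" using A(1) norm_ge_zero[of A] by linarith
  have pos: "norm (A o\<^sub>L M) > 0"
    using A(2) M0 by (cases "A o\<^sub>L M = 0") auto
  define y where "y = v' - (v \<bullet> v') *\<^sub>R v"
  have y: "v \<bullet> y = 0" "(norm y)\<^sup>2 = 1 - (v \<bullet> v')\<^sup>2"
    using remove_component[OF nv, of v'] nv' by (auto simp: y_def)
  have v'y: "v' \<bullet> y = (norm y)\<^sup>2"
    unfolding y(2) using nv' by (simp add: y_def inner_diff_right norm_eq_1 power2_eq_square inner_commute)
  have "norm (A o\<^sub>L M) * (norm y)\<^sup>2 = u' \<bullet> A (M y)"
    using u'[of y] v'y by simp
  also have "\<dots> \<le> norm u' * norm (A (M y))" by (rule norm_cauchy_schwarz)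
  also have "\<dots> \<le> norm A * norm (M y)" using nu' norm_blinfun[of A] by simp
  also have "\<dots> \<le> K * (\<epsilon> * norm M * norm y)"
    using A(1) K orth[OF y(1)] by (intro mult_mono) auto
  also have "\<dots> \<le> K * (\<epsilon> * (K * norm (A o\<^sub>L M)) * norm y)"
    using A(2) K e by (intro mult_left_mono mult_right_mono) auto
  finally have "norm (A o\<^sub>L M) * (norm y)\<^sup>2 \<le> norm (A o\<^sub>L M) * (K\<^sup>2 * \<epsilon> * norm y)"
    by (simp add: power2_eq_square mult_ac)
  then have "norm y * norm y \<le> (K\<^sup>2 * \<epsilon>) * norm y" using pos by (simp add: power2_eq_square)
  then have ny: "norm y \<le> K\<^sup>2 * \<epsilon>"
    using e by (cases "y = 0") auto
  \<comment> \<open>the sine of the angle between two lines is symmetric\<close>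
  define z where "z = v - (v' \<bullet> v) *\<^sub>R v'"
  have "(norm z)\<^sup>2 = (norm y)\<^sup>2"
    unfolding y(2) z_def remove_component(3)[OF nv'] by (simp add: nv inner_commute)
  then have nz: "norm z \<le> K\<^sup>2 * \<epsilon>" using ny by simp
  have "v \<bullet> x = (v' \<bullet> v) * (v' \<bullet> x) + z \<bullet> x"
    by (simp add: z_def inner_diff_left)
  moreover have "\<bar>(v' \<bullet> v) * (v' \<bullet> x)\<bar> \<le> \<bar>v' \<bullet> x\<bar>"
    using Cauchy_Schwarz_ineq2[of v' v] nv nv' by (simp add: abs_mult mult_left_le_one_le)
  moreover have "\<bar>z \<bullet> x\<bar> \<le> K\<^sup>2 * \<epsilon> * norm x"
    using Cauchy_Schwarz_ineq2[of z x] nz by (meson mult_right_mono norm_ge_zero order.trans)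
  ultimately show ?thesis by linarith
qed

text \<open>
  The alphabet that will be used is \<open>\<and>\<^sup>l S\<close>. Its elements are extended by zero outside \<open>\<and>\<^sup>l \<real>\<^sup>d\<close> and are not invertible,
  so bounds on the inverses are replaced by their effect \<open>norm_left\<close>, \<open>norm_right\<close> on
  the norms of products.
\<close>

locale gapped_products =
  fixes S :: "('a::euclidean_space \<Rightarrow>\<^sub>L 'a) set" and K C \<tau> :: real
  assumes ne: "S \<noteq> {}" and K: "K \<ge> 1" and C: "C \<ge> 1" and \<tau>: "0 < \<tau>" "\<tau> < 1"
    and norm_le: "\<And>A. A \<in> S \<Longrightarrow> norm A \<le> K"
    and nz: "\<And>n P. n \<ge> 1 \<Longrightarrow> P \<in> products S n \<Longrightarrow> P \<noteq> 0"
    and norm_left: "\<And>n P A. n \<ge> 1 \<Longrightarrow> P \<in> products S n \<Longrightarrow> A \<in> S \<Longrightarrow> norm P \<le> K * norm (A o\<^sub>L P)"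
    and norm_right: "\<And>n P A. n \<ge> 1 \<Longrightarrow> P \<in> products S n \<Longrightarrow> A \<in> S \<Longrightarrow> norm P \<le> K * norm (P o\<^sub>L A)"
    and gap: "\<And>n P. n \<ge> 1 \<Longrightarrow> P \<in> products S n \<Longrightarrow> \<exists>u v. gap_vectors (C * \<tau> ^ n) P u v"
begin

text \<open>
  A length is recorded with each direction because the same operator can be a product of several
  lengths, with different guaranteed gaps.
\<close>

definition in_dir :: "nat \<Rightarrow> ('a \<Rightarrow>\<^sub>L 'a) \<Rightarrow> 'a" where
  "in_dir n P = (SOME v. \<exists>u. gap_vectors (C * \<tau> ^ n) P u v)"

definition out_dir :: "nat \<Rightarrow> ('a \<Rightarrow>\<^sub>L 'a) \<Rightarrow> 'a" where
  "out_dir n P = (SOME u. gap_vectors (C * \<tau> ^ n) P u (in_dir n P))"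

lemma gap_dirs:
  assumes "n \<ge> 1" "P \<in> products S n"
  shows "gap_vectors (C * \<tau> ^ n) P (out_dir n P) (in_dir n P)"
proof -
  have "\<exists>v u. gap_vectors (C * \<tau> ^ n) P u v" using gap[OF assms] by blast
  then have "\<exists>u. gap_vectors (C * \<tau> ^ n) P u (in_dir n P)"
    unfolding in_dir_def by (rule someI_ex)
  then show ?thesis unfolding out_dir_def by (rule someI_ex)
qed

lemma norm_dirs:
  assumes "n \<ge> 1" "P \<in> products S n"
  shows "norm (in_dir n P) = 1" "norm (out_dir n P) = 1"
  using gap_dirs[OF assms] by (auto simp: gap_vectors_def)

text \<open>
  Each further letter on the left turns the direction by an angle that decreases geometrically with
  the length reached, so the total angle is bounded by a geometric series.
\<close>

lemma in_dir_stable: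
  assumes m: "m \<ge> 1" and Q: "Q \<in> products S m" and P: "P \<in> products S l"
  shows "\<bar>in_dir m Q \<bullet> x\<bar> \<le> \<bar>in_dir (l + m) (P o\<^sub>L Q) \<bullet> x\<bar> +
    K\<^sup>2 * C * \<tau> ^ m * (\<Sum>i<l. \<tau> ^ i) * norm x"
  using P
proof (induction l arbitrary: P)
  case 0
  then show ?case by simp
next
  case (Suc l)
  then obtain A R where P: "A \<in> S" "R \<in> products S l" "P = A o\<^sub>L R" by (auto elim: products_SucE)
  have RQ: "R o\<^sub>L Q \<in> products S (l + m)" using P Q products_comp by blast
  have ARQ: "A o\<^sub>L (R o\<^sub>L Q) \<in> products S (Suc l + m)" using products_SucI[OF P(1) RQ] by simp
  have "\<bar>in_dir (l + m) (R o\<^sub>L Q) \<bullet> x\<bar> \<le>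
      \<bar>in_dir (Suc l + m) (A o\<^sub>L (R o\<^sub>L Q)) \<bullet> x\<bar> + K\<^sup>2 * (C * \<tau> ^ (l + m)) * norm x"
    using m RQ ARQ P(1)
    by (intro gap_direction_stable[OF gap_dirs gap_dirs norm_le norm_left nz]) auto
  then show ?case
    using Suc.IH[OF P(2)] P(3) by (simp add: algebra_simps power_add blinfun_compose_assoc)
qed

text \<open>
  A product \<open>Q\<close> of length \<open>m\<close> expands the vectors orthogonal to the direction selected by any longer
  product \<open>P Q\<close> at most by \<open>E \<tau>\<^sup>m \<parallel>Q\<parallel>\<close>: the gap of \<open>Q\<close> itself contributes \<open>C\<close>, the turning of the
  direction contributes the other summand.
\<close>

definition E where "E = C + K\<^sup>2 * C / (1 - \<tau>)"

lemma E_ge: "E \<ge> 1" "E \<ge> 0"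
proof -
  have "K\<^sup>2 * C / (1 - \<tau>) \<ge> 0" using K C \<tau> by (intro divide_nonneg_pos) auto
  then show "E \<ge> 1" using C by (simp add: E_def)
  then show "E \<ge> 0" by simp
qed

lemma sum_powers_le: "(\<Sum>i<l. \<tau> ^ i) \<le> 1 / (1 - \<tau>)"
proof -
  have "(\<Sum>i<l. \<tau> ^ i) = (1 - \<tau> ^ l) / (1 - \<tau>)"
    using \<tau> by (subst sum_gp_strict) auto
  also have "\<dots> \<le> 1 / (1 - \<tau>)" using \<tau> by (intro divide_right_mono) auto
  finally show ?thesis .
qed

lemma norm_orth_in_dir_le:
  assumes m: "m \<ge> 1" and Q: "Q \<in> products S m" and P: "P \<in> products S l"
    and x: "in_dir (l + m) (P o\<^sub>L Q) \<bullet> x = 0"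
  shows "norm (Q x) \<le> E * \<tau> ^ m * norm Q * norm x"
proof -
  have "norm (Q x) \<le> norm Q * (\<bar>in_dir m Q \<bullet> x\<bar> + C * \<tau> ^ m * norm x)"
    by (rule gap_vectors_norm_le[OF gap_dirs[OF m Q]])
  also have "\<bar>in_dir m Q \<bullet> x\<bar> \<le> K\<^sup>2 * C * \<tau> ^ m * (\<Sum>i<l. \<tau> ^ i) * norm x"
    using in_dir_stable[OF m Q P, of x] x by simp
  also have "\<dots> \<le> K\<^sup>2 * C * \<tau> ^ m * (1 / (1 - \<tau>)) * norm x"
    using sum_powers_le K C \<tau> by (intro mult_left_mono mult_right_mono) auto
  finally have "norm (Q x) \<le>
      norm Q * (K\<^sup>2 * C * \<tau> ^ m * (1 / (1 - \<tau>)) * norm x + C * \<tau> ^ m * norm x)"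
    by (simp add: mult_left_mono)
  then show ?thesis by (simp add: E_def algebra_simps)
qed

text \<open>
  For a fixed \<open>P\<close>, the failure of \<open>\<parallel>P Q\<parallel> = \<parallel>P\<parallel> \<parallel>Q\<parallel>\<close> is measured by \<open>defect Q\<close>, and its part along the most
  expanded direction of \<open>P Q\<close> by \<open>dir_defect\<close>. The latter is comparable to the former once \<open>Q\<close> is
  long, and increases slowly when letters are added to \<open>Q\<close> on the right.
\<close>

context
  fixes P l assumes l: "l \<ge> 1" and P: "P \<in> products S l"
begin

definition defect where "defect Q = norm Q * norm P / norm (P o\<^sub>L Q)"

definition dir_defect where
  "dir_defect m Q = norm (Q (in_dir (l + m) (P o\<^sub>L Q))) * norm P / norm (P o\<^sub>L Q)"

lemma PQ: "Q \<in> products S m \<Longrightarrow> P o\<^sub>L Q \<in> products S (l + m)" and lm: "l + m \<ge> 1"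
  using products_comp[OF P] l by auto

lemma PQ_pos: "Q \<in> products S m \<Longrightarrow> norm (P o\<^sub>L Q) > 0"
  using nz[OF lm PQ] by simp

lemma products_SucE_right:
  assumes "R \<in> products S (Suc m)"
  obtains Q B where "Q \<in> products S m" "B \<in> S" "R = Q o\<^sub>L B"
  using assms products_addE[of R S m 1] by auto

lemma defect_le_power:
  assumes "Q \<in> products S m"
  shows "norm Q * norm P \<le> (K ^ m)\<^sup>2 * norm (P o\<^sub>L Q)"
proof -
  have "norm P \<le> K ^ m * norm (P o\<^sub>L Q)"
    using assms
  proof (induction m arbitrary: Q)
    case (Suc m)
    then obtain R B where Q: "R \<in> products S m" "B \<in> S" "Q = R o\<^sub>L B"
      using products_SucE_right by blast
    have "norm (P o\<^sub>L R) \<le> K * norm (P o\<^sub>L Q)"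
      using norm_right[OF lm PQ[OF Q(1)] Q(2)] Q(3) by (simp add: blinfun_compose_assoc)
    then have "K ^ m * norm (P o\<^sub>L R) \<le> K ^ m * (K * norm (P o\<^sub>L Q))"
      using K by (intro mult_left_mono) auto
    then show ?case using Suc.IH[OF Q(1)] by (simp add: mult_ac)
  qed simp
  moreover have "norm Q \<le> K ^ m" by (rule norm_products_le[OF norm_le assms])
  ultimately have "norm Q * norm P \<le> K ^ m * (K ^ m * norm (P o\<^sub>L Q))"
    using K by (intro mult_mono) auto
  then show ?thesis by (simp add: power2_eq_square mult_ac)
qed

lemma defect_le_dir_defect:
  assumes Q: "Q \<in> products S m" and small: "E * \<tau> ^ m \<le> 1 / 2" and m: "m \<ge> 1"
  shows "defect Q \<le> 2 * dir_defect m Q"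
proof -
  define v where "v = in_dir (l + m) (P o\<^sub>L Q)"
  have nv: "norm v = 1" unfolding v_def by (rule norm_dirs(1)[OF lm PQ[OF Q]])
  have "norm (Q x) \<le> (norm (Q v) + E * \<tau> ^ m * norm Q) * norm x" for x
  proof -
    define w where "w = x - (v \<bullet> x) *\<^sub>R v"
    have w: "v \<bullet> w = 0" "norm w \<le> norm x" unfolding w_def using remove_component[OF nv] by auto
    have "Q x = (v \<bullet> x) *\<^sub>R Q v + Q w"
      by (simp add: w_def blinfun.diff_right blinfun.scaleR_right)
    then have "norm (Q x) \<le> \<bar>v \<bullet> x\<bar> * norm (Q v) + norm (Q w)"
      using norm_triangle_ineq[of "(v \<bullet> x) *\<^sub>R Q v" "Q w"] by simp
    also have "\<dots> \<le> norm x * norm (Q v) + E * \<tau> ^ m * norm Q * norm x"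
    proof (intro add_mono mult_right_mono)
      show "\<bar>v \<bullet> x\<bar> \<le> norm x" using Cauchy_Schwarz_ineq2[of v x] nv by simp
      have "norm (Q w) \<le> E * \<tau> ^ m * norm Q * norm w"
        using norm_orth_in_dir_le[OF m Q P] w(1) unfolding v_def by blast
      also have "\<dots> \<le> E * \<tau> ^ m * norm Q * norm x"
        using w(2) E_ge \<tau> by (intro mult_left_mono) auto
      finally show "norm (Q w) \<le> E * \<tau> ^ m * norm Q * norm x" .
    qed auto
    finally show ?thesis by (simp add: algebra_simps)
  qed
  then have "norm Q \<le> norm (Q v) + E * \<tau> ^ m * norm Q"
    using E_ge \<tau> by (intro norm_blinfun_bound) auto
  moreover have "E * \<tau> ^ m * norm Q \<le> 1 / 2 * norm Q" using small by (intro mult_right_mono) auto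
  ultimately have "norm Q \<le> 2 * norm (Q v)" by linarith
  then have "norm Q * norm P / norm (P o\<^sub>L Q) \<le> 2 * norm (Q v) * norm P / norm (P o\<^sub>L Q)"
    by (intro divide_right_mono mult_right_mono) auto
  then show ?thesis by (simp add: defect_def dir_defect_def v_def)
qed

text \<open>
  Split the image under \<open>B\<close> of the new direction \<open>v'\<close> into a multiple of the old direction \<open>v\<close> and a remainder.
  The norm of \<open>P Q B\<close> is at least that of \<open>P Q\<close> times the length of the first part, so the first part does not
  increase the directional defect; and \<open>Q\<close> expands the remainder at most by \<open>E \<tau>\<^sup>m \<parallel>Q\<parallel>\<close>.
\<close>

lemma dir_defect_step:
  assumes Q: "Q \<in> products S m" and B: "B \<in> S"
  shows "dir_defect (Suc m) (Q o\<^sub>L B) \<le> dir_defect m Q + K\<^sup>2 * E * \<tau> ^ m * defect Q"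
proof -
  define v where "v = in_dir (l + m) (P o\<^sub>L Q)"
  define v' where "v' = in_dir (l + Suc m) (P o\<^sub>L (Q o\<^sub>L B))"
  define u where "u = out_dir (l + m) (P o\<^sub>L Q)"
  define b where "b = B v'"
  define r where "r = b - (v \<bullet> b) *\<^sub>R v"
  have QB: "Q o\<^sub>L B \<in> products S (Suc m)" using products_comp[OF Q, of B 1] B by simp
  have nv: "norm v = 1" "norm v' = 1" "norm u = 1"
    unfolding v_def v'_def u_def
    by (rule norm_dirs[OF lm PQ[OF Q]] norm_dirs[OF lm PQ[OF QB]])+
  have uPQ: "u \<bullet> (P o\<^sub>L Q) x = norm (P o\<^sub>L Q) * (v \<bullet> x)" for x
    using gap_dirs[OF lm PQ[OF Q]] unfolding u_def v_def gap_vectors_def by blast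
  have top: "norm ((P o\<^sub>L (Q o\<^sub>L B)) v') = norm (P o\<^sub>L (Q o\<^sub>L B))"
    using gap_dirs[OF lm PQ[OF QB]] unfolding v'_def gap_vectors_def by auto
  have r: "v \<bullet> r = 0" "norm r \<le> K"
  proof -
    have "norm r \<le> norm b" "v \<bullet> r = 0" unfolding r_def using remove_component[OF nv(1)] by auto
    moreover have "norm b \<le> K"
      unfolding b_def using norm_blinfun[of B v'] nv(2) norm_le[OF B] by simp
    ultimately show "v \<bullet> r = 0" "norm r \<le> K" by auto
  qed
  have Qr: "norm (Q r) \<le> E * \<tau> ^ m * norm Q * K"
  proof (cases "m = 0")
    case True
    then have "Q = id_blinfun" using Q by simp
    moreover have "norm (id_blinfun :: 'a \<Rightarrow>\<^sub>L 'a) \<ge> 1"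
      using norm_blinfun[of "id_blinfun :: 'a \<Rightarrow>\<^sub>L 'a" v] nv by simp
    then have "1 * 1 * K \<le> E * norm (id_blinfun :: 'a \<Rightarrow>\<^sub>L 'a) * K"
      using E_ge K by (intro mult_right_mono mult_mono) auto
    ultimately show ?thesis using True r(2) by simp
  next
    case False
    then have "norm (Q r) \<le> E * \<tau> ^ m * norm Q * norm r"
      using r(1) unfolding v_def by (intro norm_orth_in_dir_le[OF _ Q P]) auto
    also have "\<dots> \<le> E * \<tau> ^ m * norm Q * K" using r(2) E_ge \<tau> by (intro mult_left_mono) auto
    finally show ?thesis .
  qed
  have vb: "norm (P o\<^sub>L Q) * \<bar>v \<bullet> b\<bar> \<le> norm (P o\<^sub>L (Q o\<^sub>L B))"
  proof -
    have "norm (P o\<^sub>L Q) * \<bar>v \<bullet> b\<bar> = \<bar>u \<bullet> (P o\<^sub>L Q) b\<bar>" unfolding uPQ by (simp add: abs_mult)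
    also have "\<dots> \<le> norm ((P o\<^sub>L (Q o\<^sub>L B)) v')"
      using Cauchy_Schwarz_ineq2[of u "(P o\<^sub>L Q) b"] nv by (simp add: b_def)
    finally show ?thesis unfolding top .
  qed
  have PQB: "norm (P o\<^sub>L Q) \<le> K * norm (P o\<^sub>L (Q o\<^sub>L B))"
    using norm_right[OF lm PQ[OF Q] B] by (simp add: blinfun_compose_assoc)
  define p where "p = norm (P o\<^sub>L Q)"
  define p' where "p' = norm (P o\<^sub>L (Q o\<^sub>L B))"
  have p: "p > 0" "p' > 0" using PQ_pos Q QB by (auto simp: p_def p'_def)
  have "(Q o\<^sub>L B) v' = (v \<bullet> b) *\<^sub>R Q v + Q r"
    by (simp add: r_def b_def blinfun.diff_right blinfun.scaleR_right)
  then have "norm ((Q o\<^sub>L B) v') \<le> \<bar>v \<bullet> b\<bar> * norm (Q v) + E * \<tau> ^ m * norm Q * K"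
    using norm_triangle_ineq[of "(v \<bullet> b) *\<^sub>R Q v" "Q r"] Qr by simp
  also have "\<dots> \<le> (p' / p) * norm (Q v) + E * \<tau> ^ m * norm Q * K"
    using vb p by (intro add_right_mono mult_right_mono) (auto simp: p_def p'_def field_simps)
  also have "\<dots> \<le> (p' / p) * norm (Q v) + E * \<tau> ^ m * norm Q * K * (K * p' / p)"
  proof -
    have "1 \<le> K * p' / p" using PQB p by (simp add: p_def p'_def field_simps)
    moreover have "0 \<le> E * \<tau> ^ m * norm Q * K" using E_ge \<tau> K by auto
    ultimately have "E * \<tau> ^ m * norm Q * K * 1 \<le> E * \<tau> ^ m * norm Q * K * (K * p' / p)"
      by (rule mult_left_mono)
    then show ?thesis by simp
  qed
  finally have "norm ((Q o\<^sub>L B) v') * norm P / p' \<le>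
      ((p' / p) * norm (Q v) + E * \<tau> ^ m * norm Q * K * (K * p' / p)) * norm P / p'"
    using p by (intro divide_right_mono mult_right_mono) auto
  also have "\<dots> = norm (Q v) * norm P / p + K\<^sup>2 * E * \<tau> ^ m * (norm Q * norm P / p)"
    using p by (simp add: field_simps power2_eq_square)
  finally show ?thesis by (simp add: dir_defect_def defect_def v_def v'_def p_def p'_def)
qed

end

text \<open>
  By the preceding step the directional defect satisfies a linear recursion with summable coefficients,
  whence it is bounded (discrete Gronwall inequality), uniformly in \<open>P\<close> and \<open>Q\<close>.
\<close>

lemma almost_multiplicative:
  obtains c where "0 < c" "c \<le> 1"
    "\<And>l m P Q. l \<ge> 1 \<Longrightarrow> P \<in> products S l \<Longrightarrow> Q \<in> products S m \<Longrightarrow>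
       c * norm P * norm Q \<le> norm (P o\<^sub>L Q)"
proof -
  have "(\<lambda>m. E * \<tau> ^ m) \<longlonglongrightarrow> E * 0" using \<tau> by (intro tendsto_intros LIMSEQ_power_zero) auto
  then have "\<forall>\<^sub>F m in sequentially. E * \<tau> ^ m < 1 / 2" by (rule order_tendstoD) simp
  then obtain m0 where m0: "\<And>m. m \<ge> m0 \<Longrightarrow> E * \<tau> ^ m < 1 / 2"
    by (auto simp: eventually_sequentially)
  \<comment> \<open>\<open>H\<close> bounds the defect of the short products, for which the gap gives nothing\<close>
  define H where "H = (K ^ (max m0 1))\<^sup>2"
  define a where "a = K\<^sup>2 * E"
  define Z where "Z = (1 + H / 2) * exp (2 * a * (1 / (1 - \<tau>)))"
  have H: "H \<ge> 1" unfolding H_def using K by simp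
  have a: "a \<ge> 0" using E_ge by (simp add: a_def)
  have Z: "Z \<ge> 1"
  proof -
    have "1 * 1 \<le> (1 + H / 2) * exp (2 * a * (1 / (1 - \<tau>)))"
      using H a \<tau> by (intro mult_mono) auto
    then show ?thesis by (simp add: Z_def)
  qed
  have main: "defect P Q \<le> 2 * Z" if l: "l \<ge> 1" and P: "P \<in> products S l" and Q: "Q \<in> products S m" for l m P Q
  proof -
    have R: "defect P Q \<le> H + 2 * dir_defect P l m Q" if Q: "Q \<in> products S m" for m Q
    proof (cases "m \<ge> max m0 1")
      case True
      then show ?thesis using defect_le_dir_defect[OF l P Q] m0[of m] H by force
    next
      case False
      have pos: "norm (P o\<^sub>L Q) > 0" by (rule PQ_pos[OF l P Q])
      have "defect P Q \<le> (K ^ m)\<^sup>2"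
        using defect_le_power[OF l P Q] pos by (simp add: defect_def[OF l P] field_simps)
      also have "\<dots> \<le> H" unfolding H_def using False K by (intro power_mono power_increasing) auto
      finally show ?thesis using H pos by (simp add: dir_defect_def[OF l P] add_increasing2)
    qed
    have "dir_defect P l m Q + H / 2 \<le> (1 + H / 2) * exp (2 * a * (\<Sum>i<m. \<tau> ^ i))"
      using Q
    proof (induction m arbitrary: Q)
      case 0
      then show ?case
        using nz[OF l P] norm_dirs(1)[OF l P] by (simp add: dir_defect_def[OF l P])
    next
      case (Suc m)
      then obtain Q' B where Q: "Q' \<in> products S m" "B \<in> S" "Q = Q' o\<^sub>L B"
        using products_SucE_right[OF l P] by blast
      define Y where "Y = dir_defect P l m Q'"
      have "dir_defect P l (Suc m) Q \<le> Y + a * \<tau> ^ m * defect P Q'"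
        using dir_defect_step[OF l P Q(1,2)] by (simp add: Q(3) Y_def a_def)
      also have "\<dots> \<le> Y + a * \<tau> ^ m * (H + 2 * Y)"
        using R[OF Q(1)] a \<tau> by (intro add_left_mono mult_left_mono) (auto simp: Y_def)
      finally have "dir_defect P l (Suc m) Q + H / 2 \<le> (Y + H / 2) * (1 + 2 * a * \<tau> ^ m)"
        by (simp add: algebra_simps)
      also have "\<dots> \<le> (Y + H / 2) * exp (2 * a * \<tau> ^ m)"
      proof (intro mult_left_mono exp_ge_add_one_self)
        show "0 \<le> Y + H / 2" using H by (simp add: Y_def dir_defect_def[OF l P])
      qed
      also have "\<dots> \<le> (1 + H / 2) * exp (2 * a * (\<Sum>i<m. \<tau> ^ i)) * exp (2 * a * \<tau> ^ m)"
        using Suc.IH[OF Q(1)] by (intro mult_right_mono) (auto simp: Y_def)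
      also have "\<dots> = (1 + H / 2) * exp (2 * a * (\<Sum>i<Suc m. \<tau> ^ i))"
        by (simp add: exp_add[symmetric] algebra_simps)
      finally show ?case .
    qed
    also have "\<dots> \<le> Z"
      unfolding Z_def using mult_left_mono[OF sum_powers_le[of m], of "2 * a"] a H
      by (intro mult_left_mono) auto
    finally show ?thesis using R[OF Q] by linarith
  qed
  show thesis
  proof (rule that[of "1 / (2 * Z)"])
    fix l m P Q assume l: "l \<ge> (1::nat)" and P: "P \<in> products S l" and Q: "Q \<in> products S m"
    have "norm (P o\<^sub>L Q) > 0" by (rule PQ_pos[OF l P Q])
    then show "1 / (2 * Z) * norm P * norm Q \<le> norm (P o\<^sub>L Q)"
      using main[OF l P Q] Z by (simp add: defect_def[OF l P] field_simps)
  qed (use Z in auto)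
qed

text \<open>
  The product of \<open>M\<close> and \<open>M'\<close> can only be large if \<open>M'\<close> does not nearly annihilate the direction into which
  \<open>M\<close> maps almost everything.
\<close>

lemma out_in_dir_transversal:
  assumes N: "N \<ge> 1" and M: "M \<in> products S N" and M': "M' \<in> products S N"
    and c: "c * norm M' * norm M \<le> norm (M' o\<^sub>L M)" and small: "C * \<tau> ^ N \<le> c / 4"
  shows "c / 2 \<le> \<bar>in_dir N M' \<bullet> out_dir N M\<bar>"
proof -
  define e where "e = C * \<tau> ^ N"
  define t where "t = \<bar>in_dir N M' \<bullet> out_dir N M\<bar>"
  have g: "gap_vectors e M (out_dir N M) (in_dir N M)" "gap_vectors e M' (out_dir N M') (in_dir N M')"
    unfolding e_def using gap_dirs[OF N] M M' by auto
  have e: "e \<ge> 0" using C \<tau> by (simp add: e_def)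
  have n1: "norm (in_dir N M) = 1" "norm (out_dir N M) = 1" using norm_dirs[OF N M] by auto
  have M'u: "norm (M' (out_dir N M)) \<le> norm M' * (t + e)"
    using gap_vectors_norm_le[OF g(2), of "out_dir N M"] n1 by (simp add: t_def)
  have "norm ((M' o\<^sub>L M) x) \<le> (norm M' * norm M * (t + 2 * e)) * norm x" for x
  proof -
    obtain r where r: "M x = (norm M * (in_dir N M \<bullet> x)) *\<^sub>R out_dir N M + r"
      "norm r \<le> e * norm M * norm x"
      using gap_vectors_remainder[OF g(1)] .
    have "norm ((M' o\<^sub>L M) x) \<le>
        norm M * \<bar>in_dir N M \<bullet> x\<bar> * norm (M' (out_dir N M)) + norm (M' r)"
      using norm_triangle_ineq[of "(norm M * (in_dir N M \<bullet> x)) *\<^sub>R M' (out_dir N M)" "M' r"]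
      by (simp add: r(1) blinfun.add_right blinfun.scaleR_right abs_mult)
    also have "\<dots> \<le> norm M * norm x * (norm M' * (t + e)) + norm M' * (e * norm M * norm x)"
    proof (intro add_mono mult_mono M'u)
      show "\<bar>in_dir N M \<bullet> x\<bar> \<le> norm x" using Cauchy_Schwarz_ineq2[of "in_dir N M" x] n1 by simp
      show "norm (M' r) \<le> norm M' * (e * norm M * norm x)"
        using norm_blinfun[of M' r] r(2) by (meson mult_left_mono norm_ge_zero order.trans)
    qed (use e in \<open>auto simp: t_def\<close>)
    finally show ?thesis by (simp add: algebra_simps)
  qed
  then have "norm (M' o\<^sub>L M) \<le> norm M' * norm M * (t + 2 * e)"
    using e by (intro norm_blinfun_bound) (auto simp: t_def)
  then have "(norm M' * norm M) * c \<le> (norm M' * norm M) * (t + 2 * e)" using c by (simp add: mult_ac)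
  moreover have "norm M' * norm M > 0" using nz[OF N] M M' by simp
  ultimately have "c \<le> t + 2 * e" by (rule mult_left_le_imp_le)
  then show ?thesis using small by (simp add: t_def e_def)
qed

text \<open>
  Around the most expanded direction of each block there is a cone of vectors making an angle bounded
  away from a right angle. A block maps its cone close to its output direction, which by transversality
  lies well inside the cone of any next block. This is robust under perturbations of the blocks that
  are small relative to their norms, and the component of a vector along the axis of the cone grows at
  least by the factor \<open>c/4 \<parallel>M\<parallel>\<close>.
\<close>

lemma norm_products_perturbed_blocks:
  assumes N: "N \<ge> 1" and c: "0 < c" "c \<le> 1"
    and mult: "\<And>P Q. P \<in> products S N \<Longrightarrow> Q \<in> products S N \<Longrightarrow> c * norm P * norm Q \<le> norm (P o\<^sub>L Q)"
    and small: "C * \<tau> ^ N \<le> c\<^sup>2 / 128"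
    and near: "\<And>M'. M' \<in> T \<Longrightarrow> \<exists>M\<in>products S N. norm (M' - M) \<le> c\<^sup>2 / 128 * norm M"
    and r: "r \<ge> 0" "\<And>M. M \<in> products S N \<Longrightarrow> r \<le> norm M"
    and P: "P \<in> products T k"
  shows "(c / 4 * r) ^ k \<le> norm P"
proof -
  define v where "v = in_dir N"
  define u where "u = out_dir N"
  have cc: "c\<^sup>2 \<le> c" using c by (simp add: power2_eq_square mult_left_le)
  have compat: "c / 2 \<le> \<bar>v M' \<bullet> u M\<bar>" if "M \<in> products S N" "M' \<in> products S N" for M M'
    unfolding u_def v_def
    using small cc c mult that by (intro out_in_dir_transversal[OF N]) auto
  \<comment> \<open>every image of the cone around \<open>v M\<close> lies in the cone around any \<open>v M\<^sub>2\<close>\<close>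
  have step: "c / 4 * norm (M' y) \<le> \<bar>v M2 \<bullet> M' y\<bar> \<and>
      c / 4 * (norm M * \<bar>v M \<bullet> y\<bar>) \<le> \<bar>v M2 \<bullet> M' y\<bar>"
    if M: "M \<in> products S N" and M2: "M2 \<in> products S N" and M': "norm (M' - M) \<le> c\<^sup>2 / 128 * norm M"
      and y: "c / 4 * norm y \<le> \<bar>v M \<bullet> y\<bar>" for M M' M2 y
  proof -
    define b where "b = \<bar>v M \<bullet> y\<bar>"
    have g: "gap_vectors (C * \<tau> ^ N) M (u M) (v M)" unfolding u_def v_def by (rule gap_dirs[OF N M])
    have n1: "norm (u M) = 1" "norm (v M2) = 1" using norm_dirs[OF N] M M2 by (auto simp: u_def v_def)
    obtain e where e: "M y = (norm M * (v M \<bullet> y)) *\<^sub>R u M + e"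
      "norm e \<le> C * \<tau> ^ N * norm M * norm y"
      using gap_vectors_remainder[OF g] .
    define e' where "e' = e + blinfun_apply (M' - M) y"
    have M'y: "M' y = (norm M * (v M \<bullet> y)) *\<^sub>R u M + e'"
      using e(1) by (simp add: e'_def blinfun.diff_left)
    have "norm e' \<le> C * \<tau> ^ N * norm M * norm y + norm (M' - M) * norm y"
      unfolding e'_def using e(2) norm_blinfun[of "M' - M" y] by (intro norm_triangle_le) linarith
    also have "\<dots> \<le> c\<^sup>2 / 128 * norm M * norm y + c\<^sup>2 / 128 * norm M * norm y"
      using small M' by (intro add_mono mult_right_mono) auto
    also have "\<dots> = norm M * (c / 16 * (c / 4 * norm y))" by (simp add: power2_eq_square)
    also have "\<dots> \<le> norm M * (c / 16 * b)"
      using y c unfolding b_def by (intro mult_left_mono) auto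
    finally have e': "norm e' \<le> norm M * (c / 16 * b)" .
    have up: "norm (M' y) \<le> norm M * b + norm e'"
      unfolding M'y b_def using n1 by (intro norm_triangle_le) (simp add: abs_mult)
    have "\<bar>v M2 \<bullet> e'\<bar> \<le> norm e'" using Cauchy_Schwarz_ineq2[of "v M2" e'] n1 by simp
    moreover have "v M2 \<bullet> M' y = norm M * (v M \<bullet> y) * (v M2 \<bullet> u M) + v M2 \<bullet> e'"
      unfolding M'y by (simp add: inner_add_right)
    ultimately have low: "norm M * b * \<bar>v M2 \<bullet> u M\<bar> - norm e' \<le> \<bar>v M2 \<bullet> M' y\<bar>"
      using abs_mult[of "norm M * (v M \<bullet> y)" "v M2 \<bullet> u M"] by (simp add: b_def abs_mult)
    have "norm M * b * (c / 2) \<le> norm M * b * \<bar>v M2 \<bullet> u M\<bar>"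
      using compat[OF M M2] by (intro mult_left_mono) (auto simp: b_def)
    then have low': "c * (norm M * b) / 2 - norm M * (c / 16 * b) \<le> \<bar>v M2 \<bullet> M' y\<bar>"
      using low e' by (simp add: mult_ac)
    have 0: "0 \<le> c * (norm M * b)" using c by (simp add: b_def)
    have "c / 4 * norm (M' y) \<le> c / 4 * (norm M * b + norm M * (c / 16 * b))"
      using up e' c by (intro mult_left_mono) auto
    also have "\<dots> = c * (norm M * b) / 4 + c * (c * (norm M * b)) / 64" by (simp add: algebra_simps)
    also have "\<dots> \<le> c * (norm M * b) / 4 + c * (norm M * b) / 64"
      using mult_right_mono[OF c(2) 0] by linarith
    finally have "c / 4 * norm (M' y) \<le> c * (norm M * b) / 4 + c * (norm M * b) / 64" .
    moreover have "norm M * (c / 16 * b) = c * (norm M * b) / 16" by simp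
    ultimately show ?thesis using low' 0 unfolding b_def[symmetric] by (auto simp: mult_ac)
  qed
  have main: "\<exists>x. norm x = 1 \<and> (\<forall>M2\<in>products S N.
      c / 4 * norm (P x) \<le> \<bar>v M2 \<bullet> P x\<bar> \<and>
      (c / 4 * r) ^ k \<le> \<bar>v M2 \<bullet> P x\<bar>)" if "k \<ge> 1"
    using that P
  proof (induction k arbitrary: P rule: nat_induct_at_least)
    case base
    then have "P \<in> T" by simp
    then obtain M where M: "M \<in> products S N" "norm (P - M) \<le> c\<^sup>2 / 128 * norm M" using near by blast
    have n: "norm (v M) = 1" using norm_dirs[OF N M(1)] by (simp add: v_def)
    then have vv: "v M \<bullet> v M = 1" by (simp add: norm_eq_1)
    have "c / 4 * r \<le> c / 4 * (norm M * 1)" using r(2)[OF M(1)] c by simp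
    moreover have "c / 4 * norm (v M) \<le> \<bar>v M \<bullet> v M\<bar>" using n vv c by simp
    moreover note step[OF M(1) _ M(2) this]
    ultimately show ?case
      using n vv by (intro exI[of _ "v M"] conjI ballI) fastforce+
  next
    case (Suc k)
    obtain M' Q where P: "M' \<in> T" "Q \<in> products T k" "P = M' o\<^sub>L Q"
      using Suc.prems by (auto elim: products_SucE)
    obtain M where M: "M \<in> products S N" "norm (M' - M) \<le> c\<^sup>2 / 128 * norm M" using near[OF P(1)] by blast
    obtain x where x: "norm x = 1" "\<And>M2. M2 \<in> products S N \<Longrightarrow>
        c / 4 * norm (Q x) \<le> \<bar>v M2 \<bullet> Q x\<bar>"
      "\<And>M2. M2 \<in> products S N \<Longrightarrow> (c / 4 * r) ^ k \<le> \<bar>v M2 \<bullet> Q x\<bar>"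
      using Suc.IH[OF P(2)] by blast
    have "(c / 4 * r) ^ Suc k \<le> c / 4 * (norm M * \<bar>v M \<bullet> Q x\<bar>)"
      using mult_mono[OF r(2)[OF M(1)] x(3)[OF M(1)]] r(1) c by (simp add: mult_ac mult_left_mono)
    then show ?case
      using step[OF M(1) _ M(2) x(2)[OF M(1)]] x(1) P(3) by (intro exI[of _ x]) fastforce
  qed
  show ?thesis
  proof (cases "k = 0")
    case True
    then have "P = id_blinfun" using P by simp
    obtain M where M: "M \<in> products S N" using products_nonempty[OF ne] by blast
    have "norm (id_blinfun :: 'a \<Rightarrow>\<^sub>L 'a) \<ge> 1"
      using norm_blinfun[of "id_blinfun :: 'a \<Rightarrow>\<^sub>L 'a" "in_dir N M"] norm_dirs[OF N M] by simp
    then show ?thesis using True \<open>P = id_blinfun\<close> by simp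
  next
    case False
    obtain M where M: "M \<in> products S N" using products_nonempty[OF ne] by blast
    obtain x where x: "norm x = 1" "(c / 4 * r) ^ k \<le> \<bar>v M \<bullet> P x\<bar>"
      using main False M by fastforce
    have "\<bar>v M \<bullet> P x\<bar> \<le> norm (P x)"
      using Cauchy_Schwarz_ineq2[of "v M" "P x"] norm_dirs[OF N M] by (simp add: v_def)
    also have "\<dots> \<le> norm P" using norm_blinfun[of P x] x(1) by simp
    finally show ?thesis using x(2) by linarith
  qed
qed

end

lemma norm_products_near:
  assumes S: "\<And>A. A \<in> S \<Longrightarrow> norm A \<le> K" and T: "\<And>B. B \<in> T \<Longrightarrow> norm B \<le> K"
    and K: "K \<ge> 1" and \<delta>: "\<delta> \<ge> 0"
    and near: "\<And>A. A \<in> S \<Longrightarrow> \<exists>B\<in>T. norm (B - A) \<le> \<delta>"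
    and P: "P \<in> products S n"
  shows "\<exists>Q\<in>products T n. norm (Q - P) \<le> \<delta> * (n * K ^ n)"
  using P
proof (induction n arbitrary: P)
  case 0
  then show ?case by simp
next
  case (Suc n)
  then obtain A R where P: "A \<in> S" "R \<in> products S n" "P = A o\<^sub>L R" by (auto elim: products_SucE)
  obtain B where B: "B \<in> T" "norm (B - A) \<le> \<delta>" using near[OF P(1)] by blast
  obtain Q where Q: "Q \<in> products T n" "norm (Q - R) \<le> \<delta> * (n * K ^ n)" using Suc.IH[OF P(2)] by blast
  have "(B o\<^sub>L Q) - P = (B o\<^sub>L (Q - R)) + ((B - A) o\<^sub>L R)"
    unfolding P(3) by (rule blinfun_eqI) (simp add: blinfun.diff_left blinfun.diff_right blinfun.add_left)
  then have "norm ((B o\<^sub>L Q) - P) \<le> norm B * norm (Q - R) + norm (B - A) * norm R"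
    using norm_blinfun_compose[of B "Q - R"] norm_blinfun_compose[of "B - A" R]
    by (simp add: norm_triangle_le)
  also have "\<dots> \<le> K * (\<delta> * (n * K ^ n)) + \<delta> * K ^ Suc n"
  proof (intro add_mono mult_mono T B Q)
    have "norm R \<le> K ^ n" by (rule norm_products_le[OF S P(2)])
    also have "\<dots> \<le> K ^ Suc n" using K by (intro power_increasing) auto
    finally show "norm R \<le> K ^ Suc n" .
  qed (use K \<delta> in auto)
  also have "\<dots> = \<delta> * (Suc n * K ^ Suc n)" by (simp add: algebra_simps)
  finally show ?case using products_SucI[OF B(1) Q(1)] by blast
qed

text \<open>
  The factor \<open>c/4\<close> lost per block costs \<open>(c/4)\<^bsup>1/N\<^esup>\<close> per letter, which tends to \<open>1\<close> with the block length \<open>N\<close>.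
  So \<open>N\<close> is chosen first, and then the letters are perturbed so little that products of length \<open>N\<close>
  remain close to those of \<open>S\<close>.
\<close>

lemma (in gapped_products) lower_spectral_radius_lower_semicontinuous:
  assumes S: "exp_bounded S" and e: "e > 0"
  shows "\<exists>\<delta>>0. \<forall>T. exp_bounded T \<longrightarrow> (\<forall>B\<in>T. \<exists>A\<in>S. norm (A - B) \<le> \<delta>) \<longrightarrow>
    lower_spectral_radius S - e \<le> lower_spectral_radius T"
proof -
  obtain c where c: "0 < c" "c \<le> 1"
    and mult: "\<And>l m P Q. l \<ge> 1 \<Longrightarrow> P \<in> products S l \<Longrightarrow> Q \<in> products S m \<Longrightarrow>
       c * norm P * norm Q \<le> norm (P o\<^sub>L Q)"
    using almost_multiplicative by blast
  define \<rho> where "\<rho> = lower_spectral_radius S"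
  have \<rho>: "\<rho> > 0" and \<rho>_le: "\<And>n P. n \<ge> 1 \<Longrightarrow> P \<in> products S n \<Longrightarrow> \<rho> ^ n \<le> norm P"
    unfolding \<rho>_def using lower_spectral_radius_basic(2,3)[OF S] by blast+
  have "(\<lambda>m. C * \<tau> ^ m) \<longlonglongrightarrow> C * 0" using \<tau> by (intro tendsto_intros LIMSEQ_power_zero) auto
  then have 1: "\<forall>\<^sub>F m in sequentially. C * \<tau> ^ m < c\<^sup>2 / 128" by (rule order_tendstoD) (use c in simp)
  have "(\<lambda>m. root m (c / 4) * \<rho>) \<longlonglongrightarrow> 1 * \<rho>" using c by (intro tendsto_intros LIMSEQ_root_const) auto
  then have 2: "\<forall>\<^sub>F m in sequentially. \<rho> - e < root m (c / 4) * \<rho>" by (rule order_tendstoD) (use e in simp)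
  obtain N where N: "N \<ge> 1" "C * \<tau> ^ N < c\<^sup>2 / 128" "\<rho> - e < root N (c / 4) * \<rho>"
    using eventually_conj[OF 1 eventually_conj[OF 2 eventually_ge_at_top[of 1]]]
    by (auto simp: eventually_sequentially)
  define K' where "K' = K + 1"
  define \<delta> where "\<delta> = min 1 (c\<^sup>2 / 128 * \<rho> ^ N / (N * K' ^ N))"
  have K': "K' > 0" using K by (simp add: K'_def)
  have \<delta>: "\<delta> > 0" using c \<rho> N K' by (simp add: \<delta>_def)
  show ?thesis
  proof (intro exI[of _ \<delta>] conjI allI impI \<delta>)
    fix T assume T: "exp_bounded T" and near: "\<forall>B\<in>T. \<exists>A\<in>S. norm (A - B) \<le> \<delta>"
    have T_le: "norm B \<le> K'" if B: "B \<in> T" for B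
    proof -
      obtain A where A: "A \<in> S" "norm (A - B) \<le> \<delta>" using near B by blast
      then have "norm B \<le> norm A + \<delta>" by (metis norm_minus_commute norm_triangle_sub add_left_mono order.trans)
      then show ?thesis using norm_le[OF A(1)] by (simp add: K'_def \<delta>_def)
    qed
    have S_le: "norm A \<le> K'" if "A \<in> S" for A using norm_le[OF that] by (simp add: K'_def)
    have blocks: "\<exists>M\<in>products S N. norm (M' - M) \<le> c\<^sup>2 / 128 * norm M" if M': "M' \<in> products T N" for M'
    proof -
      obtain M where M: "M \<in> products S N" "norm (M - M') \<le> \<delta> * (N * K' ^ N)"
        using norm_products_near[OF T_le S_le _ _ _ M', where \<delta> = \<delta>] near \<delta> K by (auto simp: K'_def)
      have "\<delta> * (N * K' ^ N) \<le> c\<^sup>2 / 128 * \<rho> ^ N / (N * K' ^ N) * (N * K' ^ N)"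
        using K' by (intro mult_right_mono) (auto simp: \<delta>_def)
      also have "\<dots> = c\<^sup>2 / 128 * \<rho> ^ N" using K' N by simp
      also have "\<dots> \<le> c\<^sup>2 / 128 * norm M" using \<rho>_le[OF N(1) M(1)] by (intro mult_left_mono) auto
      finally have "norm (M' - M) \<le> c\<^sup>2 / 128 * norm M" using M(2) norm_minus_commute[of M M'] by linarith
      then show ?thesis using M(1) by blast
    qed
    define g where "g = root N (c / 4) * \<rho>"
    have g0: "g \<ge> 0" using c \<rho> N by (simp add: g_def)
    have gN: "g ^ N = c / 4 * \<rho> ^ N" using c N by (simp add: g_def power_mult_distrib)
    have "g \<le> lower_spectral_radius T"
    proof (rule lower_spectral_radius_ge[OF T g0])
      fix k
      have "g ^ (N * max k 1) \<le> norm P" if P: "P \<in> products T (N * max k 1)" for P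
      proof -
        have "(c / 4 * \<rho> ^ N) ^ max k 1 \<le> norm P"
          using P products_products_subset[of T N "max k 1"] N c \<rho> \<rho>_le mult blocks
          by (intro norm_products_perturbed_blocks[where T = "products T N"]) auto
        then show ?thesis unfolding power_mult gN .
      qed
      moreover have "k \<le> N * max k 1" using N by (cases N) auto
      ultimately show "\<exists>n\<ge>k. \<forall>P\<in>products T n. g ^ n \<le> norm P" by blast
    qed
    then show "lower_spectral_radius S - e \<le> lower_spectral_radius T"
      using N(3) unfolding g_def[symmetric] by (simp add: \<rho>_def)
  qed
qed

section \<open>Exterior powers of linear maps\<close>

lemma blinfun_axis_eqI:
  fixes M N :: "(real^'m) \<Rightarrow>\<^sub>L 'b::real_normed_vector"
  assumes "\<And>i. M (axis i 1) = N (axis i 1)"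
  shows "M = N"
proof (rule blinfun_eqI)
  fix x :: "real^'m"
  have x: "x = (\<Sum>i\<in>UNIV. x $ i *\<^sub>R axis i 1)"
    using basis_expansion[of x] by (simp add: scalar_mult_eq_scaleR)
  show "M x = N x"
    by (subst (1 2) x) (simp add: blinfun.sum_right blinfun.scaleR_right assms)
qed

lemma blinfun_nth_axis:
  fixes M :: "(real^'m) \<Rightarrow>\<^sub>L (real^'k)"
  shows "M x $ j = (\<Sum>i\<in>UNIV. x $ i * M (axis i 1) $ j)"
proof -
  have x: "x = (\<Sum>i\<in>UNIV. x $ i *\<^sub>R axis i 1)"
    using basis_expansion[of x] by (simp add: scalar_mult_eq_scaleR)
  show ?thesis
    by (subst (1) x) (simp add: blinfun.sum_right blinfun.scaleR_right)
qed

definition adjoint_pair :: "('a::euclidean_space \<Rightarrow>\<^sub>L 'a) \<Rightarrow> ('a \<Rightarrow>\<^sub>L 'a) \<Rightarrow> bool" where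
  "adjoint_pair A B \<longleftrightarrow> (\<forall>x y. A x \<bullet> y = x \<bullet> B y)"

lemma adjoint_pair_axisI:
  fixes A B :: "(real^'m) \<Rightarrow>\<^sub>L (real^'m)"
  assumes "\<And>i j. A (axis i 1) $ j = B (axis j 1) $ i"
  shows "adjoint_pair A B"
  unfolding adjoint_pair_def
proof (intro allI)
  fix x y
  have "A x \<bullet> y = (\<Sum>j\<in>UNIV. \<Sum>i\<in>UNIV. x $ i * A (axis i 1) $ j * y $ j)"
    by (simp add: inner_vec_def blinfun_nth_axis[of A x] sum_distrib_right)
  also have "\<dots> = (\<Sum>i\<in>UNIV. \<Sum>j\<in>UNIV. x $ i * (y $ j * B (axis j 1) $ i))"
    by (subst sum.swap) (simp add: assms mult_ac)
  also have "\<dots> = x \<bullet> B y"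
    by (simp add: inner_vec_def blinfun_nth_axis[of B y] sum_distrib_left)
  finally show "A x \<bullet> y = x \<bullet> B y" .
qed

lemma adjoint_pair_axisD:
  fixes A B :: "(real^'m) \<Rightarrow>\<^sub>L (real^'m)"
  assumes "adjoint_pair A B"
  shows "A (axis i 1) $ j = B (axis j 1) $ i"
  using assms[unfolded adjoint_pair_def, rule_format, of "axis i 1" "axis j 1"]
  by (simp add: inner_axis inner_axis')

lemma adjoint_pair_commute: "adjoint_pair A B \<Longrightarrow> adjoint_pair B A"
  by (simp add: adjoint_pair_def) (metis inner_commute)

lemma ext_power_axis:
  fixes A :: "(real^'n) \<Rightarrow>\<^sub>L (real^'n)"
  shows "ext_power k A (axis I 1) =
    (if card I = k then wedge (map (\<lambda>i. A (axis i 1)) (set_enum I)) else 0)"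
proof (cases "card I = k")
  case True
  then show ?thesis
    using ext_power_wedge[of "map (\<lambda>i. axis i 1) (set_enum I)" k A] wedge_basis[of I]
    by (simp add: set_enum(3) o_def)
next
  case False
  then show ?thesis by (simp, intro ext_power_eq_0) (auto simp: axis_def)
qed

lemma ext_power_compose:
  fixes A B :: "(real^'n) \<Rightarrow>\<^sub>L (real^'n)"
  shows "ext_power k (A o\<^sub>L B) = ext_power k A o\<^sub>L ext_power k B"
proof (rule blinfun_axis_eqI)
  fix I :: "'n set"
  show "(ext_power k (A o\<^sub>L B)) (axis I 1) =
      (ext_power k A o\<^sub>L ext_power k B) (axis I 1)"
    by (auto simp: ext_power_axis ext_power_wedge set_enum(3) o_def)
qed

lemma ext_power_axis_nth:
  fixes A :: "(real^'n) \<Rightarrow>\<^sub>L (real^'n)"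
  shows "ext_power k A (axis I 1) $ J = (if card I = k \<and> card J = k then
     \<Sum>p | p permutes {..<k}. of_int (sign p) *
       (\<Prod>j<k. A (axis (set_enum I ! j) 1) $ (set_enum J ! p j)) else 0)"
  by (auto simp: ext_power_axis wedge_def set_enum(3))

text \<open>
  Transposing a minor amounts to replacing each permutation in the Leibniz formula by its inverse.
\<close>

lemma adjoint_pair_ext_power:
  fixes A B :: "(real^'n) \<Rightarrow>\<^sub>L (real^'n)"
  assumes AB: "adjoint_pair A B"
  shows "adjoint_pair (ext_power k A) (ext_power k B)"
proof (rule adjoint_pair_axisI)
  fix I J :: "'n set"
  have "(\<Sum>p | p permutes {..<k}. of_int (sign p) *
       (\<Prod>j<k. A (axis (set_enum I ! j) 1) $ (set_enum J ! p j))) =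
     (\<Sum>p | p permutes {..<k}. of_int (sign (inv p)) *
       (\<Prod>j<k. A (axis (set_enum I ! j) 1) $ (set_enum J ! inv p j)))"
    by (rule sum_permutations_inverse)
  also have "\<dots> = (\<Sum>p | p permutes {..<k}. real_of_int (sign p) *
       (\<Prod>j<k. B (axis (set_enum J ! j) 1) $ (set_enum I ! p j)))"
  proof (rule sum.cong[OF refl])
    fix p assume "p \<in> {p. p permutes {..<k}}"
    then have p: "p permutes {..<k}" by simp
    have "sign (inv p) = sign p"
      using p by (intro sign_inverse) (auto simp: permutation_permutes)
    moreover have "(\<Prod>j<k. A (axis (set_enum I ! j) 1) $ (set_enum J ! inv p j)) =
        (\<Prod>j<k. A (axis (set_enum I ! p j) 1) $ (set_enum J ! inv p (p j)))"
      using prod.permute[OF p, of "\<lambda>j. A (axis (set_enum I ! j) 1) $ (set_enum J ! inv p j)"]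
      by (simp add: o_def)
    ultimately show "real_of_int (sign (inv p)) *
          (\<Prod>j<k. A (axis (set_enum I ! j) 1) $ (set_enum J ! inv p j)) =
        real_of_int (sign p) * (\<Prod>j<k. B (axis (set_enum J ! j) 1) $ (set_enum I ! p j))"
      using permutes_inverses(2)[OF p] by (simp add: adjoint_pair_axisD[OF AB])
  qed
  finally show "ext_power k A (axis I 1) $ J = ext_power k B (axis J 1) $ I"
    by (auto simp: ext_power_axis_nth)
qed

definition diag :: "('m::finite \<Rightarrow> real) \<Rightarrow> (real^'m) \<Rightarrow>\<^sub>L (real^'m)" where
  "diag s = Blinfun (\<lambda>x. \<chi> i. s i * x $ i)"

lemma diag_nth [simp]: "(diag s) x $ i = s i * x $ i"
proof -
  have "linear (\<lambda>x. \<chi> i. s i * x $ i)"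
    by (rule linearI) (simp_all add: vec_eq_iff algebra_simps)
  then have "bounded_linear (\<lambda>x. \<chi> i. s i * x $ i)" by (simp add: linear_conv_bounded_linear)
  then show ?thesis by (simp add: diag_def bounded_linear_Blinfun_apply)
qed

lemma diag_axis: "(diag s) (axis i 1) = s i *\<^sub>R axis i 1"
  by (simp add: vec_eq_iff axis_def)

lemma diag_1: "diag (\<lambda>_. 1) = id_blinfun"
  by (rule blinfun_eqI) (simp add: vec_eq_iff)

lemma adjoint_pair_diag: "adjoint_pair (diag s) (diag s)"
  by (rule adjoint_pair_axisI) (auto simp: axis_def)

lemma wedge_scaleR:
  "wedge (map (\<lambda>i. c i *\<^sub>R w i) xs) = prod_list (map c xs) *\<^sub>R wedge (map w xs)"
proof -
  have "prod_list (map c xs) = (\<Prod>j<length xs. c (xs ! j))"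
    by (induction xs rule: rev_induct) (simp_all add: nth_append)
  then show ?thesis
    by (auto simp: vec_eq_iff wedge_def prod.distrib sum_distrib_left mult_ac)
qed

lemma ext_power_diag: "ext_power k (diag s) = diag (\<lambda>I. if card I = k then prod s I else 0)"
proof (rule blinfun_axis_eqI)
  fix I
  show "(ext_power k (diag s)) (axis I 1) =
      (diag (\<lambda>I. if card I = k then prod s I else 0)) (axis I 1)"
    using prod.distinct_set_conv_list[OF set_enum(2)[of I], of s]
    by (auto simp: ext_power_axis diag_axis wedge_scaleR wedge_basis set_enum(1))
qed

lemma norm_diag_le:
  assumes "\<And>i. x $ i \<noteq> 0 \<Longrightarrow> \<bar>s i\<bar> \<le> m" "m \<ge> 0"
  shows "norm ((diag s) x) \<le> m * norm x"
proof -
  have "norm ((diag s) x) \<le> norm (m *\<^sub>R x)"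
  proof (rule norm_le_componentwise_cart)
    fix i
    show "norm ((diag s) x $ i) \<le> norm ((m *\<^sub>R x) $ i)"
      using assms(1)[of i] assms(2) by (cases "x $ i = 0") (auto simp: abs_mult intro: mult_right_mono)
  qed
  then show ?thesis using assms(2) by simp
qed

lemma norm_diag_ge:
  assumes "\<And>i. x $ i \<noteq> 0 \<Longrightarrow> \<bar>s i\<bar> \<ge> m" "m \<ge> 0"
  shows "norm ((diag s) x) \<ge> m * norm x"
proof -
  have "norm (m *\<^sub>R x) \<le> norm ((diag s) x)"
  proof (rule norm_le_componentwise_cart)
    fix i
    show "norm ((m *\<^sub>R x) $ i) \<le> norm ((diag s) x $ i)"
      using assms(1)[of i] assms(2) by (cases "x $ i = 0") (auto simp: abs_mult intro: mult_right_mono)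
  qed
  then show ?thesis using assms(2) by simp
qed

text \<open>
  By transposition and multiplicativity, \<open>\<parallel>\<and>\<^sup>kU x\<parallel>\<^sup>2 = x \<bullet> \<and>\<^sup>k(U\<^sup>T U) x\<close>, and \<open>\<and>\<^sup>k\<close> of the identity is the
  projection onto \<open>\<and>\<^sup>k \<real>\<^sup>d\<close>.
\<close>

lemma norm_ext_power_isometry:
  fixes U U' :: "(real^'n) \<Rightarrow>\<^sub>L (real^'n)"
  assumes adj: "adjoint_pair U U'" and inv: "U' o\<^sub>L U = id_blinfun"
  shows "norm (ext_power k U x) \<le> norm x"
    and "(\<And>I. card I \<noteq> k \<Longrightarrow> x $ I = 0) \<Longrightarrow> norm (ext_power k U x) = norm x"
proof -
  define x' where "x' = (ext_power k id_blinfun) x"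
  have x': "x' $ I = (if card I = k then x $ I else 0)" for I
    by (simp add: x'_def diag_1[symmetric] ext_power_diag del: diag_nth) simp
  have "ext_power k U x \<bullet> ext_power k U x =
      x \<bullet> (ext_power k U' o\<^sub>L ext_power k U) x"
    using adjoint_pair_ext_power[OF adj, of k] by (simp add: adjoint_pair_def)
  also have "\<dots> = x \<bullet> x'" by (simp add: ext_power_compose[symmetric] inv x'_def)
  also have "\<dots> = x' \<bullet> x'" by (auto simp: inner_vec_def x' intro!: sum.cong)
  finally have eq: "norm (ext_power k U x) = norm x'" by (simp add: norm_eq)
  have "norm x' \<le> norm x" by (rule norm_le_componentwise_cart) (simp add: x')
  then show "norm (ext_power k U x) \<le> norm x" using eq by simp
  show "norm (ext_power k U x) = norm x" if "\<And>I. card I \<noteq> k \<Longrightarrow> x $ I = 0"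
  proof -
    have "x' = x" using that by (simp add: vec_eq_iff x')
    then show ?thesis using eq by simp
  qed
qed

lemma wedge_zero:
  assumes "0 \<in> set vs"
  shows "wedge vs = 0"
proof -
  obtain j where "j < length vs" "vs ! j = 0" using assms by (auto simp: in_set_conv_nth)
  then have "(\<Prod>j<length vs. vs ! j $ (set_enum I ! p j)) = 0" for I p
    by (intro prod_zero bexI[of _ j]) auto
  then show ?thesis by (simp add: wedge_def vec_eq_iff del: prod_zero_iff)
qed

text \<open>
  The hypotheses describe a kernel of dimension \<open>d - k + 1\<close>, so that \<open>M\<close> has rank below \<open>k\<close>. The shear
  \<open>G\<close> replaces one basis vector by the kernel vector \<open>x\<close>, after which every \<open>k\<close>-fold wedge of
  columns contains a zero.
\<close>

lemma ext_power_rank_deficient: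
  fixes M :: "(real^'n) \<Rightarrow>\<^sub>L (real^'n)"
  assumes I: "card I = k" and x: "x \<noteq> 0" "\<And>i. i \<notin> I \<Longrightarrow> x $ i = 0" and Mx: "M x = 0"
    and M: "\<And>i. i \<notin> I \<Longrightarrow> M (axis i 1) = 0"
  shows "ext_power k M = 0"
proof -
  obtain i0 where i0: "x $ i0 \<noteq> 0" using x(1) by (auto simp: vec_eq_iff)
  then have i0I: "i0 \<in> I" using x(2) by blast
  define w where "w = x - axis i0 1"
  have lin: "bounded_linear (\<lambda>y::real^'n. y + (c * y $ i0) *\<^sub>R w)" for c
    by (intro bounded_linear_add bounded_linear_ident bounded_linear_scaleR_const
        bounded_linear_const_mult bounded_linear_vec_nth)
  define G where "G = Blinfun (\<lambda>y::real^'n. y + (1 * y $ i0) *\<^sub>R w)"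
  define H where "H = Blinfun (\<lambda>y::real^'n. y + (- (1 / x $ i0) * y $ i0) *\<^sub>R w)"
  have G: "G y = y + (y $ i0) *\<^sub>R w" for y
    unfolding G_def by (simp add: bounded_linear_Blinfun_apply[OF lin[of 1], simplified])
  have H: "H y = y + (- (1 / x $ i0) * y $ i0) *\<^sub>R w" for y
    unfolding H_def by (rule fun_cong[OF bounded_linear_Blinfun_apply[OF lin]])
  have GH: "G o\<^sub>L H = id_blinfun"
  proof (rule blinfun_eqI)
    fix y
    show "(G o\<^sub>L H) y = id_blinfun y"
      using i0 by (simp add: G H w_def vec_eq_iff axis_def field_simps)
  qed
  have "ext_power k (M o\<^sub>L G) = 0"
  proof (rule blinfun_axis_eqI)
    fix J :: "'n set"
    show "(ext_power k (M o\<^sub>L G)) (axis J 1) = blinfun_apply 0 (axis J 1)"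
    proof (cases "card J = k")
      case J: True
      have "\<exists>j\<in>J. (M o\<^sub>L G) (axis j 1) = 0"
      proof (cases "i0 \<in> J")
        case True
        then show ?thesis by (intro bexI[of _ i0]) (simp_all add: G w_def Mx)
      next
        case False
        then have "\<not> J \<subseteq> I" using i0I I J card_subset_eq[of I J] by auto
        then obtain j where "j \<in> J" "j \<notin> I" by blast
        then show ?thesis using False M by (intro bexI[of _ j]) (auto simp: G axis_def)
      qed
      then show ?thesis using J by (auto simp: ext_power_axis set_enum(1) intro!: wedge_zero)
    qed (simp add: ext_power_axis)
  qed
  moreover have "ext_power k M = ext_power k (M o\<^sub>L G) o\<^sub>L ext_power k H"
    by (simp add: ext_power_compose[symmetric] blinfun_compose_assoc GH)
  ultimately show ?thesis by simp
qed

text \<open>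
  The minor of \<open>Z\<close> with rows and columns \<open>I\<close> is unchanged when \<open>Z\<close> is compressed to the span of \<open>I\<close>, and
  the compression has the vector \<open>x\<close> in its kernel.
\<close>

lemma ext_power_principal_minor_zero:
  fixes Z :: "(real^'n) \<Rightarrow>\<^sub>L (real^'n)"
  assumes I: "card I = k" and x: "x \<noteq> 0" "\<And>i. i \<notin> I \<Longrightarrow> x $ i = 0"
    and Zx: "\<And>i. i \<in> I \<Longrightarrow> Z x $ i = 0"
  shows "axis I 1 \<bullet> ext_power k Z (axis I 1) = 0"
proof -
  define D where "D = diag (\<lambda>i. if i \<in> I then 1 else (0::real))"
  have D: "ext_power k D (axis I 1) = axis I 1"
    using I by (simp add: D_def ext_power_diag diag_axis)
  have "ext_power k (D o\<^sub>L Z o\<^sub>L D) = 0"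
  proof (rule ext_power_rank_deficient[OF I x])
    have Dx: "D x = x" using x(2) by (auto simp: D_def vec_eq_iff)
    show "(D o\<^sub>L Z o\<^sub>L D) x = 0"
      using Zx by (simp add: Dx) (simp add: vec_eq_iff D_def)
    show "(D o\<^sub>L Z o\<^sub>L D) (axis i 1) = 0" if "i \<notin> I" for i
      using that by (simp add: D_def diag_axis)
  qed
  then have "ext_power k D o\<^sub>L ext_power k Z o\<^sub>L ext_power k D = 0" by (simp only: ext_power_compose)
  then have "(ext_power k D o\<^sub>L ext_power k Z o\<^sub>L ext_power k D) (axis I 1) = 0" by simp
  then have 0: "ext_power k D (ext_power k Z (axis I 1)) = 0"
    by (simp add: D)
  have "adjoint_pair (ext_power k D) (ext_power k D)"
    unfolding D_def by (intro adjoint_pair_ext_power adjoint_pair_diag)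
  then have "axis I 1 \<bullet> ext_power k Z (axis I 1) =
      axis I 1 \<bullet> ext_power k D (ext_power k Z (axis I 1))"
    using D by (metis adjoint_pair_def)
  then show ?thesis by (simp only: 0 inner_zero_right)
qed

lemma continuous_on_ext_power:
  "continuous_on UNIV (ext_power k :: ((real^'n) \<Rightarrow>\<^sub>L (real^'n)) \<Rightarrow> _)"
proof (rule continuous_on_blinfun_componentwise)
  fix b :: "real^('n set)"
  have "continuous_on UNIV (\<lambda>A::(real^'n) \<Rightarrow>\<^sub>L (real^'n).
      wedge (map (\<lambda>i. A (axis i 1)) (set_enum I)))" for I
    unfolding wedge_def
  proof (intro continuous_on_vec_lambda)
    fix J :: "'n set"
    show "continuous_on UNIV (\<lambda>A::(real^'n) \<Rightarrow>\<^sub>L (real^'n).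
      if card J = length (map (\<lambda>i. A (axis i 1)) (set_enum I))
      then \<Sum>p | p permutes {..<length (map (\<lambda>i. A (axis i 1)) (set_enum I))}.
        real_of_int (sign p) * (\<Prod>j<length (map (\<lambda>i. A (axis i 1)) (set_enum I)).
          map (\<lambda>i. A (axis i 1)) (set_enum I) ! j $ (set_enum J ! p j))
      else 0)"
      by (cases "card J = card I") (auto simp: set_enum(3) intro!: continuous_intros)
  qed
  then show "continuous_on UNIV (\<lambda>A::(real^'n) \<Rightarrow>\<^sub>L (real^'n). ext_power k A b)"
    unfolding ext_power_apply by (intro continuous_intros) auto
qed

lemma products_ext_power:
  assumes "n \<ge> 1"
  shows "products (ext_power k ` S) n = ext_power k ` products S n"
  using assms
proof (induction n rule: nat_induct_at_least)
  case base
  then show ?case by simp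
next
  case (Suc n)
  show ?case
  proof (intro subset_antisym subsetI)
    fix P assume "P \<in> products (ext_power k ` S) (Suc n)"
    then show "P \<in> ext_power k ` products S (Suc n)"
      using Suc by (elim products_SucE) (auto simp: ext_power_compose[symmetric] intro!: imageI products_SucI)
  next
    fix P assume "P \<in> ext_power k ` products S (Suc n)"
    then obtain A Q where "A \<in> S" "Q \<in> products S n" "P = ext_power k (A o\<^sub>L Q)"
      by (auto elim: products_SucE)
    then show "P \<in> products (ext_power k ` S) (Suc n)"
      unfolding ext_power_compose using Suc by (auto intro!: products_SucI)
  qed
qed

section \<open>Singular value decomposition\<close>

text \<open>
  A maximum point \<open>e\<close> of the quadratic form on the unit sphere of \<open>V\<close> is an eigenvector: the first variation in
  any direction \<open>w\<close> orthogonal to \<open>e\<close> is \<open>2 (T e \<bullet> w)\<close> and must vanish.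
\<close>

lemma selfadjoint_eigenvector:
  fixes T :: "'a::euclidean_space \<Rightarrow> 'a"
  assumes lin: "linear T" and sa: "\<And>x y. T x \<bullet> y = x \<bullet> T y"
    and V: "subspace V" "T ` V \<subseteq> V" "V \<noteq> {0}"
  shows "\<exists>e\<in>V. \<exists>\<mu>. norm e = 1 \<and> T e = \<mu> *\<^sub>R e"
proof -
  let ?S = "sphere 0 1 \<inter> V"
  have "compact ?S" by (intro compact_Int_closed closed_subspace V) auto
  moreover have "?S \<noteq> {}"
  proof -
    obtain x where "x \<in> V" "x \<noteq> 0" using V subspace_0[OF V(1)] by blast
    then have "(1 / norm x) *\<^sub>R x \<in> ?S" using subspace_scale[OF V(1)] by simp
    then show ?thesis by blast
  qed
  moreover have "continuous_on ?S (\<lambda>x. x \<bullet> T x)"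
    using lin by (intro continuous_intros linear_continuous_on) (simp add: linear_conv_bounded_linear)
  ultimately obtain e where "e \<in> ?S" "\<forall>x\<in>?S. x \<bullet> T x \<le> e \<bullet> T e"
    using continuous_attains_sup[of ?S "\<lambda>x. x \<bullet> T x"] by blast
  then have e: "e \<in> V" "norm e = 1" and max: "\<And>x. x \<in> V \<Longrightarrow> norm x = 1 \<Longrightarrow> x \<bullet> T x \<le> e \<bullet> T e"
    by auto
  define \<mu> where "\<mu> = e \<bullet> T e"
  have max': "x \<bullet> T x \<le> \<mu> * (x \<bullet> x)" if x: "x \<in> V" for x
  proof (cases "x = 0")
    case True
    then show ?thesis by simp
  next
    case False
    define c where "c = 1 / norm x"
    have "(c *\<^sub>R x) \<bullet> T (c *\<^sub>R x) \<le> \<mu>"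
      unfolding \<mu>_def using False x subspace_scale[OF V(1)] by (intro max) (auto simp: c_def)
    then have "c\<^sup>2 * (x \<bullet> T x) \<le> \<mu>" by (simp add: linear_cmul[OF lin] power2_eq_square mult.assoc)
    then have "(x \<bullet> T x) / (x \<bullet> x) \<le> \<mu>"
      by (simp add: c_def power_divide power2_norm_eq_inner)
    then show ?thesis using False by (simp add: field_simps)
  qed
  have orth: "T e \<bullet> w = 0" if w: "w \<in> V" "e \<bullet> w = 0" for w
  proof (rule ccontr)
    define a where "a = T e \<bullet> w"
    define b where "b = \<mu> * (w \<bullet> w) - w \<bullet> T w"
    \<comment> \<open>a step small enough for the first order term to dominate\<close>
    define t where "t = a / (\<bar>b\<bar> + 1)"
    assume "T e \<bullet> w \<noteq> 0"
    then have a: "a \<noteq> 0" by (simp add: a_def)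
    have "(e + t *\<^sub>R w) \<bullet> T (e + t *\<^sub>R w) \<le> \<mu> * ((e + t *\<^sub>R w) \<bullet> (e + t *\<^sub>R w))"
      using e w V(1) by (intro max' subspace_add subspace_scale)
    moreover have "e \<bullet> e = 1" using e by (simp add: norm_eq_1)
    moreover have "e \<bullet> T w = a" "w \<bullet> T e = a" using sa[of e w] by (auto simp: a_def inner_commute)
    ultimately have "2 * t * a \<le> t\<^sup>2 * b"
      using w(2) by (simp add: linear_add[OF lin] linear_cmul[OF lin] inner_add_left inner_add_right
          \<mu>_def[symmetric] b_def algebra_simps power2_eq_square inner_commute[of w e])
    also have "\<dots> \<le> t\<^sup>2 * (\<bar>b\<bar> + 1)" by (intro mult_left_mono) auto
    also have "\<dots> = t * (t * (\<bar>b\<bar> + 1))" by (simp add: power2_eq_square)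
    also have "t * (\<bar>b\<bar> + 1) = a" by (simp add: t_def)
    finally have "t * a \<le> 0" by (simp add: mult.commute)
    moreover have "t * a = a\<^sup>2 / (\<bar>b\<bar> + 1)" by (simp add: t_def power2_eq_square)
    moreover have "a\<^sup>2 / (\<bar>b\<bar> + 1) > 0" using a by (intro divide_pos_pos) auto
    ultimately show False by simp
  qed
  define w where "w = T e - \<mu> *\<^sub>R e"
  have w: "w \<in> V" "e \<bullet> w = 0"
    unfolding w_def using e V by (auto intro!: subspace_diff subspace_scale simp: inner_diff_right \<mu>_def norm_eq_1)
  have "w \<bullet> w = T e \<bullet> w - \<mu> * (e \<bullet> w)" by (simp add: w_def inner_diff_left)
  also have "\<dots> = 0" using orth[OF w] w by simp
  finally have "T e = \<mu> *\<^sub>R e" by (simp add: w_def)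
  then show ?thesis using e by blast
qed

lemma selfadjoint_eigenbasis:
  fixes T :: "'a::euclidean_space \<Rightarrow> 'a"
  assumes lin: "linear T" and sa: "\<And>x y. T x \<bullet> y = x \<bullet> T y"
    and V: "subspace V" "T ` V \<subseteq> V"
  shows "\<exists>B. finite B \<and> B \<subseteq> V \<and> span B = V \<and> pairwise orthogonal B \<and>
    (\<forall>b\<in>B. norm b = 1 \<and> (\<exists>\<mu>. T b = \<mu> *\<^sub>R b))"
  using V
proof (induction "dim V" arbitrary: V rule: less_induct)
  case less
  show ?case
  proof (cases "V = {0}")
    case True
    then show ?thesis by (intro exI[of _ "{}"]) auto
  next
    case False
    then obtain e \<mu> where e: "e \<in> V" "norm e = 1" "T e = \<mu> *\<^sub>R e"
      using selfadjoint_eigenvector[OF lin sa less.prems] by blast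
    have ee: "e \<bullet> e = 1" using e by (simp add: norm_eq_1)
    define W where "W = V \<inter> {y. orthogonal e y}"
    have W: "subspace W" unfolding W_def using less.prems(1) subspace_orthogonal_to_vector by (rule subspace_inter)
    have TW: "T ` W \<subseteq> W"
    proof
      fix y assume "y \<in> T ` W"
      then obtain x where x: "x \<in> V" "e \<bullet> x = 0" "y = T x" by (auto simp: W_def orthogonal_def)
      have "e \<bullet> T x = 0" using sa[of e x] x by (simp add: e(3))
      then show "y \<in> W" using x less.prems(2) by (auto simp: W_def orthogonal_def)
    qed
    have "dim W < dim V"
    proof -
      have "e \<notin> W" using ee by (simp add: W_def orthogonal_def)
      then have "W \<subset> V" using e by (auto simp: W_def)
      then show ?thesis
        using dim_psubset[of W V] W less.prems(1) by (simp add: span_eq_iff[THEN iffD2])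
    qed
    then obtain B where B: "finite B" "B \<subseteq> W" "span B = W" "pairwise orthogonal B"
      "\<forall>b\<in>B. norm b = 1 \<and> (\<exists>\<mu>. T b = \<mu> *\<^sub>R b)"
      using less.hyps[OF _ W TW] by blast
    have sub: "insert e B \<subseteq> V" using e B(2) by (auto simp: W_def)
    have "V \<subseteq> span (insert e B)"
    proof
      fix x assume x: "x \<in> V"
      have "x - (e \<bullet> x) *\<^sub>R e \<in> W"
        using x e(1) less.prems(1) ee
        by (auto simp: W_def orthogonal_def inner_diff_right intro!: subspace_diff subspace_scale)
      then have "x - (e \<bullet> x) *\<^sub>R e \<in> span (insert e B)"
        using B(3) span_mono[of B "insert e B"] by auto
      then have "(x - (e \<bullet> x) *\<^sub>R e) + (e \<bullet> x) *\<^sub>R e \<in> span (insert e B)"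
        by (rule span_add) (intro span_scale span_base, simp)
      then show "x \<in> span (insert e B)" by simp
    qed
    then have "span (insert e B) = V"
      using span_minimal[OF sub less.prems(1)] by blast
    moreover have "pairwise orthogonal (insert e B)"
      using B(2,4) by (auto simp: pairwise_insert W_def orthogonal_commute)
    ultimately show ?thesis using B e sub by (intro exI[of _ "insert e B"]) auto
  qed
qed

text \<open>The linear map that sends the standard basis to the family \<open>b\<close>, and its transpose.\<close>

definition frame :: "('m \<Rightarrow> real^'m) \<Rightarrow> (real^'m) \<Rightarrow>\<^sub>L (real^'m)" where
  "frame b = Blinfun (\<lambda>x. \<Sum>i\<in>UNIV. x $ i *\<^sub>R b i)"

definition coframe :: "('m \<Rightarrow> real^'m) \<Rightarrow> (real^'m) \<Rightarrow>\<^sub>L (real^'m)" where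
  "coframe b = Blinfun (\<lambda>y. \<chi> i. b i \<bullet> y)"

lemma frame_apply:
  fixes b :: "'m::finite \<Rightarrow> real^'m"
  shows "(frame b) x = (\<Sum>i\<in>UNIV. x $ i *\<^sub>R b i)"
proof -
  have "linear (\<lambda>x::real^'m. \<Sum>i\<in>UNIV. x $ i *\<^sub>R b i)"
    by (rule linearI) (simp_all add: scaleR_add_left sum.distrib scaleR_sum_right)
  then show ?thesis by (simp add: frame_def bounded_linear_Blinfun_apply linear_conv_bounded_linear)
qed

lemma coframe_apply:
  fixes b :: "'m::finite \<Rightarrow> real^'m"
  shows "(coframe b) y = (\<chi> i. b i \<bullet> y)"
proof -
  have "linear (\<lambda>y. \<chi> i. b i \<bullet> y)"
    by (rule linearI) (simp_all add: vec_eq_iff inner_add_right)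
  then show ?thesis by (simp add: coframe_def bounded_linear_Blinfun_apply linear_conv_bounded_linear)
qed

lemma frame_axis:
  fixes b :: "'m::finite \<Rightarrow> real^'m"
  shows "(frame b) (axis i 1) = b i"
proof -
  have "(\<Sum>j\<in>UNIV. (axis i 1 :: real^'m) $ j *\<^sub>R b j) = (\<Sum>j\<in>UNIV. if j = i then b j else 0)"
    by (intro sum.cong) (auto simp: axis_def)
  then show ?thesis by (simp add: frame_apply)
qed

definition orthogonal_pair :: "((real^'m) \<Rightarrow>\<^sub>L (real^'m)) \<Rightarrow> ((real^'m) \<Rightarrow>\<^sub>L (real^'m)) \<Rightarrow> bool" where
  "orthogonal_pair U U' \<longleftrightarrow> adjoint_pair U U' \<and> U' o\<^sub>L U = id_blinfun \<and> U o\<^sub>L U' = id_blinfun"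

lemma orthogonal_pair_frame:
  fixes b :: "'m::finite \<Rightarrow> real^'m"
  assumes "\<And>i j. b i \<bullet> b j = (if i = j then 1 else 0)"
  shows "orthogonal_pair (frame b) (coframe b)"
proof -
  have adj: "adjoint_pair (frame b) (coframe b)"
    by (rule adjoint_pair_axisI) (simp add: frame_axis coframe_apply inner_axis)
  have 1: "coframe b o\<^sub>L frame b = id_blinfun"
    by (rule blinfun_axis_eqI) (simp add: frame_axis coframe_apply vec_eq_iff assms, simp add: axis_def)
  have "inj ((frame b))"
    by (rule inj_on_inverseI[of _ "blinfun_apply (coframe b)"]) (metis 1 blinfun_apply_blinfun_compose id_blinfun.rep_eq)
  then have surj: "surj ((frame b))"
    by (intro linear_inj_imp_surj bounded_linear.linear blinfun.bounded_linear_right)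
  have "frame b o\<^sub>L coframe b = id_blinfun"
  proof (rule blinfun_eqI)
    fix y
    obtain x where "y = (frame b) x" using surj by (metis surjD)
    then show "(frame b o\<^sub>L coframe b) y = id_blinfun y"
      using 1 by (metis blinfun_apply_blinfun_compose id_blinfun.rep_eq)
  qed
  then show ?thesis using adj 1 by (simp add: orthogonal_pair_def)
qed

lemma norm_orthogonal_pair:
  assumes "orthogonal_pair U U'"
  shows "norm (U x) = norm x" "norm (U' x) = norm x"
    "U (U' x) = x" "U' (U x) = x"
proof -
  have adj: "\<And>x y. U x \<bullet> y = x \<bullet> U' y"
    using assms by (auto simp: orthogonal_pair_def adjoint_pair_def)
  show inv: "U (U' x) = x" "U' (U x) = x" for x
    using assms by (metis blinfun_apply_blinfun_compose id_blinfun.rep_eq orthogonal_pair_def)+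
  show n: "norm (U x) = norm x" for x by (simp add: norm_eq adj inv)
  show "norm (U' x) = norm x" using n[of "U' x"] inv by simp
qed

lemma dim_supported: "dim {x::real^'m. \<forall>i. i \<notin> J \<longrightarrow> x $ i = 0} = card J"
  using dim_substandard_cart[where 'a = real and d = J] by (simp add: dim_vec_eq)

lemma subspace_supported: "subspace {x::real^'m. \<forall>i. i \<notin> J \<longrightarrow> x $ i = 0}"
  by (auto simp: subspace_def)

lemma
  assumes "orthogonal_pair U U'"
  shows dim_orthogonal_supported: "dim (blinfun_apply U ` {x. \<forall>i. i \<notin> J \<longrightarrow> x $ i = 0}) = card J"
    and subspace_orthogonal_supported: "subspace (blinfun_apply U ` {x. \<forall>i. i \<notin> J \<longrightarrow> x $ i = 0})"
proof -
  have lin: "linear (blinfun_apply U)" by (intro bounded_linear.linear blinfun.bounded_linear_right)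
  have "inj (blinfun_apply U)"
    by (rule inj_on_inverseI[of _ "blinfun_apply U'"]) (rule norm_orthogonal_pair(4)[OF assms])
  then show "dim (blinfun_apply U ` {x. \<forall>i. i \<notin> J \<longrightarrow> x $ i = 0}) = card J"
    using dim_image_eq[OF lin inj_on_subset[OF _ subset_UNIV]] by (simp only: dim_supported)
  show "subspace (blinfun_apply U ` {x. \<forall>i. i \<notin> J \<longrightarrow> x $ i = 0})"
    by (rule linear_subspace_image[OF lin subspace_supported])
qed

text \<open>
  \<open>svd A U U' V V' s f\<close>: \<open>A = U D V\<^sup>T\<close> with orthogonal \<open>U\<close>, \<open>V\<close> (transposes \<open>U'\<close>, \<open>V'\<close>) and \<open>D\<close>
  diagonal with entries \<open>s\<close>. The index type has no order; \<open>f\<close> lists it by decreasing \<open>s\<close>.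
\<close>

definition svd where
  "svd A U U' V V' s f \<longleftrightarrow> orthogonal_pair U U' \<and> orthogonal_pair V V' \<and> A = U o\<^sub>L diag s o\<^sub>L V' \<and>
     (\<forall>i. s i > 0) \<and> bij_betw f {..<CARD('n)} (UNIV :: 'n set) \<and>
     (\<forall>i j. i \<le> j \<longrightarrow> j < CARD('n) \<longrightarrow> s (f j) \<le> s (f i)) \<and>
     (\<forall>k<CARD('n). singular_value (k + 1) A = s (f k))"
  for A :: "(real^'n) \<Rightarrow>\<^sub>L (real^'n)"

lemma count_sum_replicate_mset:
  "finite A \<Longrightarrow> count (\<Sum>t\<in>A. replicate_mset (g t) t) x = (if x \<in> A then g x else 0)"
  by (induction A rule: finite_induct) auto

text \<open>
  \<open>V\<close> consists of an orthonormal eigenbasis \<open>b\<close> of \<open>A\<^sup>T A\<close> and \<open>U\<close> of the normalised images \<open>A b\<^sub>i\<close>. The eigenspaces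
  of \<open>A\<^sup>T A\<close> are spanned by subsets of this basis, which identifies the multiset of singular values.
\<close>

lemma exists_svd:
  fixes A :: "(real^'n) \<Rightarrow>\<^sub>L (real^'n)"
  assumes A: "A \<in> GL"
  shows "\<exists>U U' V V' s f. svd A U U' V V' s f"
proof -
  define T where "T x = adjoint (blinfun_apply A) (A x)" for x
  have linA: "linear (blinfun_apply A)" by (intro bounded_linear.linear blinfun.bounded_linear_right)
  have linT: "linear T"
    unfolding T_def using linear_compose[OF linA adjoint_linear[OF linA]] by (simp add: o_def)
  have TA: "x \<bullet> T y = A x \<bullet> A y" for x y
    unfolding T_def by (simp add: adjoint_works[OF linA])
  have sa: "T x \<bullet> y = x \<bullet> T y" for x y using TA[of y x] TA[of x y] by (simp add: inner_commute)
  obtain B where B: "finite B" "span B = UNIV" "pairwise orthogonal B"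
    "\<And>b. b \<in> B \<Longrightarrow> norm b = 1" "\<And>b. b \<in> B \<Longrightarrow> \<exists>\<mu>. T b = \<mu> *\<^sub>R b"
    using selfadjoint_eigenbasis[OF linT sa, of UNIV] by auto
  have "independent B"
    using B by (intro pairwise_orthogonal_independent) (auto dest!: B(4))
  then have "card B = DIM(real^'n)"
    using dim_eq_card[of B UNIV] B(2) by (simp add: dim_UNIV)
  then have "card (UNIV :: 'n set) = card B" by simp
  then obtain b where b: "bij_betw b (UNIV :: 'n set) B"
    using finite_same_card_bij[of "UNIV :: 'n set" B] B(1) by auto
  then have bB: "b i \<in> B" for i by (auto simp: bij_betw_def)
  have bb: "b i \<bullet> b j = (if i = j then 1 else 0)" for i j
  proof (cases "i = j")
    case True
    then show ?thesis using B(4)[OF bB, of i] by (simp add: norm_eq_1)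
  next
    case False
    then have "b i \<noteq> b j" using b by (auto simp: bij_betw_def inj_on_def)
    then show ?thesis using B(3) bB False by (auto simp: pairwise_def orthogonal_def)
  qed
  have inj: "A x = 0 \<Longrightarrow> x = 0" for x
    using A linear_injective_0[OF linA] by (auto simp: GL_def bij_def)
  define s where "s i = norm (A (b i))" for i
  have s: "s i > 0" for i
    using inj[of "b i"] B(4)[OF bB, of i] by (auto simp: s_def)
  have Tb: "T (b i) = (s i)\<^sup>2 *\<^sub>R b i" for i
  proof -
    obtain \<mu> where \<mu>: "T (b i) = \<mu> *\<^sub>R b i" using B(5)[OF bB] by blast
    have "\<mu> = b i \<bullet> T (b i)" by (simp add: \<mu> bb)
    also have "\<dots> = (s i)\<^sup>2" by (simp add: TA s_def power2_norm_eq_inner)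
    finally show ?thesis using \<mu> by simp
  qed
  define c where "c i = (1 / s i) *\<^sub>R A (b i)" for i
  have cc: "c i \<bullet> c j = (if i = j then 1 else 0)" for i j
    using s[of i] s[of j] by (auto simp: c_def TA[symmetric] Tb bb power2_eq_square)
  have V: "orthogonal_pair (frame b) (coframe b)" by (rule orthogonal_pair_frame[OF bb])
  have U: "orthogonal_pair (frame c) (coframe c)" by (rule orthogonal_pair_frame[OF cc])
  have AV: "A o\<^sub>L frame b = frame c o\<^sub>L diag s"
  proof (rule blinfun_axis_eqI)
    fix i
    show "(A o\<^sub>L frame b) (axis i 1) = (frame c o\<^sub>L diag s) (axis i 1)"
      using s[of i] by (simp add: frame_axis diag_axis blinfun.scaleR_right c_def)
  qed
  have "A = (A o\<^sub>L frame b) o\<^sub>L coframe b"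
    using V by (simp add: blinfun_compose_assoc orthogonal_pair_def)
  then have decomp: "A = frame c o\<^sub>L diag s o\<^sub>L coframe b" by (simp add: AV)
  have T_frame: "T ((frame b) x) = (frame b) (\<chi> i. (s i)\<^sup>2 * x $ i)" for x
    by (simp add: frame_apply linear_sum[OF linT] linear_cmul[OF linT] Tb mult.commute)
  have gram: "gram_eigenspace A \<mu> = (frame b) ` {x. \<forall>i. i \<notin> {i. (s i)\<^sup>2 = \<mu>} \<longrightarrow> x $ i = 0}" for \<mu>
  proof (intro subset_antisym subsetI)
    fix v assume "v \<in> gram_eigenspace A \<mu>"
    then have v: "T v = \<mu> *\<^sub>R v" by (simp add: gram_eigenspace_def T_def)
    define x where "x = (coframe b) v"
    have vx: "v = (frame b) x" by (simp add: x_def norm_orthogonal_pair(3)[OF V])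
    have "(frame b) (\<chi> i. (s i)\<^sup>2 * x $ i) = (frame b) (\<mu> *\<^sub>R x)"
      using v unfolding vx T_frame by (simp add: blinfun.scaleR_right)
    then have "(\<chi> i. (s i)\<^sup>2 * x $ i) = \<mu> *\<^sub>R x" using norm_orthogonal_pair(4)[OF V] by metis
    then show "v \<in> (frame b) ` {x. \<forall>i. i \<notin> {i. (s i)\<^sup>2 = \<mu>} \<longrightarrow> x $ i = 0}"
      unfolding vx by (intro imageI) (auto simp: vec_eq_iff)
  next
    fix v assume "v \<in> (frame b) ` {x. \<forall>i. i \<notin> {i. (s i)\<^sup>2 = \<mu>} \<longrightarrow> x $ i = 0}"
    then obtain x where x: "v = (frame b) x" "\<And>i. (s i)\<^sup>2 \<noteq> \<mu> \<Longrightarrow> x $ i = 0" by auto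
    then have "(\<chi> i. (s i)\<^sup>2 * x $ i) = \<mu> *\<^sub>R x" by (auto simp: vec_eq_iff)
    then show "v \<in> gram_eigenspace A \<mu>"
      using T_frame[of x] by (simp add: gram_eigenspace_def x(1) T_def blinfun.scaleR_right)
  qed
  have dim_gram: "dim (gram_eigenspace A (t\<^sup>2)) = card {i. s i = t}" if "t \<ge> 0" for t
  proof -
    have "{i. (s i)\<^sup>2 = t\<^sup>2} = {i. s i = t}"
      using s that by (auto simp: power2_eq_iff_nonneg less_imp_le)
    then show ?thesis by (simp only: gram dim_orthogonal_supported[OF V])
  qed
  have sub: "subspace (gram_eigenspace A \<mu>)" for \<mu>
    unfolding gram by (rule subspace_orthogonal_supported[OF V])
  have set_eq: "{t. t \<ge> 0 \<and> gram_eigenspace A (t\<^sup>2) \<noteq> {0}} = range s"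
  proof -
    have "gram_eigenspace A (t\<^sup>2) \<noteq> {0} \<longleftrightarrow> t \<in> range s" if t: "t \<ge> 0" for t
    proof -
      have "gram_eigenspace A (t\<^sup>2) = {0} \<longleftrightarrow> dim (gram_eigenspace A (t\<^sup>2)) = 0"
        using sub[of "t\<^sup>2"] subspace_0[OF sub[of "t\<^sup>2"]] by (auto simp: dim_eq_0)
      also have "\<dots> \<longleftrightarrow> {i. s i = t} = {}" by (simp add: dim_gram[OF t])
      finally show ?thesis by auto
    qed
    moreover have "s i \<ge> 0" for i using s[of i] by simp
    ultimately show ?thesis by blast
  qed
  have mset: "singular_mset A = image_mset s (mset_set UNIV)"
  proof (rule multiset_eqI)
    fix x
    have "count (singular_mset A) x = (if x \<in> range s then dim (gram_eigenspace A (x\<^sup>2)) else 0)"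
      unfolding singular_mset_def set_eq by (rule count_sum_replicate_mset) simp
    also have "\<dots> = card {i. s i = x}"
    proof (cases "x \<in> range s")
      case True
      then have "x \<ge> 0" using s by (auto intro: less_imp_le)
      then show ?thesis using True by (simp add: dim_gram)
    next
      case False
      then have "{i. s i = x} = {}" by auto
      then show ?thesis using False by simp
    qed
    also have "\<dots> = count (image_mset s (mset_set UNIV)) x"
      by (simp add: count_image_mset vimage_def)
    finally show "count (singular_mset A) x = count (image_mset s (mset_set UNIV)) x" .
  qed
  obtain ys :: "'n list" where ys: "set ys = UNIV" "distinct ys"
    using finite_distinct_list[of "UNIV :: 'n set"] by auto
  define xs where "xs = rev (sort_key s ys)"
  have xs: "set xs = UNIV" "distinct xs" "sorted (map s (rev xs))"
    using ys by (auto simp: xs_def)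
  have len: "length xs = CARD('n)" using distinct_card[OF xs(2)] xs(1) by simp
  define f where "f k = xs ! k" for k
  have "mset xs = mset_set UNIV" using xs(1,2) mset_set_set[of xs] by simp
  then have "singular_mset A = mset (map s xs)" using mset by simp
  then have "sorted_list_of_multiset (singular_mset A) = sort (map s xs)"
    by (simp only: sorted_list_of_multiset_mset)
  also have "\<dots> = map s (rev xs)"
    by (rule properties_for_sort[OF _ xs(3)]) simp
  finally have sv: "singular_value (k + 1) A = s (f k)" if "k < CARD('n)" for k
    using that by (simp add: singular_value_def rev_map f_def len)
  have "bij_betw f {..<CARD('n)} UNIV"
    unfolding f_def using bij_betw_nth[OF xs(2), of "{..<CARD('n)}" UNIV] len xs(1) by simp
  moreover have "s (f j) \<le> s (f i)" if "i \<le> j" "j < CARD('n)" for i j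
  proof -
    have "sorted (rev (map s xs))" using xs(3) by (simp only: rev_map)
    then have "map s xs ! j \<le> map s xs ! i"
      by (rule sorted_rev_nth_mono) (use that len in simp_all)
    then show ?thesis using that len by (simp add: f_def)
  qed
  ultimately show ?thesis
    unfolding svd_def using U V decomp s sv
    by (intro exI[of _ "frame c"] exI[of _ "coframe c"] exI[of _ "frame b"] exI[of _ "coframe b"]
        exI[of _ s] exI[of _ f]) simp
qed

section \<open>Norms and spectral gaps of exterior powers\<close>

lemma ex_blinfun_inverse:
  fixes A :: "(real^'n) \<Rightarrow>\<^sub>L (real^'n)"
  assumes A: "A \<in> GL"
  obtains B where "B o\<^sub>L A = id_blinfun" "A o\<^sub>L B = id_blinfun"
proof -
  have bij: "bij (blinfun_apply A)" using A by (simp add: GL_def)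
  have lin: "linear (blinfun_apply A)" by (intro bounded_linear.linear blinfun.bounded_linear_right)
  have "linear (inv (blinfun_apply A))"
    using inj_linear_imp_inv_linear[OF lin] bij by (simp add: bij_def)
  then have B: "blinfun_apply (Blinfun (inv (blinfun_apply A))) = inv (blinfun_apply A)"
    by (simp add: bounded_linear_Blinfun_apply linear_conv_bounded_linear)
  show thesis
  proof (rule that[of "Blinfun (inv (blinfun_apply A))"]; rule blinfun_eqI)
    fix x
    show "(Blinfun (inv (blinfun_apply A)) o\<^sub>L A) x = id_blinfun x"
      using bij by (simp add: B bij_def inv_f_f)
    show "(A o\<^sub>L Blinfun (inv (blinfun_apply A))) x = id_blinfun x"
      using bij by (simp add: B bij_def surj_f_inv_f)
  qed
qed

lemma GL_I:
  fixes A :: "(real^'n) \<Rightarrow>\<^sub>L (real^'n)"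
  assumes "\<And>x. A x = 0 \<Longrightarrow> x = 0"
  shows "A \<in> GL"
proof -
  have lin: "linear (blinfun_apply A)" by (intro bounded_linear.linear blinfun.bounded_linear_right)
  then have "inj (blinfun_apply A)" using assms linear_injective_0[OF lin] by blast
  then show ?thesis using linear_inj_imp_surj[OF lin] by (simp add: GL_def bij_def)
qed

definition expands_by :: "real \<Rightarrow> ('a::euclidean_space \<Rightarrow>\<^sub>L 'a) \<Rightarrow> bool" where
  "expands_by \<kappa> A \<longleftrightarrow> (\<forall>x. \<kappa> * norm x \<le> norm (A x))"

lemma expands_by_GL:
  fixes A :: "(real^'n) \<Rightarrow>\<^sub>L (real^'n)"
  assumes "expands_by \<kappa> A" "\<kappa> > 0"
  shows "A \<in> GL"
proof (rule GL_I)
  fix x assume "A x = 0"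
  then have "\<kappa> * norm x \<le> 0" using assms(1) by (metis expands_by_def norm_zero)
  then show "x = 0" using assms(2) by (simp add: mult_le_0_iff)
qed

lemma expands_by_products:
  fixes S :: "('a::euclidean_space \<Rightarrow>\<^sub>L 'a) set"
  assumes S: "\<And>A. A \<in> S \<Longrightarrow> expands_by \<kappa> A" and \<kappa>: "\<kappa> \<ge> 0" and P: "P \<in> products S n"
  shows "expands_by (\<kappa> ^ n) P"
  using P
proof (induction n arbitrary: P)
  case 0
  then show ?case by (simp add: expands_by_def)
next
  case (Suc n)
  then obtain A Q where P: "A \<in> S" "Q \<in> products S n" "P = A o\<^sub>L Q" by (auto elim: products_SucE)
  show ?case
    unfolding expands_by_def
  proof
    fix x :: 'a
    have "\<kappa> ^ Suc n * norm x = \<kappa> * (\<kappa> ^ n * norm x)" by simp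
    also have "\<dots> \<le> \<kappa> * norm (Q x)"
      using Suc.IH[OF P(2)] \<kappa> by (intro mult_left_mono) (auto simp: expands_by_def)
    also have "\<dots> \<le> norm (P x)" using S[OF P(1)] by (simp add: P(3) expands_by_def)
    finally show "\<kappa> ^ Suc n * norm x \<le> norm (P x)" .
  qed
qed

lemma KGL_bounds:
  fixes S :: "((real^'n) \<Rightarrow>\<^sub>L (real^'n)) set"
  assumes S: "S \<in> KGL"
  obtains K \<kappa> where "K \<ge> 1" "0 < \<kappa>" "\<kappa> \<le> 1"
    "\<And>A. A \<in> S \<Longrightarrow> norm A \<le> K" "\<And>A. A \<in> S \<Longrightarrow> expands_by \<kappa> A"
proof -
  have comp: "compact S" and ne: "S \<noteq> {}" and GL: "S \<subseteq> GL" using S by (auto simp: KGL_def)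
  obtain K where K: "\<And>A. A \<in> S \<Longrightarrow> norm A \<le> K"
    using compact_imp_bounded[OF comp] by (auto simp: bounded_iff)
  let ?X = "S \<times> sphere (0::real^'n) 1"
  let ?g = "\<lambda>p. norm (blinfun_apply (fst p) (snd p))"
  have "compact ?X" using comp by (intro compact_Times) auto
  moreover have "?X \<noteq> {}" using ne by auto
  moreover have "continuous_on ?X ?g" by (intro continuous_intros)
  ultimately obtain p where p: "p \<in> ?X" "\<And>q. q \<in> ?X \<Longrightarrow> ?g p \<le> ?g q"
    using continuous_attains_inf[of ?X ?g] by blast
  have "?g p > 0"
  proof -
    have "inj (blinfun_apply (fst p))" using p(1) GL by (auto simp: GL_def bij_def)
    moreover have "snd p \<noteq> 0" using p(1) by auto
    ultimately have "blinfun_apply (fst p) (snd p) \<noteq> 0"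
      by (metis blinfun.zero_right injD)
    then show ?thesis by simp
  qed
  moreover have "expands_by (min 1 (?g p)) A" if A: "A \<in> S" for A
    unfolding expands_by_def
  proof
    fix x :: "real^'n"
    show "min 1 (?g p) * norm x \<le> norm (A x)"
    proof (cases "x = 0")
      case False
      have "?g p \<le> norm (A ((1 / norm x) *\<^sub>R x))"
        using p(2)[of "(A, (1 / norm x) *\<^sub>R x)"] A False by simp
      also have "\<dots> = norm (A x) / norm x"
        by (simp add: blinfun.scaleR_right)
      finally have "?g p * norm x \<le> norm (A x)" using False by (simp add: field_simps)
      moreover have "min 1 (?g p) * norm x \<le> ?g p * norm x" by (intro mult_right_mono) auto
      ultimately show ?thesis by linarith
    qed simp
  qed
  ultimately show thesis
    using that[of "max 1 K" "min 1 (?g p)"] K by (auto simp: le_max_iff_disj)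
qed

context
  fixes A U U' V V' :: "(real^'n) \<Rightarrow>\<^sub>L (real^'n)" and s :: "'n \<Rightarrow> real" and f :: "nat \<Rightarrow> 'n"
  assumes svd: "svd A U U' V V' s f"
begin

lemma svdD:
  shows U: "orthogonal_pair U U'" and V: "orthogonal_pair V V'" and A_eq: "A = U o\<^sub>L diag s o\<^sub>L V'"
    and s_pos: "s i > 0" and f_bij: "bij_betw f {..<CARD('n)} UNIV"
    and s_mono: "i' \<le> j' \<Longrightarrow> j' < CARD('n) \<Longrightarrow> s (f j') \<le> s (f i')"
    and sv: "k < CARD('n) \<Longrightarrow> singular_value (k + 1) A = s (f k)"
  using svd unfolding svd_def by auto

definition top_indices where "top_indices k = f ` {..<k}"

lemma inj_f: "k \<le> CARD('n) \<Longrightarrow> inj_on f {..<k}"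
  using f_bij by (auto simp: bij_betw_def intro: inj_on_subset)

lemma card_top: "k \<le> CARD('n) \<Longrightarrow> card (top_indices k) = k"
  using card_image[OF inj_f] by (simp add: top_indices_def)

lemma not_top: "k \<le> CARD('n) \<Longrightarrow> i \<notin> top_indices k \<Longrightarrow> \<exists>j\<ge>k. j < CARD('n) \<and> i = f j"
proof -
  assume "i \<notin> top_indices k"
  moreover have "i \<in> f ` {..<CARD('n)}" using f_bij by (simp add: bij_betw_def)
  ultimately show ?thesis by (force simp: top_indices_def not_less)
qed

lemma prod_top: "k \<le> CARD('n) \<Longrightarrow> prod s (top_indices k) = (\<Prod>j<k. s (f j))"
  unfolding top_indices_def by (subst prod.reindex[OF inj_f]) auto

lemma prod_s_pos: "prod s I > 0"
  by (intro prod_pos) (simp add: s_pos)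

text \<open>
  Exchange argument: \<open>I\<close> arises from the index set of the \<open>k\<close> largest entries by replacing \<open>m \<ge> 1\<close> elements,
  and each replacement loses at least the factor \<open>\<sigma>\<^bsub>k+1\<^esub>/\<sigma>\<^sub>k\<close>.
\<close>

lemma prod_not_top_le:
  assumes k: "1 \<le> k" "k < CARD('n)" and I: "card I = k" "I \<noteq> top_indices k"
  shows "prod s I \<le> s (f k) / s (f (k - 1)) * prod s (top_indices k)"
proof -
  define T where "T = top_indices k"
  define a where "a = s (f (k - 1))"
  define b where "b = s (f k)"
  have ab: "0 < b" "b \<le> a" using s_pos s_mono[of "k - 1" k] k by (auto simp: a_def b_def)
  have T: "card T = k" using card_top k by (simp add: T_def)
  define m where "m = card (I - T)"
  have "card (I - T) + card (I \<inter> T) = card I" "card (T - I) + card (I \<inter> T) = card T"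
    using card_Diff_subset_Int[of I T] card_Diff_subset_Int[of T I]
      card_mono[of I "I \<inter> T"] card_mono[of T "I \<inter> T"] by (auto simp: Int_commute)
  then have m': "card (T - I) = m" using I T by (simp add: m_def)
  have "m \<noteq> 0"
  proof
    assume "m = 0"
    then have "I \<subseteq> T" by (auto simp: m_def)
    then show False using I T card_subset_eq[of T I] by (auto simp: T_def)
  qed
  then obtain m0 where m0: "m = Suc m0" by (cases m) auto
  have "prod s (I - T) \<le> prod (\<lambda>_. b) (I - T)"
  proof (rule prod_mono)
    fix i assume "i \<in> I - T"
    then obtain j where "j \<ge> k" "j < CARD('n)" "i = f j" using not_top[of k i] k by (auto simp: T_def)
    then show "0 \<le> s i \<and> s i \<le> b" using s_mono s_pos[of i] by (auto simp: b_def)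
  qed
  then have le: "prod s (I - T) \<le> b ^ m" by (simp add: m_def)
  have "prod (\<lambda>_. a) (T - I) \<le> prod s (T - I)"
  proof (rule prod_mono)
    fix i assume "i \<in> T - I"
    then obtain j where "j < k" "i = f j" by (auto simp: T_def top_indices_def)
    then show "0 \<le> a \<and> a \<le> s i" using s_mono[of j "k - 1"] k ab by (auto simp: a_def)
  qed
  then have ge: "a ^ m \<le> prod s (T - I)" by (simp add: m')
  have "prod s (I - T) * a \<le> b ^ m * a" using le ab by (intro mult_right_mono) auto
  also have "\<dots> = b * (b ^ m0 * a)" by (simp add: m0)
  also have "\<dots> \<le> b * (a ^ m0 * a)" using ab by (intro mult_left_mono mult_right_mono power_mono) auto
  also have "\<dots> \<le> b * prod s (T - I)" using ge ab by (intro mult_left_mono) (auto simp: m0 mult.commute)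
  finally have "prod s (I - T) * a * prod s (I \<inter> T) \<le> b * prod s (T - I) * prod s (I \<inter> T)"
    using prod_s_pos[of "I \<inter> T"] by (intro mult_right_mono) auto
  moreover have "prod s I = prod s (I - T) * prod s (I \<inter> T)"
    by (subst mult.commute, subst prod.Int_Diff[of I s T]) simp_all
  moreover have "prod s T = prod s (T - I) * prod s (I \<inter> T)"
    by (subst mult.commute, subst prod.Int_Diff[of T s I]) (simp_all add: Int_commute)
  ultimately have "a * prod s I \<le> b * prod s T" by (simp add: mult_ac)
  then show ?thesis using ab unfolding a_def[symmetric] b_def[symmetric] T_def[symmetric]
    by (simp add: field_simps)
qed

lemma only_top:
  assumes "k = 0 \<or> k = CARD('n)" "card I = k"
  shows "I = top_indices k"
proof (cases "k = 0")
  case True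
  then show ?thesis using assms by (simp add: top_indices_def)
next
  case False
  then have "card I = CARD('n)" "card (top_indices k) = CARD('n)"
    using assms card_top[of k] by simp_all
  then have "I = UNIV" "top_indices k = UNIV"
    using card_subset_eq[of UNIV I] card_subset_eq[of UNIV "top_indices k"] by simp_all
  then show ?thesis by simp
qed

lemma prod_le_top:
  assumes k: "k \<le> CARD('n)" and I: "card I = k"
  shows "prod s I \<le> prod s (top_indices k)"
proof (cases "I = top_indices k")
  case False
  then have "\<not> (k = 0 \<or> k = CARD('n))" using only_top[OF _ I] by blast
  then have k': "1 \<le> k" "k < CARD('n)" using k by auto
  have "s (f k) / s (f (k - 1)) \<le> 1" using s_mono[of "k - 1" k] s_pos[of "f (k - 1)"] k' by simp
  then have "s (f k) / s (f (k - 1)) * prod s (top_indices k) \<le> 1 * prod s (top_indices k)"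
    using prod_s_pos by (intro mult_right_mono) (auto intro: less_imp_le)
  then show ?thesis using prod_not_top_le[OF k' I False] by linarith
qed simp

definition top_out where "top_out k = ext_power k U (axis (top_indices k) 1)"
definition top_in where "top_in k = ext_power k V (axis (top_indices k) 1)"

lemma adjU: "adjoint_pair U U'" "adjoint_pair U' U" "U' o\<^sub>L U = id_blinfun" "U o\<^sub>L U' = id_blinfun"
  and adjV: "adjoint_pair V V'" "adjoint_pair V' V" "V' o\<^sub>L V = id_blinfun" "V o\<^sub>L V' = id_blinfun"
  using U V adjoint_pair_commute by (auto simp: orthogonal_pair_def)

lemma ext_power_svd_apply:
  "ext_power k A x =
    ext_power k U ((diag (\<lambda>I. if card I = k then prod s I else 0))
      (ext_power k V' x))"
  unfolding A_eq ext_power_compose ext_power_diag by simp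

lemma ext_power_id_axis: "card I = k \<Longrightarrow> (ext_power k id_blinfun) (axis I 1) = axis I 1"
  unfolding diag_1[symmetric] ext_power_diag by (simp add: diag_axis)

lemma top_norms:
  assumes "k \<le> CARD('n)"
  shows "norm (top_out k) = 1" "norm (top_in k) = 1"
proof -
  have "(axis (top_indices k) 1 :: real^('n set)) $ I = 0" if "card I \<noteq> k" for I
    using that card_top[OF assms] by (auto simp: axis_def)
  then show "norm (top_out k) = 1" "norm (top_in k) = 1"
    unfolding top_out_def top_in_def
    using norm_ext_power_isometry(2)[OF adjU(1,3)] norm_ext_power_isometry(2)[OF adjV(1,3)]
    by (simp_all add: norm_axis_1)
qed

lemma ext_V'_top_in: "k \<le> CARD('n) \<Longrightarrow> ext_power k V' (top_in k) = axis (top_indices k) 1"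
  using ext_power_compose[of k V' V] adjV(3) ext_power_id_axis[OF card_top]
  by (simp add: top_in_def) (metis blinfun_apply_blinfun_compose)

lemma ext_U'_top_out: "k \<le> CARD('n) \<Longrightarrow> ext_power k U' (top_out k) = axis (top_indices k) 1"
  using ext_power_compose[of k U' U] adjU(3) ext_power_id_axis[OF card_top]
  by (simp add: top_out_def) (metis blinfun_apply_blinfun_compose)

lemma ext_power_top_in:
  assumes k: "k \<le> CARD('n)"
  shows "ext_power k A (top_in k) = prod s (top_indices k) *\<^sub>R top_out k"
  by (simp add: ext_power_svd_apply ext_V'_top_in[OF k] diag_axis card_top[OF k] blinfun.scaleR_right top_out_def)

lemma norm_ext_power:
  assumes k: "k \<le> CARD('n)"
  shows "norm (ext_power k A) = prod s (top_indices k)"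
proof (rule antisym)
  show "norm (ext_power k A) \<le> prod s (top_indices k)"
  proof (rule norm_blinfun_bound)
    fix x
    have "norm (ext_power k A x) \<le>
        norm ((diag (\<lambda>I. if card I = k then prod s I else 0)) (ext_power k V' x))"
      unfolding ext_power_svd_apply by (rule norm_ext_power_isometry(1)[OF adjU(1,3)])
    also have "\<dots> \<le> prod s (top_indices k) * norm (ext_power k V' x)"
      using prod_le_top[OF k] prod_s_pos by (intro norm_diag_le) (auto simp: less_imp_le)
    also have "\<dots> \<le> prod s (top_indices k) * norm x"
      using prod_s_pos norm_ext_power_isometry(1)[OF adjV(2,4)] by (intro mult_left_mono) (auto intro: less_imp_le)
    finally show "norm (ext_power k A x) \<le> prod s (top_indices k) * norm x" .
  qed (use prod_s_pos in \<open>auto intro: less_imp_le\<close>)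
  show "prod s (top_indices k) \<le> norm (ext_power k A)"
    using norm_blinfun[of "ext_power k A" "top_in k"] top_norms[OF k] prod_s_pos[of "top_indices k"]
    by (simp add: ext_power_top_in[OF k])
qed

text \<open>
  \<open>\<and>\<^sup>k A\<close> inherits a decomposition \<open>\<and>\<^sup>kU \<and>\<^sup>kD \<and>\<^sup>kV\<^sup>T\<close> with diagonal middle factor, whose entries are the products of
  \<open>k\<close> singular values.
\<close>

lemma gap_vectors_ext_power:
  assumes k: "k \<le> CARD('n)" and \<epsilon>: "\<epsilon> \<ge> 0"
    and le: "\<And>I. card I = k \<Longrightarrow> I \<noteq> top_indices k \<Longrightarrow> prod s I \<le> \<epsilon> * prod s (top_indices k)"
  shows "gap_vectors \<epsilon> (ext_power k A) (top_out k) (top_in k)"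
  unfolding gap_vectors_def
proof (intro conjI allI impI \<epsilon> top_norms k)
  show "ext_power k A (top_in k) = norm (ext_power k A) *\<^sub>R top_out k"
    unfolding norm_ext_power[OF k] by (rule ext_power_top_in[OF k])
  have v: "top_in k \<bullet> x = ext_power k V' x $ top_indices k" for x
    using adjoint_pair_ext_power[OF adjV(1), of k] by (simp add: adjoint_pair_def top_in_def inner_axis')
  show "top_out k \<bullet> ext_power k A x = norm (ext_power k A) * (top_in k \<bullet> x)" for x
  proof -
    let ?y = "(diag (\<lambda>I. if card I = k then prod s I else 0)) (ext_power k V' x)"
    have "top_out k \<bullet> (ext_power k U) ?y = ext_power k U' (top_out k) \<bullet> ?y"
      using adjoint_pair_ext_power[OF adjU(2), of k] by (simp add: adjoint_pair_def)
    also have "\<dots> = prod s (top_indices k) * ext_power k V' x $ top_indices k"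
      by (simp add: ext_U'_top_out[OF k] inner_axis' card_top[OF k])
    finally show ?thesis unfolding v norm_ext_power[OF k] ext_power_svd_apply .
  qed
  fix x assume "top_in k \<bullet> x = 0"
  then have 0: "ext_power k V' x $ top_indices k = 0" by (simp add: v)
  have nn: "0 \<le> \<epsilon> * prod s (top_indices k)" using \<epsilon> prod_s_pos by (simp add: less_imp_le)
  have "norm (ext_power k A x) \<le>
      norm ((diag (\<lambda>I. if card I = k then prod s I else 0)) (ext_power k V' x))"
    unfolding ext_power_svd_apply by (rule norm_ext_power_isometry(1)[OF adjU(1,3)])
  also have "\<dots> \<le> (\<epsilon> * prod s (top_indices k)) * norm (ext_power k V' x)"
  proof (rule norm_diag_le[OF _ nn])
    fix I assume "ext_power k V' x $ I \<noteq> 0"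
    then have "I \<noteq> top_indices k" using 0 by metis
    then show "\<bar>if card I = k then prod s I else 0\<bar> \<le> \<epsilon> * prod s (top_indices k)"
      using le[of I] prod_s_pos[of I] nn by (cases "card I = k") auto
  qed
  also have "\<dots> \<le> (\<epsilon> * prod s (top_indices k)) * norm x"
    using nn norm_ext_power_isometry(1)[OF adjV(2,4)] by (intro mult_left_mono) auto
  finally show "norm (ext_power k A x) \<le> \<epsilon> * norm (ext_power k A) * norm x"
    by (simp add: norm_ext_power[OF k])
qed

lemma gap_vectors_singular_values:
  assumes k: "1 \<le> k" "k < CARD('n)"
  shows "gap_vectors (singular_value (k + 1) A / singular_value k A) (ext_power k A) (top_out k) (top_in k)"
proof -
  have "singular_value (k + 1) A / singular_value k A = s (f k) / s (f (k - 1))"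
    using sv[of k] sv[of "k - 1"] k by simp
  moreover have "s (f k) / s (f (k - 1)) \<ge> 0" using s_pos by (simp add: less_imp_le)
  ultimately show ?thesis
    using prod_not_top_le[OF k] k by (simp only:) (rule gap_vectors_ext_power, simp_all)
qed

lemma norm_ext_power_neighbours:
  assumes k: "1 \<le> k" "k < CARD('n)"
  shows "norm (ext_power (k - 1) A) * norm (ext_power (k + 1) A) =
    singular_value (k + 1) A / singular_value k A * (norm (ext_power k A))\<^sup>2"
proof -
  obtain j where j: "k = Suc j" using k by (cases k) auto
  have "s (f j) > 0" by (rule s_pos)
  then show ?thesis
    using k sv[of "Suc j"] sv[of j]
    by (simp add: norm_ext_power prod_top j power2_eq_square field_simps)
qed

lemma norm_eq_max_singular_value: "norm A = s (f 0)"
proof (rule antisym)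
  have le: "s i \<le> s (f 0)" for i
  proof -
    obtain j where "j < CARD('n)" "i = f j" using not_top[of 0 i] by (auto simp: top_indices_def)
    then show ?thesis using s_mono[of 0 j] by simp
  qed
  show "norm A \<le> s (f 0)"
  proof (rule norm_blinfun_bound)
    fix x
    show "norm (A x) \<le> s (f 0) * norm x"
      using norm_diag_le[of "V' x" s "s (f 0)"] le s_pos
      by (simp add: A_eq norm_orthogonal_pair[OF U] norm_orthogonal_pair[OF V] less_imp_le)
  qed (simp add: s_pos less_imp_le)
  have "norm (A (V (axis (f 0) 1))) = s (f 0)"
    using s_pos[of "f 0"] by (simp add: A_eq norm_orthogonal_pair[OF U] norm_orthogonal_pair[OF V] diag_axis)
  then show "s (f 0) \<le> norm A"
    using norm_blinfun[of A "V (axis (f 0) 1)"] by (simp add: norm_orthogonal_pair[OF V])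
qed

lemma norm_ext_power_le_power:
  assumes k: "k \<le> CARD('n)"
  shows "norm (ext_power k A) \<le> norm A ^ k"
proof -
  have "(\<Prod>j<k. s (f j)) \<le> (\<Prod>j<k. s (f 0))"
    using s_mono[of 0] s_pos k by (intro prod_mono) (auto simp: less_imp_le)
  then show ?thesis by (simp add: norm_ext_power[OF k] prod_top[OF k] norm_eq_max_singular_value)
qed

lemma norm_ext_power_ge_power:
  assumes k: "k \<le> CARD('n)" and A: "expands_by \<kappa> A" "\<kappa> \<ge> 0"
  shows "\<kappa> ^ k \<le> norm (ext_power k A)"
proof -
  have "\<kappa> \<le> s i" for i
    using A(1)[unfolded expands_by_def, rule_format, of "V (axis i 1)"] s_pos[of i]
    by (simp add: A_eq norm_orthogonal_pair[OF U] norm_orthogonal_pair[OF V] diag_axis)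
  then have "(\<Prod>j<k. \<kappa>) \<le> (\<Prod>j<k. s (f j))" using A(2) by (intro prod_mono) auto
  then show ?thesis by (simp add: norm_ext_power[OF k] prod_top[OF k])
qed

lemma norm_ext_power_1: "norm (ext_power 1 A) = norm A"
  by (subst norm_ext_power) (auto simp: prod_top norm_eq_max_singular_value Suc_le_eq)

lemma norm_ext_power_0: "norm (ext_power 0 A) = 1"
  by (subst norm_ext_power) (auto simp: top_indices_def)

text \<open>
  If \<open>W\<close> sends a vector of the most expanded \<open>k\<close>-plane of the image of \<open>A\<close> into the most
  contracted subspace of its domain, then \<open>A W A\<close> realises one large and one small \<open>k\<close>-volume
  growth instead of two large ones.
\<close>

lemma norm_ext_power_sandwich:
  fixes W :: "(real^'n) \<Rightarrow>\<^sub>L (real^'n)"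
  assumes k: "1 \<le> k" "k < CARD('n)"
    and x: "x \<in> blinfun_apply U ` {x. \<forall>i. i \<notin> top_indices k \<longrightarrow> x $ i = 0}" "x \<noteq> 0"
    and Wx: "W x \<in> blinfun_apply V ` {x. \<forall>i. i \<notin> - top_indices k \<longrightarrow> x $ i = 0}"
  shows "norm (ext_power k (A o\<^sub>L W o\<^sub>L A)) \<le>
    2 * norm (ext_power k W) * (norm (ext_power (k - 1) A) * norm (ext_power (k + 1) A))"
proof -
  define M where "M = ext_power k A"
  define N where "N = ext_power k W"
  define u where "u = top_out k"
  define v where "v = top_in k"
  define \<epsilon> where "\<epsilon> = singular_value (k + 1) A / singular_value k A"
  have gap: "gap_vectors \<epsilon> M u v"
    unfolding M_def u_def v_def \<epsilon>_def by (rule gap_vectors_singular_values[OF k])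
  then have \<epsilon>: "\<epsilon> \<ge> 0" and nu: "norm u = 1" and nv: "norm v = 1" by (auto simp: gap_vectors_def)
  obtain x' where x': "x = U x'" "\<And>i. i \<notin> top_indices k \<Longrightarrow> x' $ i = 0" using x(1) by auto
  have x'0: "x' \<noteq> 0" using x(2) x'(1) by (auto simp: blinfun.zero_right)
  obtain z where z: "W x = V z" "\<And>i. i \<in> top_indices k \<Longrightarrow> z $ i = 0"
    using Wx by auto
  have "(V' o\<^sub>L W o\<^sub>L U) x' = z"
    using z(1) by (simp add: x'(1)[symmetric] norm_orthogonal_pair(4)[OF V])
  then have "axis (top_indices k) 1 \<bullet> (ext_power k (V' o\<^sub>L W o\<^sub>L U)) (axis (top_indices k) 1) = 0"
    using z(2) x'(2) x'0 k by (intro ext_power_principal_minor_zero[where x = x'] card_top) auto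
  then have vNu: "v \<bullet> N u = 0"
    using adjoint_pair_ext_power[OF adjV(1), of k]
    by (simp add: ext_power_compose adjoint_pair_def v_def u_def top_in_def top_out_def N_def)
  have "norm ((M o\<^sub>L N o\<^sub>L M) y) \<le> (2 * norm N * (\<epsilon> * (norm M)\<^sup>2)) * norm y" for y
  proof -
    obtain e where e: "M y = (norm M * (v \<bullet> y)) *\<^sub>R u + e" "norm e \<le> \<epsilon> * norm M * norm y"
      using gap_vectors_remainder[OF gap] .
    define w where "w = N (M y)"
    have Ne: "norm (N e) \<le> norm N * (\<epsilon> * norm M * norm y)"
      using norm_blinfun[of N e] e(2) by (meson mult_left_mono norm_ge_zero order.trans)
    have "v \<bullet> w = v \<bullet> N e"
      by (simp add: w_def e(1) blinfun.add_right blinfun.scaleR_right inner_add_right vNu)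
    then have vw: "\<bar>v \<bullet> w\<bar> \<le> norm N * (\<epsilon> * norm M * norm y)"
      using Cauchy_Schwarz_ineq2[of v "N e"] nv Ne by simp
    have "norm (M y) \<le> norm M * norm y" by (rule norm_blinfun)
    then have nw: "norm w \<le> norm N * (norm M * norm y)"
      unfolding w_def using norm_blinfun[of N "M y"] by (meson mult_left_mono norm_ge_zero order.trans)
    have "norm (M w) \<le> norm M * (\<bar>v \<bullet> w\<bar> + \<epsilon> * norm w)" by (rule gap_vectors_norm_le[OF gap])
    also have "\<dots> \<le> norm M * (norm N * (\<epsilon> * norm M * norm y) + \<epsilon> * (norm N * (norm M * norm y)))"
      using vw nw \<epsilon> by (intro mult_left_mono add_mono) auto
    finally show ?thesis by (simp add: w_def power2_eq_square algebra_simps)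
  qed
  then have "norm (M o\<^sub>L N o\<^sub>L M) \<le> 2 * norm N * (\<epsilon> * (norm M)\<^sup>2)"
    using \<epsilon> by (intro norm_blinfun_bound) auto
  then show ?thesis
    unfolding norm_ext_power_neighbours[OF k] by (simp add: ext_power_compose M_def N_def \<epsilon>_def)
qed

end

lemma
  fixes A :: "(real^'n) \<Rightarrow>\<^sub>L (real^'n)"
  assumes A: "A \<in> GL"
  shows GL_norm_ext_power_le: "k \<le> CARD('n) \<Longrightarrow> norm (ext_power k A) \<le> norm A ^ k"
    and GL_norm_ext_power_ge: "k \<le> CARD('n) \<Longrightarrow> expands_by \<kappa> A \<Longrightarrow> \<kappa> \<ge> 0 \<Longrightarrow> \<kappa> ^ k \<le> norm (ext_power k A)"
    and GL_norm_ext_power_1: "norm (ext_power 1 A) = norm A"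
    and GL_norm_ext_power_0: "norm (ext_power 0 A) = 1"
proof -
  obtain U U' V V' s f where "svd A U U' V V' s f" using exists_svd[OF A] by blast
  note svd = this
  show "k \<le> CARD('n) \<Longrightarrow> norm (ext_power k A) \<le> norm A ^ k" by (rule norm_ext_power_le_power[OF svd])
  show "k \<le> CARD('n) \<Longrightarrow> expands_by \<kappa> A \<Longrightarrow> \<kappa> \<ge> 0 \<Longrightarrow> \<kappa> ^ k \<le> norm (ext_power k A)"
    by (rule norm_ext_power_ge_power[OF svd])
  show "norm (ext_power 1 A) = norm A" by (rule norm_ext_power_1[OF svd])
  show "norm (ext_power 0 A) = 1" by (rule norm_ext_power_0[OF svd])
qed

lemma products_GL:
  fixes S :: "((real^'n) \<Rightarrow>\<^sub>L (real^'n)) set"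
  assumes "S \<in> KGL" "P \<in> products S n"
  shows "P \<in> GL"
proof -
  obtain K \<kappa> where "0 < \<kappa>" "\<And>A. A \<in> S \<Longrightarrow> expands_by \<kappa> A" using KGL_bounds[OF assms(1)] by metis
  then show ?thesis using expands_by_products[of S \<kappa> P n] assms(2) expands_by_GL[of "\<kappa> ^ n" P] by auto
qed

lemma exp_bounded_KGL:
  fixes S :: "((real^'n) \<Rightarrow>\<^sub>L (real^'n)) set"
  assumes S: "S \<in> KGL"
  shows "exp_bounded S"
proof -
  obtain K \<kappa> where K: "\<And>A. A \<in> S \<Longrightarrow> norm A \<le> K" and \<kappa>: "0 < \<kappa>" "\<And>A. A \<in> S \<Longrightarrow> expands_by \<kappa> A"
    using KGL_bounds[OF S] by metis
  have "\<kappa> ^ n \<le> norm P" if "P \<in> products S n" for n P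
  proof -
    have "\<kappa> ^ n * norm (axis undefined 1 :: real^'n) \<le> norm (P (axis undefined 1))"
      using expands_by_products[OF \<kappa>(2) less_imp_le[OF \<kappa>(1)] that] unfolding expands_by_def by blast
    also have "\<dots> \<le> norm P * norm (axis undefined 1 :: real^'n)" by (rule norm_blinfun)
    finally show ?thesis by (simp add: norm_axis_1)
  qed
  then show ?thesis using S K \<kappa>(1) unfolding exp_bounded_def KGL_def by blast
qed

lemma exp_bounded_ext_power:
  fixes S :: "((real^'n) \<Rightarrow>\<^sub>L (real^'n)) set"
  assumes S: "S \<in> KGL" and k: "k \<le> CARD('n)"
  shows "exp_bounded (ext_power k ` S)"
proof -
  obtain K \<kappa> where K: "\<And>A. A \<in> S \<Longrightarrow> norm A \<le> K" and \<kappa>: "0 < \<kappa>" "\<And>A. A \<in> S \<Longrightarrow> expands_by \<kappa> A"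
    using KGL_bounds[OF S] by metis
  have GL: "A \<in> GL" if "A \<in> S" for A using S that by (auto simp: KGL_def)
  have "norm (ext_power k A) \<le> K ^ k" if "A \<in> S" for A
    using GL_norm_ext_power_le[OF GL[OF that] k] power_mono[OF K[OF that], of k] by simp
  moreover have "(\<kappa> ^ k) ^ n \<le> norm P" if n: "n \<ge> 1" and P: "P \<in> products (ext_power k ` S) n" for n P
  proof -
    obtain Q where Q: "Q \<in> products S n" "P = ext_power k Q" using P by (auto simp: products_ext_power[OF n])
    have "(\<kappa> ^ n) ^ k \<le> norm P"
      unfolding Q(2) using expands_by_products[OF \<kappa>(2) _ Q(1)] \<kappa>(1)
      by (intro GL_norm_ext_power_ge products_GL[OF S Q(1)] k) auto
    then show ?thesis by (simp add: power_mult[symmetric] mult.commute)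
  qed
  moreover have "ext_power k ` S \<noteq> {}" using S by (simp add: KGL_def)
  moreover have "\<kappa> ^ k > 0" using \<kappa>(1) by simp
  ultimately show ?thesis unfolding exp_bounded_def by blast
qed

text \<open>
  The gap of \<open>\<and>\<^sup>k P\<close> is \<open>\<sigma>\<^bsub>k+1\<^esub>(P)/\<sigma>\<^sub>k(P)\<close>, so domination is exactly what the locale asks for. For \<open>k = d\<close> the space
  \<open>\<and>\<^sup>d \<real>\<^sup>d\<close> is a line and the second singular value is zero.
\<close>

lemma gapped_products_ext_power:
  fixes S :: "((real^'n) \<Rightarrow>\<^sub>L (real^'n)) set"
  assumes S: "S \<in> KGL" and k: "1 \<le> k" "k \<le> CARD('n)" and dom: "dominated k S"
  shows "\<exists>K C \<tau>. gapped_products (ext_power k ` S) K C \<tau>"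
proof -
  obtain K \<kappa> where K: "K \<ge> 1" "\<And>A. A \<in> S \<Longrightarrow> norm A \<le> K" and \<kappa>: "0 < \<kappa>" "\<kappa> \<le> 1" "\<And>A. A \<in> S \<Longrightarrow> expands_by \<kappa> A"
    using KGL_bounds[OF S] by metis
  have GL: "A \<in> GL" if "A \<in> S" for A using S that by (auto simp: KGL_def)
  define K' where "K' = max (K ^ k) ((1 / \<kappa>) ^ k)"
  have K'1: "K' \<ge> 1" using K(1) by (simp add: K'_def le_max_iff_disj)
  have inv: "\<exists>B. B o\<^sub>L A = id_blinfun \<and> A o\<^sub>L B = id_blinfun \<and> norm (ext_power k B) \<le> K'" if A: "A \<in> S" for A
  proof -
    obtain B where B: "B o\<^sub>L A = id_blinfun" "A o\<^sub>L B = id_blinfun" using ex_blinfun_inverse[OF GL[OF A]] .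
    have AB: "A (B x) = x" for x
      using B(2) by (metis blinfun_apply_blinfun_compose id_blinfun.rep_eq)
    have "norm B \<le> 1 / \<kappa>"
    proof (rule norm_blinfun_bound)
      fix x
      show "norm (B x) \<le> 1 / \<kappa> * norm x"
        using \<kappa>(3)[OF A, unfolded expands_by_def, rule_format, of "B x"] \<kappa>(1)
        by (simp add: AB field_simps)
    qed (use \<kappa>(1) in simp)
    moreover have "B \<in> GL"
      using AB by (intro GL_I) (metis blinfun.zero_right)
    ultimately have "norm (ext_power k B) \<le> (1 / \<kappa>) ^ k"
      using GL_norm_ext_power_le[of B k] k power_mono[of "norm B" "1 / \<kappa>" k] by simp
    then show ?thesis using B unfolding K'_def by (intro exI[of _ B]) auto
  qed
  obtain C \<tau> where C: "C \<ge> 1" and \<tau>: "0 < \<tau>" "\<tau> < 1" and gap: "\<And>n P. n \<ge> 1 \<Longrightarrow> P \<in> products S n \<Longrightarrow>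
      \<exists>u v. gap_vectors (C * \<tau> ^ n) (ext_power k P) u v"
  proof (cases "k = CARD('n)")
    case True
    show thesis
    proof (rule that[of 1 "1/2"])
      fix n P assume P: "P \<in> products S n"
      obtain U U' V V' s f where svd: "svd P U U' V V' s f" using exists_svd[OF products_GL[OF S P]] by blast
      have "gap_vectors (1 * (1 / 2) ^ n) (ext_power k P) (top_out U f k) (top_in V f k)"
        by (rule gap_vectors_ext_power[OF svd k(2)]) (use only_top[OF svd disjI2[OF True]] in auto)
      then show "\<exists>u v. gap_vectors (1 * (1 / 2) ^ n) (ext_power k P) u v" by blast
    qed auto
  next
    case False
    then have k': "k < CARD('n)" using k by simp
    obtain C \<tau> where C: "C > 1" "0 < \<tau>" "\<tau> < 1" and gap:
      "\<And>n P. n \<ge> 1 \<Longrightarrow> P \<in> products S n \<Longrightarrow> singular_value (k + 1) P / singular_value k P \<le> C * \<tau> ^ n"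
      using dom False unfolding dominated_def by blast
    show thesis
    proof (rule that[of C \<tau>])
      fix n P assume n: "n \<ge> (1::nat)" and P: "P \<in> products S n"
      obtain U U' V V' s f where svd: "svd P U U' V V' s f" using exists_svd[OF products_GL[OF S P]] by blast
      note g = gap_vectors_singular_values[OF svd k(1) k']
      have "singular_value (k + 1) P / singular_value k P * norm (ext_power k P) * norm x \<le>
          C * \<tau> ^ n * norm (ext_power k P) * norm x" for x :: "real^('n set)"
        using gap[OF n P] by (intro mult_right_mono) auto
      then have "gap_vectors (C * \<tau> ^ n) (ext_power k P) (top_out U f k) (top_in V f k)"
        using g gap[OF n P] unfolding gap_vectors_def by (meson order.trans)
      then show "\<exists>u v. gap_vectors (C * \<tau> ^ n) (ext_power k P) u v" by blast
    qed (use C in auto)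
  qed
  have "gapped_products (ext_power k ` S) K' C \<tau>"
  proof
    show "ext_power k ` S \<noteq> {}" using S by (simp add: KGL_def)
    show "norm A \<le> K'" if A: "A \<in> ext_power k ` S" for A
    proof -
      obtain B where B: "B \<in> S" "A = ext_power k B" using A by auto
      have "norm A \<le> K ^ k"
        using GL_norm_ext_power_le[OF GL[OF B(1)] k(2)] power_mono[OF K(2)[OF B(1)], of k] B(2) by simp
      then show ?thesis by (simp add: K'_def)
    qed
    fix n :: nat and P assume n: "n \<ge> 1" and "P \<in> products (ext_power k ` S) n"
    then obtain Q where Q: "Q \<in> products S n" "P = ext_power k Q" by (auto simp: products_ext_power[OF n])
    show "\<exists>u v. gap_vectors (C * \<tau> ^ n) P u v" unfolding Q(2) by (rule gap[OF n Q(1)])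
    have "(\<kappa> ^ n) ^ k \<le> norm P"
      unfolding Q(2) using expands_by_products[OF \<kappa>(3) _ Q(1)] \<kappa>(1)
      by (intro GL_norm_ext_power_ge products_GL[OF S Q(1)] k) auto
    moreover have "(\<kappa> ^ n) ^ k > 0" using \<kappa>(1) by simp
    ultimately show "P \<noteq> 0" by auto
    fix A assume "A \<in> ext_power k ` S"
    then obtain B where B: "B \<in> S" "A = ext_power k B" by auto
    obtain B' where B': "B' o\<^sub>L B = id_blinfun" "B o\<^sub>L B' = id_blinfun" "norm (ext_power k B') \<le> K'"
      using inv[OF B(1)] by blast
    have "P = ext_power k B' o\<^sub>L (A o\<^sub>L P)" "P = (P o\<^sub>L A) o\<^sub>L ext_power k B'"
      unfolding Q(2) B(2) ext_power_compose[symmetric]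
      by (simp_all add: blinfun_compose_assoc B'(2)) (simp add: blinfun_compose_assoc[symmetric] B'(1))
    then have le: "norm P \<le> norm (ext_power k B') * norm (A o\<^sub>L P)" "norm P \<le> norm (ext_power k B') * norm (P o\<^sub>L A)"
      by (metis norm_blinfun_compose, metis norm_blinfun_compose mult.commute)
    show "norm P \<le> K' * norm (A o\<^sub>L P)" "norm P \<le> K' * norm (P o\<^sub>L A)"
      by (rule order.trans[OF le(1) mult_right_mono[OF B'(3) norm_ge_zero]],
          rule order.trans[OF le(2) mult_right_mono[OF B'(3) norm_ge_zero]])
  qed (use K'1 C \<tau> in auto)
  then show ?thesis by blast
qed

section \<open>Connecting orbits by small perturbations\<close>

definition thicken :: "real \<Rightarrow> 'a::real_normed_vector set \<Rightarrow> 'a set" where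
  "thicken \<delta> S = {B. \<exists>A\<in>S. norm (B - A) \<le> \<delta>}"

lemma products_sequence:
  assumes "P \<in> products S m"
  obtains A Q where "\<And>i. i < m \<Longrightarrow> A i \<in> S" "Q 0 = id_blinfun" "\<And>i. i < m \<Longrightarrow> Q (Suc i) = A i o\<^sub>L Q i" "Q m = P"
proof -
  have "\<exists>A Q. (\<forall>i<m. A i \<in> S \<and> Q (Suc i) = A i o\<^sub>L Q i) \<and> Q 0 = id_blinfun \<and> Q m = P"
    using assms
  proof (induction m arbitrary: P)
    case 0
    then show ?case by (intro exI[of _ undefined] exI[of _ "\<lambda>_. id_blinfun"]) simp
  next
    case (Suc m)
    then obtain B R where P: "B \<in> S" "R \<in> products S m" "P = B o\<^sub>L R" by (auto elim: products_SucE)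
    obtain A Q where AQ: "\<forall>i<m. A i \<in> S \<and> Q (Suc i) = A i o\<^sub>L Q i" "Q 0 = id_blinfun" "Q m = R"
      using Suc.IH[OF P(2)] by blast
    show ?case
      using AQ P by (intro exI[of _ "A(m := B)"] exI[of _ "Q(Suc m := P)"]) (auto simp: less_Suc_eq)
  qed
  then show thesis using that by blast
qed

lemma rank_one_correction:
  fixes A :: "'a::euclidean_space \<Rightarrow>\<^sub>L 'a"
  assumes x: "x \<noteq> 0" and le: "norm (z - A x) \<le> \<delta> * norm x"
  shows "\<exists>B. blinfun_apply B x = z \<and> norm (B - A) \<le> \<delta>"
proof -
  define d where "d = z - A x"
  define D where "D = Blinfun (\<lambda>y. ((1 / (x \<bullet> x)) * (x \<bullet> y)) *\<^sub>R d)"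
  have "bounded_linear (\<lambda>y. ((1 / (x \<bullet> x)) * (x \<bullet> y)) *\<^sub>R d)"
    by (intro bounded_linear_scaleR_const bounded_linear_const_mult bounded_linear_inner_right)
  then have D: "D y = ((1 / (x \<bullet> x)) * (x \<bullet> y)) *\<^sub>R d" for y
    by (simp add: D_def bounded_linear_Blinfun_apply)
  have "norm D \<le> \<delta>"
  proof (rule norm_blinfun_bound)
    have "0 \<le> \<delta> * norm x" using le norm_ge_zero order.trans by blast
    then show "\<delta> \<ge> 0" using x by (simp add: zero_le_mult_iff)
    fix y
    have "norm (D y) = \<bar>x \<bullet> y\<bar> * norm d / (norm x)\<^sup>2"
      by (simp add: D abs_mult power2_norm_eq_inner)
    also have "\<dots> \<le> (norm x * norm y) * (\<delta> * norm x) / (norm x)\<^sup>2"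
      using Cauchy_Schwarz_ineq2[of x y] le by (intro divide_right_mono mult_mono) (auto simp: d_def)
    also have "\<dots> = \<delta> * norm y" using x by (simp add: power2_eq_square)
    finally show "norm (D y) \<le> \<delta> * norm y" .
  qed
  moreover have "blinfun_apply (A + D) x = z" using x by (simp add: blinfun.add_left D d_def)
  ultimately show ?thesis by (intro exI[of _ "A + D"]) simp
qed

text \<open>
  Letters can be perturbed one by one, each by an operator of rank one, to follow a prescribed sequence of
  vectors whose relative jumps are at most \<open>\<delta>\<close>.
\<close>

lemma pseudo_orbit_realised:
  fixes S :: "('a::euclidean_space \<Rightarrow>\<^sub>L 'a) set"
  assumes "\<And>i. i < m \<Longrightarrow> A i \<in> S" "\<And>i. i < m \<Longrightarrow> z i \<noteq> 0"
    and "\<And>i. i < m \<Longrightarrow> norm (z (Suc i) - (A i) (z i)) \<le> \<delta> * norm (z i)"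
  shows "\<exists>W\<in>products (thicken \<delta> S) m. W (z 0) = z m"
  using assms
proof (induction m)
  case 0
  then show ?case by simp
next
  case (Suc m)
  obtain W where W: "W \<in> products (thicken \<delta> S) m" "W (z 0) = z m"
    using Suc.IH Suc.prems by auto
  obtain B where B: "blinfun_apply B (z m) = z (Suc m)" "norm (B - A m) \<le> \<delta>"
    using rank_one_correction[of "z m" "z (Suc m)" "A m" \<delta>] Suc.prems by auto
  have "B \<in> thicken \<delta> S" using B(2) Suc.prems(1) by (auto simp: thicken_def)
  then show ?case
    using W B(1) by (intro bexI[of _ "B o\<^sub>L W"] products_SucI) auto
qed

text \<open>
  The expansion of \<open>x\<close> by \<open>P\<close> exceeds that of \<open>y\<close> at most by a factor of small exponential growth. If the orbits of the two
  directions ever come close, one jump suffices. Otherwise a component along the orbit of \<open>y\<close> is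
  introduced and multiplied by \<open>1 + \<rho>\<close> at each step until it dominates.
\<close>

lemma perturb_to_connect:
  fixes S :: "('a::euclidean_space \<Rightarrow>\<^sub>L 'a) set"
  assumes K: "K \<ge> 1" "\<And>A. A \<in> S \<Longrightarrow> norm A \<le> K" and inj: "\<And>A x. A \<in> S \<Longrightarrow> A x = 0 \<Longrightarrow> x = 0"
    and \<delta>: "0 < \<delta>" "\<delta> \<le> 1" and \<rho>: "\<rho> = \<delta>\<^sup>2 / (2 * K\<^sup>2)"
    and P: "P \<in> products S m" and m: "m \<ge> 2" and xy: "norm x = 1" "norm y = 1"
    and le: "norm (P x) \<le> \<rho>\<^sup>2 * (1 + \<rho>) ^ (m - 1) * norm (P y)"
  shows "\<exists>W\<in>products (thicken \<delta> S) m. \<exists>c. c \<noteq> 0 \<and> W x = c *\<^sub>R P y"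
proof -
  obtain A Q where A: "\<And>i. i < m \<Longrightarrow> A i \<in> S" and Q0: "Q 0 = id_blinfun"
    and QS: "\<And>i. i < m \<Longrightarrow> Q (Suc i) = A i o\<^sub>L Q i" and Qm: "Q m = P"
    using products_sequence[OF P] by blast
  define \<xi> where "\<xi> i = (Q i) x" for i
  define \<eta> where "\<eta> i = (Q i) y" for i
  have \<xi>S: "(A i) (\<xi> i) = \<xi> (Suc i)" and \<eta>S: "(A i) (\<eta> i) = \<eta> (Suc i)" if "i < m" for i
    using QS[OF that] by (simp_all add: \<xi>_def \<eta>_def)
  have nz: "\<xi> i \<noteq> 0 \<and> \<eta> i \<noteq> 0" if "i \<le> m" for i
    using that
  proof (induction i)
    case 0
    then show ?case using xy by (auto simp: \<xi>_def \<eta>_def Q0)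
  next
    case (Suc i)
    then have i: "i < m" and "\<xi> i \<noteq> 0" "\<eta> i \<noteq> 0" by auto
    then show ?case using inj[OF A[OF i]] unfolding \<xi>S[OF i, symmetric] \<eta>S[OF i, symmetric] by blast
  qed
  have A_le: "norm ((A i) v) \<le> K * norm v" if "i < m" for i v
    using norm_blinfun[of "A i" v] K(2)[OF A[OF that]] by (meson mult_right_mono norm_ge_zero order.trans)
  \<comment> \<open>orbits within relative distance \<open>d\<close> count as close; then \<open>K \<rho> = \<delta> d\<close>\<close>
  define d where "d = \<delta> / (2 * K)"
  have d: "d > 0" "d \<le> 1 / 2" "2 * K * d = \<delta>" using \<delta> K(1) by (simp_all add: d_def field_simps)
  have \<rho>0: "\<rho> > 0" using \<delta> K(1) by (simp add: \<rho>)
  have K\<rho>: "K * \<rho> = \<delta> * d" using K(1) by (simp add: \<rho> d_def power2_eq_square field_simps)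
  have \<rho>1: "\<rho> \<le> 1"
  proof -
    have "1 * \<rho> \<le> K * \<rho>" using K(1) \<rho>0 by (intro mult_right_mono) auto
    also have "\<dots> \<le> 1 * 1" unfolding K\<rho> using d \<delta> by (intro mult_mono) auto
    finally show ?thesis by simp
  qed
  obtain z c where z: "z 0 = x" "z m = c *\<^sub>R \<eta> m" "c \<noteq> 0" "\<And>i. i < m \<Longrightarrow> z i \<noteq> 0"
    "\<And>i. i < m \<Longrightarrow> norm (z (Suc i) - (A i) (z i)) \<le> \<delta> * norm (z i)"
  proof (cases "\<exists>i<m. \<exists>t. t \<noteq> 0 \<and> norm (\<xi> i + t *\<^sub>R \<eta> i) \<le> d * (\<bar>t\<bar> * norm (\<eta> i))")
    case True
    then obtain i t where i: "i < m" and t: "t \<noteq> 0" "norm (\<xi> i + t *\<^sub>R \<eta> i) \<le> d * (\<bar>t\<bar> * norm (\<eta> i))" by blast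
    define z where "z j = (if j \<le> i then \<xi> j else - t *\<^sub>R \<eta> j)" for j
    have close: "\<bar>t\<bar> * norm (\<eta> i) \<le> 2 * norm (\<xi> i)"
    proof -
      have "norm (t *\<^sub>R \<eta> i) \<le> norm (\<xi> i + t *\<^sub>R \<eta> i) + norm (\<xi> i)"
        using norm_triangle_ineq4[of "\<xi> i + t *\<^sub>R \<eta> i" "\<xi> i"] by simp
      moreover have "d * (\<bar>t\<bar> * norm (\<eta> i)) \<le> 1 / 2 * (\<bar>t\<bar> * norm (\<eta> i))"
        using d by (intro mult_right_mono) auto
      ultimately show ?thesis using t(2) by simp
    qed
    show thesis
    proof (rule that[of z "- t"])
      show "z 0 = x" by (simp add: z_def \<xi>_def Q0)
      show "z m = - t *\<^sub>R \<eta> m" using i by (simp add: z_def)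
      show "- t \<noteq> 0" using t by simp
      fix j assume j: "j < m"
      show "z j \<noteq> 0" using nz[of j] j t by (simp add: z_def)
      show "norm (z (Suc j) - (A j) (z j)) \<le> \<delta> * norm (z j)"
      proof (cases "j = i")
        case True
        have "z (Suc j) - (A j) (z j) = - (A i) (\<xi> i + t *\<^sub>R \<eta> i)"
          using True i \<xi>S[of i] \<eta>S[of i] by (simp add: z_def blinfun.add_right blinfun.scaleR_right)
        then have "norm (z (Suc j) - (A j) (z j)) \<le> K * norm (\<xi> i + t *\<^sub>R \<eta> i)"
          using A_le[OF i] by simp
        also have "\<dots> \<le> K * (d * (2 * norm (\<xi> i)))"
          using t(2) close K(1) d by (intro mult_left_mono order.trans[OF t(2)]) auto
        also have "\<dots> = \<delta> * norm (z j)" using d(3) True by (simp add: z_def)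
        finally show ?thesis .
      next
        case False
        then have "z (Suc j) = (A j) (z j)"
          using j \<xi>S[of j] \<eta>S[of j] by (auto simp: z_def blinfun.minus_right blinfun.scaleR_right)
        then show ?thesis using \<delta> by simp
      qed
    qed
  next
    case False
    then have far: "d * (\<bar>t\<bar> * norm (\<eta> i)) < norm (\<xi> i + t *\<^sub>R \<eta> i)" if "i < m" "t \<noteq> 0" for i t
      using that by (meson not_le)
    define t where "t i = \<rho> * (1 + \<rho>) ^ i" for i
    have t0: "t i > 0" for i using \<rho>0 by (simp add: t_def)
    define z where "z i = (if i = 0 then x else if i < m then \<xi> i + t i *\<^sub>R \<eta> i else t (m - 1) *\<^sub>R \<eta> m)" for i
    have far': "d * (t i * norm (\<eta> i)) \<le> norm (\<xi> i + t i *\<^sub>R \<eta> i)" if "i < m" for i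
      using far[OF that, of "t i"] t0[of i] by simp
    show thesis
    proof (rule that[of z "t (m - 1)"])
      show "z 0 = x" by (simp add: z_def)
      show "z m = t (m - 1) *\<^sub>R \<eta> m" using m by (simp add: z_def)
      show "t (m - 1) \<noteq> 0" using t0[of "m - 1"] by simp
      fix i assume i: "i < m"
      have "0 < d * (t i * norm (\<eta> i))" using d t0[of i] nz[of i] i by simp
      then have "\<xi> i + t i *\<^sub>R \<eta> i \<noteq> 0" using far'[OF i] by auto
      then show "z i \<noteq> 0" using xy i by (auto simp: z_def)
      consider "i = 0" | "0 < i" "Suc i < m" | "0 < i" "Suc i = m" using i by linarith
      then show "norm (z (Suc i) - (A i) (z i)) \<le> \<delta> * norm (z i)"
      proof cases
        case 1
        have "z (Suc i) - (A i) (z i) = t 1 *\<^sub>R (A 0) (\<eta> 0)"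
          using 1 m \<xi>S[of 0] \<eta>S[of 0] by (simp add: z_def \<xi>_def Q0)
        then have "norm (z (Suc i) - (A i) (z i)) \<le> t 1 * (K * norm (\<eta> 0))"
          using A_le[of 0 "\<eta> 0"] m t0[of 1] by simp
        also have "\<dots> = (\<delta> * d) * (1 + \<rho>)"
          using xy K\<rho> by (simp add: \<eta>_def Q0 t_def) (metis mult.assoc mult.commute)
        also have "\<dots> \<le> (\<delta> * (1 / 2)) * 2" using \<delta> d \<rho>1 \<rho>0 by (intro mult_mono) auto
        finally show ?thesis using 1 xy by (simp add: z_def)
      next
        case 2
        have "z (Suc i) - (A i) (z i) = (t (Suc i) - t i) *\<^sub>R (A i) (\<eta> i)"
          using 2 i \<xi>S[of i] \<eta>S[of i] by (simp add: z_def blinfun.add_right blinfun.scaleR_right algebra_simps)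
        also have "t (Suc i) - t i = \<rho> * t i" by (simp add: t_def algebra_simps)
        finally have "norm (z (Suc i) - (A i) (z i)) \<le> \<rho> * t i * (K * norm (\<eta> i))"
          using A_le[OF i, of "\<eta> i"] t0[of i] \<rho>0 by simp
        also have "\<dots> = (K * \<rho>) * (t i * norm (\<eta> i))" by simp
        also have "\<dots> = \<delta> * (d * (t i * norm (\<eta> i)))" by (simp add: K\<rho>)
        also have "\<dots> \<le> \<delta> * norm (\<xi> i + t i *\<^sub>R \<eta> i)" using far'[OF i] \<delta> by (intro mult_left_mono) auto
        finally show ?thesis using 2 by (simp add: z_def)
      next
        case 3
        have "z (Suc i) - (A i) (z i) = - \<xi> m"
          using 3 i \<xi>S[of i] \<eta>S[of i] by (auto simp: z_def blinfun.add_right blinfun.scaleR_right)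
        then have "norm (z (Suc i) - (A i) (z i)) = norm (\<xi> m)" by (simp only: norm_minus_cancel)
        moreover have "m - 1 = i" using 3 by simp
        ultimately have "norm (z (Suc i) - (A i) (z i)) \<le> \<rho>\<^sup>2 * (1 + \<rho>) ^ i * norm (\<eta> m)"
          using le unfolding \<xi>_def \<eta>_def Qm by metis
        also have "\<dots> \<le> \<rho>\<^sup>2 * (1 + \<rho>) ^ i * (K * norm (\<eta> i))"
          using A_le[OF i, of "\<eta> i"] \<eta>S[OF i] 3 \<rho>0 by (intro mult_left_mono) auto
        also have "\<dots> = (K * \<rho>) * (t i * norm (\<eta> i))" by (simp add: t_def power2_eq_square)
        also have "\<dots> = \<delta> * (d * (t i * norm (\<eta> i)))" by (simp add: K\<rho>)
        also have "\<dots> \<le> \<delta> * norm (\<xi> i + t i *\<^sub>R \<eta> i)" using far'[OF i] \<delta> by (intro mult_left_mono) auto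
        finally show ?thesis using 3 i by (simp add: z_def)
      qed
    qed
  qed
  obtain W where "W \<in> products (thicken \<delta> S) m" "W (z 0) = z m"
    using pseudo_orbit_realised[where A = A and z = z, OF A z(4,5)] by blast
  then show ?thesis using z(1-3) by (auto simp: \<eta>_def Qm)
qed

lemma ex_nonzero_Int:
  fixes E F :: "'a::euclidean_space set"
  assumes "subspace E" "subspace F" "dim E + dim F > DIM('a)"
  shows "\<exists>x\<in>E \<inter> F. norm x = 1"
proof -
  have "dim {x + y |x y. x \<in> E \<and> y \<in> F} + dim (E \<inter> F) = dim E + dim F"
    by (rule dim_sums_Int[OF assms(1,2)])
  moreover have "dim {x + y |x y. x \<in> E \<and> y \<in> F} \<le> DIM('a)" by (rule dim_subset_UNIV)
  ultimately have "dim (E \<inter> F) \<noteq> 0" using assms(3) by linarith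
  then obtain x where x: "x \<in> E \<inter> F" "x \<noteq> 0" by (auto simp: dim_eq_0)
  then have "(1 / norm x) *\<^sub>R x \<in> E \<inter> F" using assms(1,2) by (auto intro: subspace_scale)
  then show ?thesis using x(2) by (intro bexI[of _ "(1 / norm x) *\<^sub>R x"]) auto
qed

text \<open>
  Without domination there is a product \<open>P\<close> for which \<open>\<sigma>\<^sub>k(P)/\<sigma>\<^bsub>k+1\<^esub>(P)\<close> is below a prescribed slow exponential.
  By counting dimensions, \<open>E\<close> contains a unit vector \<open>x\<close> that \<open>P\<close> expands at most by \<open>\<sigma>\<^sub>k\<close>, and \<open>F\<close> the image of
  a unit vector \<open>w\<close> that \<open>P\<close> expands at least by \<open>\<sigma>\<^bsub>k+1\<^esub>\<close>. These two can be connected. The length of \<open>P\<close> depends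
  on \<open>\<delta>\<close> only, not on \<open>E\<close> and \<open>F\<close>.
\<close>

lemma not_dominated_connect:
  fixes S :: "((real^'n) \<Rightarrow>\<^sub>L (real^'n)) set"
  assumes S: "S \<in> KGL" and k: "1 \<le> k" "k < CARD('n)" and nd: "\<not> dominated k S"
    and \<delta>: "0 < \<delta>" "\<delta> \<le> 1"
  obtains m where "\<And>E F. subspace E \<Longrightarrow> subspace F \<Longrightarrow> dim E = k \<Longrightarrow> dim F = CARD('n) - k \<Longrightarrow>
    \<exists>W\<in>products (thicken \<delta> S) m. \<exists>x\<in>E. x \<noteq> 0 \<and> W x \<in> F"
proof -
  obtain K \<kappa> where K: "K \<ge> 1" "\<And>A. A \<in> S \<Longrightarrow> norm A \<le> K" and \<kappa>: "0 < \<kappa>" "\<And>A. A \<in> S \<Longrightarrow> expands_by \<kappa> A"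
    using KGL_bounds[OF S] by metis
  have inj: "x = 0" if "A \<in> S" "A x = 0" for A x
  proof -
    have "inj (blinfun_apply A)" using that(1) S by (auto simp: KGL_def GL_def bij_def)
    then show ?thesis using that(2) by (metis blinfun.zero_right injD)
  qed
  define \<rho> where "\<rho> = \<delta>\<^sup>2 / (2 * K\<^sup>2)"
  have \<rho>0: "\<rho> > 0" using \<delta> K(1) by (simp add: \<rho>_def)
  have \<rho>1: "\<rho> \<le> 1"
  proof -
    have "\<delta>\<^sup>2 \<le> 1" "K\<^sup>2 \<ge> 1" using \<delta> K(1) by (simp_all add: power_le_one one_le_power)
    then have "\<delta>\<^sup>2 \<le> 2 * K\<^sup>2" by linarith
    then show ?thesis using K(1) by (simp add: \<rho>_def)
  qed
  \<comment> \<open>chosen so that failure of the bound \<open>C / (1 + \<rho>)\<^sup>m\<close> is the hypothesis of \<open>perturb_to_connect\<close>\<close>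
  define C where "C = (1 + \<rho>) / \<rho>\<^sup>2"
  have "\<rho>\<^sup>2 \<le> 1" using \<rho>0 \<rho>1 by (simp add: power_le_one)
  then have "C > 1" using \<rho>0 by (simp add: C_def)
  moreover have "0 < 1 / (1 + \<rho>)" "1 / (1 + \<rho>) < 1" using \<rho>0 by auto
  ultimately obtain m P where m: "m \<ge> 1" and P: "P \<in> products S m"
    and big: "C * (1 / (1 + \<rho>)) ^ m < singular_value (k + 1) P / singular_value k P"
    using nd unfolding dominated_def by (meson not_le)
  obtain U U' V V' s f where svd: "svd P U U' V V' s f" using exists_svd[OF products_GL[OF S P]] by blast
  note sv = svdD[OF svd]
  define a where "a = s (f (k - 1))"
  define b where "b = s (f k)"
  have ab: "0 < b" "b \<le> a" using sv(4) sv(6)[of "k - 1" k] k by (auto simp: a_def b_def)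
  have "singular_value (k + 1) P / singular_value k P = b / a"
    using sv(7)[of k] sv(7)[of "k - 1"] k by (simp add: a_def b_def)
  then have "C * (1 / (1 + \<rho>)) ^ m < b / a" using big by simp
  moreover have "C * (1 / (1 + \<rho>)) ^ m = 1 / (\<rho>\<^sup>2 * (1 + \<rho>) ^ (m - 1))"
  proof -
    obtain m' where "m = Suc m'" using m by (cases m) auto
    then show ?thesis using \<rho>0 by (simp add: C_def power_divide)
  qed
  ultimately have "1 / (\<rho>\<^sup>2 * (1 + \<rho>) ^ (m - 1)) < b / a" by simp
  then have ratio: "a < \<rho>\<^sup>2 * (1 + \<rho>) ^ (m - 1) * b"
    using ab \<rho>0 by (simp add: divide_simps mult_ac split: if_splits)
  have m2: "m \<ge> 2"
  proof (rule ccontr)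
    assume "\<not> m \<ge> 2"
    then have "m = 1" using m by simp
    then have "a < \<rho>\<^sup>2 * b" using ratio by simp
    moreover have "\<rho>\<^sup>2 * b \<le> 1 * b" using \<open>\<rho>\<^sup>2 \<le> 1\<close> ab by (intro mult_right_mono) auto
    ultimately show False using ab by simp
  qed
  show thesis
  proof (rule that[of m])
    fix E F :: "(real^'n) set"
    assume E: "subspace E" "dim E = k" and F: "subspace F" "dim F = CARD('n) - k"
    define J1 where "J1 = - top_indices f (k - 1)"
    define J2 where "J2 = top_indices f (k + 1)"
    have J: "card J1 = CARD('n) - (k - 1)" "card J2 = k + 1"
      using card_top[OF svd, of "k - 1"] card_top[OF svd, of "k + 1"] k
      by (simp_all add: J1_def J2_def Compl_eq_Diff_UNIV card_Diff_subset)
    have "\<exists>x\<in>E \<inter> blinfun_apply V ` {x. \<forall>i. i \<notin> J1 \<longrightarrow> x $ i = 0}. norm x = 1"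
      using E k by (intro ex_nonzero_Int subspace_orthogonal_supported[OF sv(2)])
        (simp_all add: dim_orthogonal_supported[OF sv(2)] J)
    then obtain x x' where x: "x \<in> E" "norm x = 1" "x = V x'" "\<And>i. i \<notin> J1 \<Longrightarrow> x' $ i = 0" by auto
    have "\<exists>y\<in>F \<inter> blinfun_apply U ` {x. \<forall>i. i \<notin> J2 \<longrightarrow> x $ i = 0}. norm y = 1"
      using F k by (intro ex_nonzero_Int subspace_orthogonal_supported[OF sv(1)])
        (simp_all add: dim_orthogonal_supported[OF sv(1)] J)
    then obtain y y' where y: "y \<in> F" "norm y = 1" "y = U y'" "\<And>i. i \<notin> J2 \<Longrightarrow> y' $ i = 0" by auto
    define w' where "w' = (diag (\<lambda>i. 1 / s i)) y'"
    define w where "w = (1 / norm w') *\<^sub>R V w'"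
    have Dw': "(diag s) w' = y'"
      using sv(4) by (simp add: w'_def vec_eq_iff less_imp_neq[OF sv(4), symmetric])
    have w'0: "w' \<noteq> 0" using y(2,3) Dw' by (auto simp: blinfun.zero_right)
    have Pw: "P w = (1 / norm w') *\<^sub>R y"
      by (simp add: w_def sv(3) blinfun.scaleR_right norm_orthogonal_pair[OF sv(2)] Dw' y(3))
    have nw: "norm w = 1" using w'0 by (simp add: w_def norm_orthogonal_pair[OF sv(2)])
    have Px: "norm (P x) \<le> a * 1"
    proof -
      have "norm ((diag s) x') \<le> a * norm x'"
      proof (rule norm_diag_le)
        fix i assume "x' $ i \<noteq> 0"
        then have "i \<notin> top_indices f (k - 1)" using x(4)[of i] by (auto simp: J1_def)
        moreover have "k - 1 \<le> CARD('n)" using k by simp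
        ultimately obtain j where "j \<ge> k - 1" "j < CARD('n)" "i = f j" using not_top[OF svd] by blast
        then show "\<bar>s i\<bar> \<le> a" using sv(6) sv(4)[of i] by (auto simp: a_def)
      qed (use ab in simp)
      moreover have "norm x' = 1" using x(2,3) by (simp add: norm_orthogonal_pair[OF sv(2)])
      ultimately show ?thesis
        by (simp add: sv(3) x(3) norm_orthogonal_pair[OF sv(1)] norm_orthogonal_pair[OF sv(2)])
    qed
    have Pw_ge: "b \<le> norm (P w)"
    proof -
      have "b * norm w' \<le> norm ((diag s) w')"
      proof (rule norm_diag_ge)
        fix i assume "w' $ i \<noteq> 0"
        then have "i \<in> top_indices f (k + 1)" using y(4)[of i] by (auto simp: J2_def w'_def)
        then obtain j where "j \<le> k" "i = f j" by (auto simp: top_indices_def[OF svd] less_Suc_eq_le)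
        then show "b \<le> \<bar>s i\<bar>" using sv(6)[of j k] sv(4)[of i] k by (auto simp: b_def)
      qed (use ab in simp)
      also have "\<dots> = 1" using y(2,3) by (simp add: Dw' norm_orthogonal_pair[OF sv(1)])
      finally show ?thesis using w'0 y(2) by (simp add: Pw field_simps)
    qed
    have "norm (P x) \<le> \<rho>\<^sup>2 * (1 + \<rho>) ^ (m - 1) * b" using Px ratio by simp
    also have "\<dots> \<le> \<rho>\<^sup>2 * (1 + \<rho>) ^ (m - 1) * norm (P w)"
      using Pw_ge \<rho>0 by (intro mult_left_mono) auto
    finally have Px': "norm (P x) \<le> \<rho>\<^sup>2 * (1 + \<rho>) ^ (m - 1) * norm (P w)" .
    have "\<exists>W\<in>products (thicken \<delta> S) m. \<exists>c. c \<noteq> 0 \<and> W x = c *\<^sub>R P w"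
    proof (rule perturb_to_connect[OF K(1) _ _ \<delta> \<rho>_def P m2 x(2) nw Px'])
      show "norm A \<le> K" if "A \<in> S" for A using K(2)[OF that] .
      show "x = 0" if "A \<in> S" "A x = 0" for A x using inj[OF that] .
    qed
    then obtain W c where W: "W \<in> products (thicken \<delta> S) m" "W x = c *\<^sub>R P w"
      by blast
    have "W x \<in> F" unfolding W(2) Pw using y(1) F(1) by (intro subspace_scale)
    then show "\<exists>W\<in>products (thicken \<delta> S) m. \<exists>x\<in>E. x \<noteq> 0 \<and> W x \<in> F"
      using W(1) x(1,2) by (intro bexI[of _ W] bexI[of _ x]) auto
  qed
qed

section \<open>Flattening the singular values of perturbed products\<close>

lemma thicken_eq_sums: "thicken \<delta> S = {A + E |A E. A \<in> S \<and> E \<in> cball 0 \<delta>}"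
proof (intro subset_antisym subsetI)
  fix B assume "B \<in> thicken \<delta> S"
  then obtain A where "A \<in> S" "norm (B - A) \<le> \<delta>" by (auto simp: thicken_def)
  then have "B = A + (B - A)" "B - A \<in> cball 0 \<delta>" by auto
  with \<open>A \<in> S\<close> show "B \<in> {A + E |A E. A \<in> S \<and> E \<in> cball 0 \<delta>}" by blast
next
  fix B assume "B \<in> {A + E |A E. A \<in> S \<and> E \<in> cball 0 \<delta>}"
  then obtain A E where "B = A + E" "A \<in> S" "norm E \<le> \<delta>" by auto
  then show "B \<in> thicken \<delta> S" by (auto simp: thicken_def intro!: bexI[of _ A])
qed

lemma subset_thicken: "\<delta> \<ge> 0 \<Longrightarrow> S \<subseteq> thicken \<delta> S"
  by (auto simp: thicken_def intro!: bexI)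

lemma thicken_KGL:
  fixes S :: "((real^'n) \<Rightarrow>\<^sub>L (real^'n)) set"
  assumes S: "S \<in> KGL"
  obtains \<delta>0 where "\<delta>0 > 0" "\<And>\<delta>. 0 \<le> \<delta> \<Longrightarrow> \<delta> \<le> \<delta>0 \<Longrightarrow> thicken \<delta> S \<in> KGL"
proof -
  obtain K \<kappa> where \<kappa>: "0 < \<kappa>" "\<And>A. A \<in> S \<Longrightarrow> expands_by \<kappa> A" using KGL_bounds[OF S] by metis
  show thesis
  proof (rule that[of "\<kappa> / 2"])
    fix \<delta> :: real assume \<delta>: "0 \<le> \<delta>" "\<delta> \<le> \<kappa> / 2"
    have "B \<in> GL" if B: "B \<in> thicken \<delta> S" for B
    proof -
      obtain A where A: "A \<in> S" "norm (B - A) \<le> \<delta>" using B by (auto simp: thicken_def)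
      have "expands_by (\<kappa> / 2) B"
        unfolding expands_by_def
      proof
        fix x :: "real^'n"
        have "\<kappa> * norm x \<le> norm (A x)" using \<kappa>(2)[OF A(1)] by (simp add: expands_by_def)
        also have "\<dots> \<le> norm (B x) + norm (blinfun_apply (B - A) x)"
          using norm_triangle_ineq4[of "B x" "blinfun_apply (B - A) x"] by (simp add: blinfun.diff_left)
        also have "norm (blinfun_apply (B - A) x) \<le> \<kappa> / 2 * norm x"
          using norm_blinfun[of "B - A" x] A(2) \<delta>(2) mult_right_mono[of "norm (B - A)" "\<kappa> / 2" "norm x"] by simp
        finally show "\<kappa> / 2 * norm x \<le> norm (B x)" by simp
      qed
      then show ?thesis using expands_by_GL \<kappa>(1) half_gt_zero by blast
    qed
    moreover have "compact (thicken \<delta> S)"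
      unfolding thicken_eq_sums using S by (intro compact_sums compact_cball) (simp add: KGL_def)
    moreover have "thicken \<delta> S \<noteq> {}" using subset_thicken[OF \<delta>(1), of S] S by (auto simp: KGL_def)
    ultimately show "thicken \<delta> S \<in> KGL" by (auto simp: KGL_def)
  qed (use \<kappa>(1) in simp)
qed

lemma GL_norm_ext_power_pos:
  fixes A :: "(real^'n) \<Rightarrow>\<^sub>L (real^'n)"
  assumes "A \<in> GL" "k \<le> CARD('n)"
  shows "norm (ext_power k A) > 0"
proof -
  obtain U U' V V' s f where svd: "svd A U U' V V' s f" using exists_svd[OF assms(1)] by blast
  show ?thesis unfolding norm_ext_power[OF svd assms(2)] by (rule prod_s_pos[OF svd])
qed

text \<open>
  \<open>g j\<close> bounds the exponential growth rate of the \<open>j\<close>-volume, for all \<open>j \<le> l\<close> at once, along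
  suitable arbitrarily long products.
\<close>

definition attainable :: "((real^'n) \<Rightarrow>\<^sub>L (real^'n)) set \<Rightarrow> nat \<Rightarrow> (nat \<Rightarrow> real) \<Rightarrow> bool" where
  "attainable T l g \<longleftrightarrow> (\<forall>\<eta>>0. \<forall>n0. \<exists>n\<ge>n0. \<exists>P\<in>products T n. \<forall>j\<le>l.
     ln (norm (ext_power j P)) \<le> n * (g j + \<eta>))"

text \<open>
  Insert between two copies of a long product \<open>P\<close> a short product that sends a vector of the most expanded
  \<open>k\<close>-plane of the image of \<open>P\<close> into the \<open>(d - k)\<close>-plane of its domain that \<open>P\<close> expands least. The bounds on all rates
  grow at most by a constant divided by the length, and the rate of the \<open>k\<close>-volume is now bounded by the
  average of the bounds on its two neighbours.
\<close>

lemma attainable_average: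
  fixes S :: "((real^'n) \<Rightarrow>\<^sub>L (real^'n)) set"
  assumes S: "S \<in> KGL" and T: "thicken \<delta> S \<in> KGL" and \<delta>: "0 < \<delta>" "\<delta> \<le> 1"
    and k: "1 \<le> k" "k < l" and l: "l \<le> CARD('n)" and nd: "\<not> dominated k S"
    and att: "attainable (thicken \<delta> S) l g"
  shows "attainable (thicken \<delta> S) l (g(k := (g (k - 1) + g (k + 1)) / 2))"
proof -
  define T' where "T' = thicken \<delta> S"
  define g' where "g' = g(k := (g (k - 1) + g (k + 1)) / 2)"
  have kn: "k < CARD('n)" using k l by simp
  obtain m where conn: "\<And>E F. subspace E \<Longrightarrow> subspace F \<Longrightarrow> dim E = k \<Longrightarrow> dim F = CARD('n) - k \<Longrightarrow>
    \<exists>W\<in>products T' m. \<exists>x\<in>E. x \<noteq> 0 \<and> W x \<in> F"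
    unfolding T'_def using not_dominated_connect[OF S k(1) kn nd \<delta>] by blast
  obtain K where K: "K \<ge> 1" "\<And>B. B \<in> T' \<Longrightarrow> norm B \<le> K" using KGL_bounds[OF T] unfolding T'_def by metis
  define L where "L = (K ^ m) ^ l"
  have L: "L \<ge> 1" using K(1) by (simp add: L_def one_le_power)
  have W_le: "norm (ext_power j W) \<le> L" if "W \<in> products T' m" "j \<le> l" for W j
  proof -
    have "norm (ext_power j W) \<le> norm W ^ j"
      using that l products_GL[OF T] by (intro GL_norm_ext_power_le) (auto simp: T'_def)
    also have "\<dots> \<le> (K ^ m) ^ j" using norm_products_le[OF K(2) that(1)] by (intro power_mono) auto
    also have "\<dots> \<le> L" unfolding L_def using K(1) that(2) by (intro power_increasing) (auto simp: one_le_power)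
    finally show ?thesis .
  qed
  have "\<exists>N\<ge>n0. \<exists>Q\<in>products T' N. \<forall>j\<le>l. ln (norm (ext_power j Q)) \<le> N * (g' j + \<eta>)" if \<eta>: "\<eta> > 0" for \<eta> n0
  proof -
    define G where "G = (\<Sum>j\<le>l. \<bar>g' j\<bar>)"
    define c where "c = ln 2 + ln L + m * G"
    obtain n1 :: nat where n1: "n1 > c / \<eta>" using reals_Archimedean2 by blast
    obtain n P where n: "n \<ge> max n0 n1" and P: "P \<in> products T' n"
      and Pg: "\<And>j. j \<le> l \<Longrightarrow> ln (norm (ext_power j P)) \<le> n * (g j + \<eta> / 2)"
      using att[unfolded attainable_def, rule_format, of "\<eta> / 2" "max n0 n1"] \<eta> unfolding T'_def by auto
    have PGL: "P \<in> GL" using products_GL[OF T] P by (simp add: T'_def)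
    obtain U U' V V' s f where svd: "svd P U U' V V' s f" using exists_svd[OF PGL] by blast
    note sv = svdD[OF svd]
    define I where "I = top_indices f k"
    have card: "card I = k" "card (- I) = CARD('n) - k"
      using card_top[OF svd, of k] kn by (simp_all add: I_def Compl_eq_Diff_UNIV card_Diff_subset)
    define E where "E = blinfun_apply U ` {x. \<forall>i. i \<notin> I \<longrightarrow> x $ i = 0}"
    define F where "F = blinfun_apply V ` {x. \<forall>i. i \<notin> - I \<longrightarrow> x $ i = 0}"
    have "subspace E" "subspace F" unfolding E_def F_def
      by (rule subspace_orthogonal_supported[OF sv(1)], rule subspace_orthogonal_supported[OF sv(2)])
    moreover have "dim E = k" "dim F = CARD('n) - k"
      unfolding E_def F_def dim_orthogonal_supported[OF sv(1)] dim_orthogonal_supported[OF sv(2)] by (rule card)+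
    ultimately obtain W x where W: "W \<in> products T' m" and x: "x \<in> E" "x \<noteq> 0" "W x \<in> F"
      using conn[of E F] by blast
    define Q where "Q = P o\<^sub>L W o\<^sub>L P"
    have Q: "Q \<in> products T' (n + m + n)" unfolding Q_def by (intro products_comp P W)
    have QGL: "Q \<in> GL" using products_GL[OF T] Q by (simp add: T'_def)
    have P_pos: "norm (ext_power j P) > 0" "norm (ext_power j Q) > 0" if "j \<le> l" for j
      using GL_norm_ext_power_pos[OF PGL] GL_norm_ext_power_pos[OF QGL] that l by (meson order.trans)+
    have main: "ln (norm (ext_power j Q)) \<le> ln 2 + ln L + 2 * n * (g' j + \<eta> / 2)" if j: "j \<le> l" for j
    proof (cases "j = k")
      case True
      define a where "a = norm (ext_power (k - 1) P)"
      define b where "b = norm (ext_power (k + 1) P)"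
      have ab: "a > 0" "b > 0" using P_pos(1)[of "k - 1"] P_pos(1)[of "k + 1"] k by (auto simp: a_def b_def)
      have "norm (ext_power k Q) \<le> 2 * norm (ext_power k W) * (a * b)"
        unfolding Q_def a_def b_def
        using norm_ext_power_sandwich[OF svd k(1) kn x(1)[unfolded E_def I_def] x(2) x(3)[unfolded F_def I_def]] .
      also have "\<dots> \<le> 2 * L * (a * b)"
        using W_le[OF W, of k] k ab by (intro mult_right_mono mult_left_mono) auto
      finally have "ln (norm (ext_power k Q)) \<le> ln (2 * L * (a * b))"
        using P_pos(2)[of k] k by (subst ln_le_cancel_iff) (use L ab in auto)
      also have "\<dots> = ln 2 + ln L + (ln a + ln b)" using L ab by (simp add: ln_mult)
      also have "ln a + ln b \<le> n * (g (k - 1) + \<eta> / 2) + n * (g (k + 1) + \<eta> / 2)"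
        unfolding a_def b_def using k by (intro add_mono Pg) auto
      also have "\<dots> = 2 * n * (g' k + \<eta> / 2)" by (simp add: g'_def field_simps)
      finally show ?thesis using True by simp
    next
      case False
      define a where "a = norm (ext_power j P)"
      have a: "a > 0" using P_pos(1)[OF j] by (simp add: a_def)
      have "norm (ext_power j Q) \<le> a * norm (ext_power j W) * a"
        unfolding Q_def ext_power_compose a_def
        by (meson mult_right_mono norm_blinfun_compose norm_ge_zero order.trans)
      also have "\<dots> \<le> a * L * a" using W_le[OF W j] a by (intro mult_right_mono mult_left_mono) auto
      finally have "ln (norm (ext_power j Q)) \<le> ln (a * L * a)"
        using P_pos(2)[OF j] by (subst ln_le_cancel_iff) (use L a in auto)
      also have "\<dots> = ln L + (ln a + ln a)" using L a by (simp add: ln_mult)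
      also have "ln a + ln a \<le> n * (g j + \<eta> / 2) + n * (g j + \<eta> / 2)"
        unfolding a_def using j by (intro add_mono Pg) auto
      also have "\<dots> = 2 * n * (g' j + \<eta> / 2)" using False by (simp add: g'_def)
      finally have "ln (norm (ext_power j Q)) \<le> ln L + 2 * n * (g' j + \<eta> / 2)" by simp
      moreover have "ln (2::real) \<ge> 0" by simp
      ultimately show ?thesis by linarith
    qed
    have "ln (norm (ext_power j Q)) \<le> real (n + m + n) * (g' j + \<eta>)" if j: "j \<le> l" for j
    proof -
      have "\<bar>g' j\<bar> \<le> G" unfolding G_def by (rule member_le_sum) (use j in auto)
      then have "- G \<le> g' j" by linarith
      then have "m * (- G) \<le> m * g' j" by (intro mult_left_mono) auto
      moreover have "c \<le> n * \<eta>"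
      proof -
        have "c < n1 * \<eta>" using n1 \<eta> by (simp add: pos_divide_less_eq)
        also have "\<dots> \<le> n * \<eta>" using n \<eta> by (intro mult_right_mono) auto
        finally show ?thesis by simp
      qed
      moreover have "0 \<le> m * \<eta>" using \<eta> by simp
      ultimately have "ln 2 + ln L \<le> m * g' j + m * \<eta> + n * \<eta>" unfolding c_def by linarith
      moreover have "real (n + m + n) * (g' j + \<eta>) = 2 * n * (g' j + \<eta> / 2) + (m * g' j + m * \<eta> + n * \<eta>)"
        by (simp add: algebra_simps)
      ultimately show ?thesis using main[OF j] by linarith
    qed
    then show ?thesis using Q n by (intro exI[of _ "n + m + n"]) auto
  qed
  then show ?thesis unfolding attainable_def T'_def g'_def by blast
qed

text \<open>
  Averaging decreases the total of a sequence unless it is convex, so an almost minimal sequence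
  is almost convex and starts with a slope that is hardly above the mean slope.
\<close>

lemma averaging_reaches_mean_slope:
  fixes X :: "(nat \<Rightarrow> real) \<Rightarrow> bool"
  assumes avg: "\<And>g k. X g \<Longrightarrow> 1 \<le> k \<Longrightarrow> k < l \<Longrightarrow> X (g(k := (g (k - 1) + g (k + 1)) / 2))"
    and low: "\<And>g j. X g \<Longrightarrow> j \<le> l \<Longrightarrow> B \<le> g j"
    and g0: "X g0" and l: "l \<ge> 1" and e: "e > 0"
  obtains g where "X g" "g 1 \<le> g0 0 + (g0 l - g0 0) / l + e"
proof -
  define Y where "Y g \<longleftrightarrow> X g \<and> g 0 = g0 0 \<and> g l = g0 l" for g
  define \<Phi> where "\<Phi> g = (\<Sum>j\<le>l. g j)" for g :: "nat \<Rightarrow> real"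
  define \<eta> where "\<eta> = e / l"
  have \<eta>: "\<eta> > 0" using e l by (simp add: \<eta>_def)
  have bdd: "bdd_below (\<Phi> ` Collect Y)"
  proof (rule bdd_belowI2)
    fix g assume "g \<in> Collect Y"
    then have "(\<Sum>j\<le>l. B) \<le> \<Phi> g" unfolding \<Phi>_def by (intro sum_mono low) (auto simp: Y_def)
    then show "real (Suc l) * B \<le> \<Phi> g" by simp
  qed
  have "Collect Y \<noteq> {}" using g0 by (auto simp: Y_def)
  then obtain g where g: "Y g" "\<Phi> g < (INF g\<in>Collect Y. \<Phi> g) + \<eta>"
    using \<eta> cINF_less_iff[OF _ bdd, of "(INF g\<in>Collect Y. \<Phi> g) + \<eta>"] by auto
  have conv: "g k - (g (k - 1) + g (k + 1)) / 2 \<le> \<eta>" if k: "1 \<le> k" "k < l" for k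
  proof -
    define g' where "g' = g(k := (g (k - 1) + g (k + 1)) / 2)"
    have "Y g'" using g(1) k avg[of g k] by (auto simp: Y_def g'_def)
    then have "(INF g\<in>Collect Y. \<Phi> g) \<le> \<Phi> g'" by (intro cINF_lower[OF bdd]) simp
    moreover have "\<Phi> g' - \<Phi> g = (\<Sum>j\<le>l. if j = k then (g (k - 1) + g (k + 1)) / 2 - g k else 0)"
      unfolding \<Phi>_def g'_def sum_subtractf[symmetric] by (intro sum.cong) auto
    ultimately show ?thesis using g(2) k by simp
  qed
  have slope: "g (Suc j) - g j \<ge> g 1 - g 0 - 2 * j * \<eta>" if "j < l" for j
    using that
  proof (induction j)
    case (Suc j)
    then show ?case using conv[of "Suc j"] by (simp add: field_simps)
  qed simp
  have "g j - g 0 \<ge> j * (g 1 - g 0) - j\<^sup>2 * \<eta>" if "j \<le> l" for j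
    using that
  proof (induction j)
    case (Suc j)
    have "(real (Suc j))\<^sup>2 * \<eta> = j\<^sup>2 * \<eta> + 2 * j * \<eta> + \<eta>" by (simp add: power2_eq_square algebra_simps)
    then show ?case using Suc slope[of j] \<eta> by (simp add: algebra_simps)
  qed simp
  from this[of l] have "l * (g 1 - g 0) \<le> (g0 l - g0 0) + l * e"
    using g(1) l by (simp add: Y_def \<eta>_def power2_eq_square)
  then have "g 1 - g 0 \<le> (g0 l - g0 0) / l + e" using l by (simp add: field_simps)
  then show thesis using that[of g] g(1) by (auto simp: Y_def)
qed

text \<open>
  Start with products of \<open>S\<close> that nearly minimise the growth of the \<open>l\<close>-volume, with crude bounds for the
  other rates. Averaging at all indices \<open>k < l\<close> is possible, so the rate of the norm can be brought
  down to nearly \<open>1/l\<close> of the rate of the \<open>l\<close>-volume.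
\<close>

lemma lower_spectral_radius_thicken_le:
  fixes S :: "((real^'n) \<Rightarrow>\<^sub>L (real^'n)) set"
  assumes S: "S \<in> KGL" and T: "thicken \<delta> S \<in> KGL" and \<delta>: "0 < \<delta>" "\<delta> \<le> 1"
    and l: "1 \<le> l" "l \<le> CARD('n)" and nd: "\<And>k. 1 \<le> k \<Longrightarrow> k < l \<Longrightarrow> \<not> dominated k S" and e: "e > 0"
  shows "lower_spectral_radius (thicken \<delta> S) \<le> exp (ln (lower_spectral_radius (ext_power l ` S)) / l + e)"
proof -
  define r where "r = lower_spectral_radius (ext_power l ` S)"
  have bounded: "exp_bounded (ext_power l ` S)" by (rule exp_bounded_ext_power[OF S l(2)])
  have r: "r > 0" unfolding r_def by (rule lower_spectral_radius_basic(2)[OF bounded])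
  obtain K \<kappa> where K: "K \<ge> 1" "\<And>A. A \<in> thicken \<delta> S \<Longrightarrow> norm A \<le> K"
    and \<kappa>: "0 < \<kappa>" "\<kappa> \<le> 1" "\<And>A. A \<in> thicken \<delta> S \<Longrightarrow> expands_by \<kappa> A"
    using KGL_bounds[OF T] by metis
  have sub: "S \<subseteq> thicken \<delta> S" using \<delta> by (intro subset_thicken) simp
  define g0 where "g0 j = (if j = 0 then 0 else if j = l then ln r else l * ln K)" for j
  have init: "attainable (thicken \<delta> S) l g0"
    unfolding attainable_def
  proof (intro allI impI)
    fix \<eta> :: real and n0 :: nat assume \<eta>: "\<eta> > 0"
    have "r * (exp \<eta> - 1) > 0" using r \<eta> by simp
    then obtain N where N: "\<And>n. n \<ge> N \<Longrightarrow> \<exists>P\<in>products (ext_power l ` S) n. norm P \<le> (r + r * (exp \<eta> - 1)) ^ n"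
      using lower_spectral_radius_approx[OF bounded] unfolding r_def by blast
    define n where "n = max (max n0 N) 1"
    have n: "n \<ge> n0" "n \<ge> N" "n \<ge> 1" by (simp_all add: n_def)
    obtain P where P: "P \<in> products S n" "norm (ext_power l P) \<le> (r * exp \<eta>) ^ n"
      using N[OF n(2)] by (auto simp: products_ext_power[OF n(3)] algebra_simps)
    have PT: "P \<in> products (thicken \<delta> S) n" using P(1) products_mono[OF sub] by blast
    have PGL: "P \<in> GL" by (rule products_GL[OF S P(1)])
    have "ln (norm (ext_power j P)) \<le> n * (g0 j + \<eta>)" if j: "j \<le> l" for j
    proof -
      have pos: "norm (ext_power j P) > 0" using GL_norm_ext_power_pos[OF PGL] j l by simp
      consider "j = 0" | "j = l" | "j \<noteq> 0" "j \<noteq> l" by blast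
      then show ?thesis
      proof cases
        case 1
        then show ?thesis using \<eta> by (simp add: GL_norm_ext_power_0[OF PGL] g0_def)
      next
        case 2
        have "ln (norm (ext_power j P)) \<le> ln ((r * exp \<eta>) ^ n)"
          using P(2) pos 2 r by (subst ln_le_cancel_iff) auto
        also have "\<dots> = n * (ln r + \<eta>)" using r by (simp add: ln_realpow ln_mult)
        finally show ?thesis using 2 l by (simp add: g0_def)
      next
        case 3
        have "norm (ext_power j P) \<le> norm P ^ j" using j l by (intro GL_norm_ext_power_le PGL) auto
        also have "\<dots> \<le> (K ^ n) ^ j" by (intro power_mono norm_products_le[OF K(2) PT]) auto
        finally have "ln (norm (ext_power j P)) \<le> ln ((K ^ n) ^ j)"
          using pos K(1) by (subst ln_le_cancel_iff) auto
        also have "\<dots> = n * (j * ln K)" using K(1) by (simp add: ln_realpow)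
        also have "\<dots> \<le> n * (l * ln K + \<eta>)"
          using j K(1) \<eta> by (intro mult_left_mono add_increasing2 mult_right_mono) auto
        finally show ?thesis using 3 by (simp add: g0_def)
      qed
    qed
    then show "\<exists>n\<ge>n0. \<exists>P\<in>products (thicken \<delta> S) n. \<forall>j\<le>l. ln (norm (ext_power j P)) \<le> n * (g0 j + \<eta>)"
      using n(1) PT by blast
  qed
  have low: "l * ln \<kappa> \<le> g j" if g: "attainable (thicken \<delta> S) l g" and j: "j \<le> l" for g j
  proof (rule field_le_epsilon)
    fix \<eta> :: real assume "\<eta> > 0"
    then obtain n P where n: "n \<ge> 1" and P: "P \<in> products (thicken \<delta> S) n"
      and le: "ln (norm (ext_power j P)) \<le> n * (g j + \<eta>)"
      using g j unfolding attainable_def by meson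
    have PGL: "P \<in> GL" by (rule products_GL[OF T P])
    have "(\<kappa> ^ n) ^ j \<le> norm (ext_power j P)"
      using expands_by_products[OF \<kappa>(3) _ P] \<kappa>(1) j l by (intro GL_norm_ext_power_ge PGL) auto
    then have "ln ((\<kappa> ^ n) ^ j) \<le> ln (norm (ext_power j P))"
      using \<kappa>(1) GL_norm_ext_power_pos[OF PGL, of j] j l by (subst ln_le_cancel_iff) auto
    then have "n * (j * ln \<kappa>) \<le> n * (g j + \<eta>)" using le \<kappa>(1) by (simp add: ln_realpow mult_ac)
    then have "j * ln \<kappa> \<le> g j + \<eta>" using n by (simp add: mult_le_cancel_left)
    moreover have "l * ln \<kappa> \<le> j * ln \<kappa>" using j \<kappa> by (intro mult_right_mono_neg) auto
    ultimately show "l * ln \<kappa> \<le> g j + \<eta>" by linarith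
  qed
  have "e / 2 > 0" using e by simp
  obtain g where g: "attainable (thicken \<delta> S) l g" "g 1 \<le> g0 0 + (g0 l - g0 0) / l + e / 2"
  proof (rule averaging_reaches_mean_slope[where X = "attainable (thicken \<delta> S) l" and l = l
        and B = "l * ln \<kappa>" and e = "e / 2" and ?g0.0 = g0])
    show "attainable (thicken \<delta> S) l (g(k := (g (k - 1) + g (k + 1)) / 2))"
      if "attainable (thicken \<delta> S) l g" "1 \<le> k" "k < l" for g k
      by (rule attainable_average[OF S T \<delta> that(2,3) l(2) nd[OF that(2,3)] that(1)])
  qed (use low init l(1) \<open>e / 2 > 0\<close> in auto)
  obtain n P where n: "n \<ge> 1" and P: "P \<in> products (thicken \<delta> S) n"
    and le: "ln (norm (ext_power 1 P)) \<le> n * (g 1 + e / 2)"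
    using g(1) l(1) \<open>e / 2 > 0\<close> unfolding attainable_def by meson
  have PGL: "P \<in> GL" by (rule products_GL[OF T P])
  have pos: "norm P > 0" using GL_norm_ext_power_pos[OF PGL, of 1] l by (simp add: GL_norm_ext_power_1[OF PGL, unfolded One_nat_def])
  have "g 1 + e / 2 \<le> ln r / l + e" using g(2) l by (simp add: g0_def)
  then have "n * (g 1 + e / 2) \<le> n * (ln r / l + e)" by (intro mult_left_mono) auto
  then have "ln (norm P) \<le> n * (ln r / l + e)" using le by (simp add: GL_norm_ext_power_1[OF PGL, unfolded One_nat_def])
  then have "exp (ln (norm P)) \<le> exp (n * (ln r / l + e))" by (simp only: exp_le_cancel_iff)
  then have "norm P \<le> exp (ln r / l + e) ^ n" using pos by (simp only: exp_ln exp_of_nat_mult)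
  then show ?thesis
    unfolding r_def[symmetric] by (intro lower_spectral_radius_le[OF exp_bounded_KGL[OF T] P n]) auto
qed

section \<open>Hausdorff distance and the continuity criterion\<close>

lemma SUP_INF_norm_less_imp_near:
  fixes X Y :: "'a::real_normed_vector set"
  assumes bd: "bounded X" "bounded Y" and Y: "Y \<noteq> {}"
    and less: "(SUP x\<in>X. INF y\<in>Y. norm (x - y)) < \<delta>" and x: "x \<in> X"
  shows "\<exists>y\<in>Y. norm (x - y) \<le> \<delta>"
proof -
  obtain K L where K: "\<And>x. x \<in> X \<Longrightarrow> norm x \<le> K" and L: "\<And>y. y \<in> Y \<Longrightarrow> norm y \<le> L"
    using bd unfolding bounded_iff by blast
  obtain y0 where y0: "y0 \<in> Y" using Y by blast
  have below: "bdd_below ((\<lambda>y. norm (z - y)) ` Y)" for z by (rule bdd_belowI2[of _ 0]) auto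
  have "bdd_above ((\<lambda>x. INF y\<in>Y. norm (x - y)) ` X)"
  proof (rule bdd_aboveI2)
    fix z assume "z \<in> X"
    then show "(INF y\<in>Y. norm (z - y)) \<le> K + L"
      using cINF_lower[OF below y0, of z] K[of z] L[OF y0] norm_triangle_ineq4[of z y0] by linarith
  qed
  then have "(INF y\<in>Y. norm (x - y)) < \<delta>" using cSUP_upper[OF x] less by (meson le_less_trans)
  then obtain y where "y \<in> Y" "norm (x - y) < \<delta>" using cINF_less_iff[OF Y below] by auto
  then show ?thesis by (meson less_imp_le)
qed

lemma hausdorff_dist_approx:
  fixes S T :: "'a::real_normed_vector set"
  assumes ST: "bounded S" "bounded T" "S \<noteq> {}" "T \<noteq> {}" and d: "hausdorff_dist T S < \<delta>"
  shows "\<And>B. B \<in> T \<Longrightarrow> \<exists>A\<in>S. norm (A - B) \<le> \<delta>" "\<And>A. A \<in> S \<Longrightarrow> \<exists>B\<in>T. norm (B - A) \<le> \<delta>"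
proof -
  have *: "(SUP B\<in>T. INF A\<in>S. norm (B - A)) < \<delta>" "(SUP A\<in>S. INF B\<in>T. norm (A - B)) < \<delta>"
    using d unfolding hausdorff_dist_def by (simp_all add: norm_minus_commute)
  show "\<exists>A\<in>S. norm (A - B) \<le> \<delta>" if "B \<in> T" for B
    using SUP_INF_norm_less_imp_near[OF ST(2,1,3) *(1) that] by (metis norm_minus_commute)
  show "\<exists>B\<in>T. norm (B - A) \<le> \<delta>" if "A \<in> S" for A
    using SUP_INF_norm_less_imp_near[OF ST(1,2,4) *(2) that] by (metis norm_minus_commute)
qed

lemma hausdorff_dist_thicken_le:
  fixes S :: "'a::real_normed_vector set"
  assumes S: "S \<noteq> {}" and \<delta>: "\<delta> \<ge> 0"
  shows "hausdorff_dist (thicken \<delta> S) S \<le> \<delta>"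
proof -
  have bel: "bdd_below ((\<lambda>y. norm (f y)) ` X)" for f :: "'a \<Rightarrow> 'a" and X by (rule bdd_belowI2[of _ 0]) auto
  have ne: "thicken \<delta> S \<noteq> {}" using subset_thicken[OF \<delta>, of S] S by auto
  have "(SUP B\<in>thicken \<delta> S. INF A\<in>S. norm (B - A)) \<le> \<delta>"
  proof (rule cSUP_least[OF ne])
    fix B assume "B \<in> thicken \<delta> S"
    then obtain A where "A \<in> S" "norm (B - A) \<le> \<delta>" by (auto simp: thicken_def)
    then show "(INF A\<in>S. norm (B - A)) \<le> \<delta>" using cINF_lower[OF bel, of A S "\<lambda>A. B - A"] by linarith
  qed
  moreover have "(SUP A\<in>S. INF B\<in>thicken \<delta> S. norm (B - A)) \<le> \<delta>"
  proof (rule cSUP_least[OF S])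
    fix A assume "A \<in> S"
    then have "A \<in> thicken \<delta> S" using subset_thicken[OF \<delta>] by blast
    then show "(INF B\<in>thicken \<delta> S. norm (B - A)) \<le> \<delta>"
      using cINF_lower[OF bel, of A "thicken \<delta> S" "\<lambda>B. B - A"] \<delta> by simp
  qed
  ultimately show ?thesis by (simp add: hausdorff_dist_def)
qed

text \<open>
  One near-optimal product of \<open>S\<close> is approximated by a product of \<open>T\<close> of the same length.
\<close>

lemma lower_spectral_radius_upper_semicontinuous:
  fixes S :: "((real^'n) \<Rightarrow>\<^sub>L (real^'n)) set"
  assumes S: "S \<in> KGL" and e: "e > 0"
  shows "\<exists>\<delta>>0. \<forall>T\<in>KGL. hausdorff_dist T S < \<delta> \<longrightarrow> lower_spectral_radius T \<le> lower_spectral_radius S + e"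
proof -
  define r where "r = lower_spectral_radius S"
  have r: "r > 0" unfolding r_def by (rule lower_spectral_radius_basic(2)[OF exp_bounded_KGL[OF S]])
  obtain K where K: "K \<ge> 1" "\<And>A. A \<in> S \<Longrightarrow> norm A \<le> K" using KGL_bounds[OF S] by metis
  obtain n P where n: "n \<ge> 1" and P: "P \<in> products S n" "norm P \<le> (r + e / 2) ^ n"
    using lower_spectral_radius_approx[OF exp_bounded_KGL[OF S], of "e / 2"] e unfolding r_def
    by (metis half_gt_zero max.cobounded1 max.cobounded2)
  define \<eta> where "\<eta> = (r + e) ^ n - (r + e / 2) ^ n"
  have "(r + e / 2) ^ n < (r + e) ^ n" using r e n by (intro power_strict_mono) auto
  then have \<eta>: "\<eta> > 0" by (simp add: \<eta>_def)
  define \<delta> where "\<delta> = min 1 (\<eta> / (n * (K + 1) ^ n))"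
  have \<delta>: "\<delta> > 0" using \<eta> n K by (simp add: \<delta>_def)
  show ?thesis
  proof (intro exI[of _ \<delta>] conjI ballI impI \<delta>)
    fix T :: "((real^'n) \<Rightarrow>\<^sub>L (real^'n)) set" assume T: "T \<in> KGL" and d: "hausdorff_dist T S < \<delta>"
    have bd: "bounded S" "bounded T" "S \<noteq> {}" "T \<noteq> {}" using S T by (auto simp: KGL_def compact_imp_bounded)
    note near = hausdorff_dist_approx[OF bd d]
    have T_le: "norm B \<le> K + 1" if B: "B \<in> T" for B
    proof -
      obtain A where A: "A \<in> S" "norm (A - B) \<le> \<delta>" using near(1)[OF B] by blast
      have "norm B \<le> norm A + norm (A - B)" using norm_triangle_ineq4[of A "A - B"] by simp
      then show ?thesis using K(2)[OF A(1)] A(2) by (simp add: \<delta>_def)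
    qed
    have S_le: "norm A \<le> K + 1" if "A \<in> S" for A using K(2)[OF that] by simp
    obtain Q where Q: "Q \<in> products T n" "norm (Q - P) \<le> \<delta> * (n * (K + 1) ^ n)"
      using norm_products_near[OF S_le T_le _ _ near(2) P(1)] K(1) \<delta> by fastforce
    have "\<delta> * (n * (K + 1) ^ n) \<le> \<eta> / (n * (K + 1) ^ n) * (n * (K + 1) ^ n)"
      using K(1) by (intro mult_right_mono) (auto simp: \<delta>_def)
    also have "\<dots> = \<eta>" using K(1) n by simp
    finally have "norm Q \<le> (r + e) ^ n"
      using Q(2) P(2) norm_triangle_ineq[of P "Q - P"] by (simp add: \<eta>_def)
    then show "lower_spectral_radius T \<le> lower_spectral_radius S + e"
      unfolding r_def[symmetric] using r e
      by (intro lower_spectral_radius_le[OF exp_bounded_KGL[OF T] Q(1) n]) auto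
  qed
qed

lemma lower_spectral_radius_ext_power_le:
  fixes T :: "((real^'n) \<Rightarrow>\<^sub>L (real^'n)) set"
  assumes T: "T \<in> KGL" and l: "l \<le> CARD('n)"
  shows "lower_spectral_radius (ext_power l ` T) \<le> lower_spectral_radius T ^ l"
proof (rule tendsto_lowerbound)
  define r where "r = lower_spectral_radius T"
  have r: "r > 0" unfolding r_def by (rule lower_spectral_radius_basic(2)[OF exp_bounded_KGL[OF T]])
  show "((\<lambda>e. (r + e) ^ l) \<longlongrightarrow> lower_spectral_radius T ^ l) (at_right 0)"
    unfolding r_def by (auto intro!: tendsto_eq_intros)
  show "\<forall>\<^sub>F e in at_right 0. lower_spectral_radius (ext_power l ` T) \<le> (r + e) ^ l"
    using eventually_at_right_less[of "0::real"]
  proof eventually_elim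
    case (elim e)
    obtain N where N: "\<And>n. n \<ge> N \<Longrightarrow> \<exists>P\<in>products T n. norm P \<le> (r + e) ^ n"
      using lower_spectral_radius_approx[OF exp_bounded_KGL[OF T] elim] unfolding r_def by blast
    obtain P where P: "P \<in> products T (max N 1)" "norm P \<le> (r + e) ^ max N 1" using N[of "max N 1"] by auto
    have "norm (ext_power l P) \<le> norm P ^ l" by (rule GL_norm_ext_power_le[OF products_GL[OF T P(1)] l])
    also have "\<dots> \<le> ((r + e) ^ max N 1) ^ l" using P(2) by (intro power_mono) auto
    also have "\<dots> = ((r + e) ^ l) ^ max N 1" by (simp add: power_mult[symmetric] mult.commute)
    finally have "norm (ext_power l P) \<le> ((r + e) ^ l) ^ max N 1" .
    moreover have "ext_power l P \<in> products (ext_power l ` T) (max N 1)"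
      using P(1) by (simp add: products_ext_power)
    ultimately show ?case
      using r elim by (intro lower_spectral_radius_le[OF exp_bounded_ext_power[OF T l]]) auto
  qed
qed simp

lemma ell_props:
  fixes S :: "((real^'n) \<Rightarrow>\<^sub>L (real^'n)) set"
  shows "1 \<le> ell S" "ell S \<le> CARD('n)" "dominated (ell S) S" "1 \<le> k \<Longrightarrow> k < ell S \<Longrightarrow> \<not> dominated k S"
proof -
  let ?X = "{k \<in> {1..CARD('n)}. dominated k S}"
  have "CARD('n) \<in> ?X" by (simp add: dominated_def Suc_le_eq)
  then have "ell S \<in> ?X" unfolding ell_def by (intro Min_in) auto
  then show l: "1 \<le> ell S" "ell S \<le> CARD('n)" "dominated (ell S) S" by auto
  show "\<not> dominated k S" if "1 \<le> k" "k < ell S"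
  proof
    assume "dominated k S"
    then have "ell S \<le> k" unfolding ell_def using that l(2) by (intro Min_le) auto
    then show False using that(2) by simp
  qed
qed

text \<open>
  \<open>A \<mapsto> \<and>\<^sup>l A\<close> is uniformly continuous on bounded sets, so \<open>\<and>\<^sup>l T\<close> is a small perturbation of the gapped alphabet
  \<open>\<and>\<^sup>l S\<close>.
\<close>

lemma lower_spectral_radius_ext_power_lower_semicontinuous:
  fixes S :: "((real^'n) \<Rightarrow>\<^sub>L (real^'n)) set"
  assumes S: "S \<in> KGL" and l: "1 \<le> l" "l \<le> CARD('n)" and dom: "dominated l S" and e: "e > 0"
  shows "\<exists>\<delta>>0. \<forall>T\<in>KGL. hausdorff_dist T S < \<delta> \<longrightarrow>
    lower_spectral_radius (ext_power l ` S) - e \<le> lower_spectral_radius (ext_power l ` T)"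
proof -
  obtain K where K: "K \<ge> 1" "\<And>A. A \<in> S \<Longrightarrow> norm A \<le> K" using KGL_bounds[OF S] by metis
  obtain K' C \<tau> where gp: "gapped_products (ext_power l ` S) K' C \<tau>" using gapped_products_ext_power[OF S l dom] by blast
  obtain \<delta>1 where \<delta>1: "\<delta>1 > 0" and lsc: "\<And>T. exp_bounded T \<Longrightarrow> \<forall>B\<in>T. \<exists>A\<in>ext_power l ` S. norm (A - B) \<le> \<delta>1 \<Longrightarrow>
      lower_spectral_radius (ext_power l ` S) - e \<le> lower_spectral_radius T"
    using gapped_products.lower_spectral_radius_lower_semicontinuous[OF gp exp_bounded_ext_power[OF S l(2)] e] by blast
  have "uniformly_continuous_on (cball 0 (K + 1)) (ext_power l :: ((real^'n) \<Rightarrow>\<^sub>L (real^'n)) \<Rightarrow> _)"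
    by (intro compact_uniformly_continuous continuous_on_subset[OF continuous_on_ext_power]) auto
  then obtain \<delta>2 where \<delta>2: "\<delta>2 > 0" and uc: "\<And>A B :: (real^'n) \<Rightarrow>\<^sub>L (real^'n). norm A \<le> K + 1 \<Longrightarrow> norm B \<le> K + 1 \<Longrightarrow>
      norm (A - B) < \<delta>2 \<Longrightarrow> norm (ext_power l A - ext_power l B) < \<delta>1"
    using \<delta>1 unfolding uniformly_continuous_on_def by (fastforce simp: dist_norm)
  define \<delta> where "\<delta> = min 1 (\<delta>2 / 2)"
  show ?thesis
  proof (intro exI[of _ \<delta>] conjI ballI impI)
    show "\<delta> > 0" using \<delta>2 by (simp add: \<delta>_def)
    fix T :: "((real^'n) \<Rightarrow>\<^sub>L (real^'n)) set" assume T: "T \<in> KGL" and d: "hausdorff_dist T S < \<delta>"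
    have bd: "bounded S" "bounded T" "S \<noteq> {}" "T \<noteq> {}" using S T by (auto simp: KGL_def compact_imp_bounded)
    show "lower_spectral_radius (ext_power l ` S) - e \<le> lower_spectral_radius (ext_power l ` T)"
    proof (rule lsc[OF exp_bounded_ext_power[OF T l(2)]], rule ballI)
      fix B' assume "B' \<in> ext_power l ` T"
      then obtain B where B: "B \<in> T" "B' = ext_power l B" by blast
      obtain A where A: "A \<in> S" "norm (A - B) \<le> \<delta>" using hausdorff_dist_approx(1)[OF bd d B(1)] by blast
      have "norm B \<le> norm A + norm (A - B)" using norm_triangle_ineq4[of A "A - B"] by simp
      then have "norm B \<le> K + 1" using K(2)[OF A(1)] A(2) by (simp add: \<delta>_def)
      then have "norm (ext_power l A - B') < \<delta>1"
        unfolding B(2) using K(2)[OF A(1)] A(2) \<delta>2 by (intro uc) (auto simp: \<delta>_def)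
      then show "\<exists>A\<in>ext_power l ` S. norm (A - B') \<le> \<delta>1" using A(1) by (auto intro: less_imp_le)
    qed
  qed
qed

theorem corollary1p1:
  fixes S :: "((real^'n) \<Rightarrow>\<^sub>L (real^'n)) set"
  assumes "S \<in> KGL"
  shows "KGL_continuous_at lower_spectral_radius S \<longleftrightarrow>
    lower_spectral_radius S = root (ell S) (lower_spectral_radius (ext_power (ell S) ` S))"
proof -
  define l where "l = ell S"
  define r where "r = lower_spectral_radius S"
  define \<rho> where "\<rho> = lower_spectral_radius (ext_power l ` S)"
  have l: "1 \<le> l" "l \<le> CARD('n)" and dom: "dominated l S" and nd: "\<And>k. 1 \<le> k \<Longrightarrow> k < l \<Longrightarrow> \<not> dominated k S"
    unfolding l_def using ell_props(1-3)[of S] ell_props(4)[of _ S] by blast+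
  have r: "r > 0" unfolding r_def by (rule lower_spectral_radius_basic(2)[OF exp_bounded_KGL[OF assms]])
  have \<rho>: "\<rho> > 0" unfolding \<rho>_def by (rule lower_spectral_radius_basic(2)[OF exp_bounded_ext_power[OF assms l(2)]])
  have le: "root l \<rho> \<le> r"
  proof -
    have "root l \<rho> \<le> root l (r ^ l)"
      unfolding \<rho>_def r_def using l by (intro real_root_le_mono lower_spectral_radius_ext_power_le[OF assms]) auto
    then show ?thesis using r l by (simp add: real_root_power_cancel)
  qed
  have "KGL_continuous_at lower_spectral_radius S \<longleftrightarrow> r = root l \<rho>"
  proof
    assume cont: "KGL_continuous_at lower_spectral_radius S"
    have "r \<le> root l \<rho>"
    proof (rule tendsto_lowerbound)
      show "((\<lambda>e. exp (ln \<rho> / l + e) + e) \<longlongrightarrow> root l \<rho>) (at_right 0)"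
      proof -
        have "root l \<rho> = exp (ln \<rho> / l)" using \<rho> l by (simp add: root_powr_inverse powr_def)
        then show ?thesis by (auto intro!: tendsto_eq_intros)
      qed
      show "\<forall>\<^sub>F e in at_right 0. r \<le> exp (ln \<rho> / l + e) + e"
        using eventually_at_right_less[of "0::real"]
      proof eventually_elim
        case (elim e)
        obtain \<delta> where \<delta>: "\<delta> > 0" "\<And>T. T \<in> KGL \<Longrightarrow> hausdorff_dist T S < \<delta> \<Longrightarrow> \<bar>lower_spectral_radius T - r\<bar> < e"
          using cont elim unfolding KGL_continuous_at_def r_def by blast
        obtain \<delta>0 where \<delta>0: "\<delta>0 > 0" "\<And>\<delta>. 0 \<le> \<delta> \<Longrightarrow> \<delta> \<le> \<delta>0 \<Longrightarrow> thicken \<delta> S \<in> KGL"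
          using thicken_KGL[OF assms] by blast
        \<comment> \<open>the neighbourhood itself is the perturbation that lowers the radius\<close>
        define \<delta>' where "\<delta>' = min (min 1 \<delta>0) (\<delta> / 2)"
        have \<delta>': "0 < \<delta>'" "\<delta>' \<le> 1" "\<delta>' \<le> \<delta>0" "\<delta>' < \<delta>" using \<delta>(1) \<delta>0(1) by (auto simp: \<delta>'_def)
        have T: "thicken \<delta>' S \<in> KGL" using \<delta>0(2) \<delta>' by simp
        have "hausdorff_dist (thicken \<delta>' S) S \<le> \<delta>'"
          using assms \<delta>' by (intro hausdorff_dist_thicken_le) (auto simp: KGL_def)
        then have "\<bar>lower_spectral_radius (thicken \<delta>' S) - r\<bar> < e" using \<delta>(2)[OF T] \<delta>'(4) by linarith
        moreover have "lower_spectral_radius (thicken \<delta>' S) \<le> exp (ln \<rho> / l + e)"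
          unfolding \<rho>_def by (rule lower_spectral_radius_thicken_le[OF assms T \<delta>'(1,2) l nd elim])
        ultimately show ?case by linarith
      qed
    qed simp
    then show "r = root l \<rho>" using le by simp
  next
    assume eq: "r = root l \<rho>"
    then have rl: "r ^ l = \<rho>" using \<rho> l by simp
    show "KGL_continuous_at lower_spectral_radius S"
      unfolding KGL_continuous_at_def
    proof (intro allI impI)
      fix e :: real assume e: "e > 0"
      \<comment> \<open>a positive number between \<open>r - e\<close> and \<open>r\<close>, so that \<open>l\<close>-th powers preserve the order\<close>
      define a where "a = max (r / 2) (r - e / 2)"
      have a: "0 < a" "a < r" "r - e < a" using r e by (auto simp: a_def max_def)
      have "a ^ l < \<rho>" unfolding rl[symmetric] using a l by (intro power_strict_mono) auto
      then have "\<rho> - a ^ l > 0" by simp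
      then obtain \<delta>1 where \<delta>1: "\<delta>1 > 0" "\<And>T. T \<in> KGL \<Longrightarrow> hausdorff_dist T S < \<delta>1 \<Longrightarrow>
          \<rho> - (\<rho> - a ^ l) \<le> lower_spectral_radius (ext_power l ` T)"
        using lower_spectral_radius_ext_power_lower_semicontinuous[OF assms l dom, of "\<rho> - a ^ l"]
        unfolding \<rho>_def by blast
      obtain \<delta>2 where \<delta>2: "\<delta>2 > 0" "\<And>T. T \<in> KGL \<Longrightarrow> hausdorff_dist T S < \<delta>2 \<Longrightarrow>
          lower_spectral_radius T \<le> r + e / 2"
        using lower_spectral_radius_upper_semicontinuous[OF assms, of "e / 2"] e unfolding r_def by auto
      have "\<bar>lower_spectral_radius T - lower_spectral_radius S\<bar> < e"
        if T: "T \<in> KGL" and d: "hausdorff_dist T S < min \<delta>1 \<delta>2" for T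
      proof -
        have "a ^ l \<le> lower_spectral_radius T ^ l"
          using \<delta>1(2)[OF T] d lower_spectral_radius_ext_power_le[OF T l(2)] by simp
        then have "a \<le> lower_spectral_radius T"
          using l a lower_spectral_radius_basic(2)[OF exp_bounded_KGL[OF T]] by (simp add: power_mono_iff)
        moreover have "lower_spectral_radius T \<le> r + e / 2" using \<delta>2(2)[OF T] d by simp
        ultimately show ?thesis using a(3) e unfolding r_def[symmetric] by linarith
      qed
      then show "\<exists>\<delta>>0. \<forall>T\<in>KGL. hausdorff_dist T S < \<delta> \<longrightarrow>
          \<bar>lower_spectral_radius T - lower_spectral_radius S\<bar> < e"
        using \<delta>1(1) \<delta>2(1) by (intro exI[of _ "min \<delta>1 \<delta>2"]) auto
    qed
  qed
  then show ?thesis unfolding r_def \<rho>_def l_def .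
qed

end
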